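(* Let $\bar\kappa\ge1$ be a real number. The following hold. (1) If $m=m(n)$ satisfies $m=o(\ln n)$ as $n\to\infty$, then $$\sup_{\substack{A \in \mathcal{S}^n_{++} \\ \kappa(A) =\bar \kappa}} \mathbb{P}_{b \sim \mathcal{U}(S^{n-1})} \left[ \frac{\kappa(A) -\kappa^{(m)}(A,b)}{\kappa^{(m)}(A,b)} \ge (1-o(1)) (\bar \kappa -1)\right] \ge 1 - o(1/n).$$ (2) If $m=m(n)$ satisfies $m=\Theta(\ln n)$ as $n\to\infty$, then $$\sup_{\substack{A \in \mathcal{S}^n_{++} \\ \kappa(A) =\bar \kappa}} \mathbb{P}_{b \sim \mathcal{U}(S^{n-1})} \left[ \frac{\kappa(A) -\kappa^{(m)}(A,b)}{\kappa^{(m)}(A,b)} \ge .015 \, \frac{(\bar \kappa -1) \ln^2 n}{ m^2 \ln^2 \ln n} \right] \ge 1 - o(1/n).$$ (3) If $m=m(n)$ satisfies $m=o\left(n^{1/2}\ln^{-1/2}n\right)$ and $m=\omega(1)$ as $n\to\infty$, then $$\sup_{\substack{A \in \mathcal{S}^n_{++} \\ \kappa(A) =\bar \kappa}} \mathbb{P}_{b \sim \mathcal{U}(S^{n-1})} \left[ \frac{\kappa(A) -\kappa^{(m)}(A,b)}{\kappa^{(m)}(A,b)}\ge 1.08 \, \frac{\bar \kappa -1}{m^2} \right] \ge 1 - o(1/n).$$ (4) For all integers $n\ge100$, $m\ge10$ and all real $p\ge1$, $$\sup_{\substack{A \in \mathcal{S}^n_{++} \\ \kappa(A) =\bar \kappa}}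 \mathbb{E}_{b \sim \mathcal{U}(S^{n-1})} \left[ \left( \frac{\kappa(A) -\kappa^{(m)}(A,b)}{\kappa(A)} \right)^p \right]^{1/p} \le .068\, (\bar \kappa +1) \, \frac{ \ln^2 \left(n(m-1)^{8p}\right) }{ (m-1)^2}.$$
   Context: $\mathcal{S}^n_{++}$ is the set of real symmetric positive definite $n\times n$ matrices; the eigenvalues of $A$, with multiplicity, are $\lambda_1(A)\ge\dots\ge\lambda_n(A)>0$, and $\kappa(A)=\lambda_1(A)/\lambda_n(A)$ is the condition number. $\mathcal{U}(S^{n-1})$ is the uniform probability measure on $S^{n-1}=\{x\in\mathbb{R}^n : \|x\|=1\}$. For a positive integer $m$ and nonzero $b\in\mathbb{R}^n$, the Krylov subspace is $\mathcal{K}_m(A,b)=\mathrm{span}\{b,Ab,\dots,A^{m-1}b\}$. The largest and smallest Ritz values after $m$ iterations of the Lanczos method are $$\lambda_1^{(m)}(A,b)=\max_{x\in\mathcal{K}_m(A,b),\,x\neq 0}\frac{x^TAx}{x^Tx},\qquad \lambda_m^{(m)}(A,b)=\min_{x\in\mathcal{K}_m(A,b),\,x\neq 0}\frac{x^TAx}{x^Tx},$$ and $\kappa^{(m)}(A,b)=\lambda_1^{(m)}(A,b)/\lambda_m^{(m)}(A,b)$ (the condition number of the tridiagonal matrix produced by the Lanczos method). Asymptotic notation is as $n\to\infty$, with $m=m(n)$ positive-integer-valued: $f=o(g)$ means $f(n)/g(n)\to0$; $f=\omega(g)$ means $g=o(f)$; $f=\Theta(g)$ means $f=O(g)$ and $g=O(f)$.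 In (1)–(3), given $\bar\kappa$ and the function $m(n)$, the claim is that there is a sequence $\eta_n$ with $n\eta_n\to0$ (and in (1) also a sequence $\varepsilon_n\to0$) such that the inequality holds for all sufficiently large $n$ with $o(1/n)$ replaced by $\eta_n$ (and $o(1)$ replaced by $\varepsilon_n$). *)

theory Defs
  imports
    "HOL-Probability.Probability"
    "HOL-Library.Landau_Symbols"
    "Jordan_Normal_Form.Spectral_Radius"
begin

unbundle no vec_syntax
unbundle no inner_syntax

definition spd_mats :: "nat \<Rightarrow> real mat set" where
  "spd_mats n = {A \<in> carrier_mat n n. transpose_mat A = A \<and>
     (\<forall>x \<in> carrier_vec n. x \<noteq> 0\<^sub>v n \<longrightarrow> 0 < x \<bullet> (A *\<^sub>v x))}"

text \<open>For a symmetric matrix all eigenvalues are real, so the real spectrum contains all of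
  them; its maximum and minimum do not depend on multiplicities.\<close>

definition eig_max :: "real mat \<Rightarrow> real" where
  "eig_max A = Max (spectrum A)"

definition eig_min :: "real mat \<Rightarrow> real" where
  "eig_min A = Min (spectrum A)"

definition cond_num :: "real mat \<Rightarrow> real" where
  "cond_num A = eig_max A / eig_min A"

definition krylov :: "real mat \<Rightarrow> real vec \<Rightarrow> nat \<Rightarrow> real vec set" where
  "krylov A b m = LinearCombinations.module.span class_ring (module_vec TYPE(real) (dim_vec b))
     ((\<lambda>k. (A ^\<^sub>m k) *\<^sub>v b) ` {..<m})"

definition rayleigh :: "real mat \<Rightarrow> real vec \<Rightarrow> real" where
  "rayleigh A x = (x \<bullet> (A *\<^sub>v x)) / (x \<bullet> x)"

text \<open>The Rayleigh quotient attains its maximum and minimum over the nonzero vectors of a nonzero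
  subspace.  \<open>Max\<close> and \<open>Min\<close> cannot be used here, since the set of values is
  in general infinite; \<open>GREATEST\<close> and \<open>LEAST\<close> pick the attained extrema.\<close>

definition ritz_max :: "real mat \<Rightarrow> real vec \<Rightarrow> nat \<Rightarrow> real" where
  "ritz_max A b m =
     (GREATEST r. \<exists>x \<in> krylov A b m. x \<noteq> 0\<^sub>v (dim_vec b) \<and> r = rayleigh A x)"

definition ritz_min :: "real mat \<Rightarrow> real vec \<Rightarrow> nat \<Rightarrow> real" where
  "ritz_min A b m =
     (LEAST r. \<exists>x \<in> krylov A b m. x \<noteq> 0\<^sub>v (dim_vec b) \<and> r = rayleigh A x)"

definition lanczos_cond :: "real mat \<Rightarrow> real vec \<Rightarrow> nat \<Rightarrow> real" where
  "lanczos_cond A b m = ritz_max A b m / ritz_min A b m"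

definition borel_vec :: "nat \<Rightarrow> real vec measure" where
  "borel_vec n = vimage_algebra (carrier_vec n) (\<lambda>v. \<lambda>i\<in>{..<n}. v $ i)
     (\<Pi>\<^sub>M i\<in>{..<n}. borel)"

definition lborel_vec :: "nat \<Rightarrow> real vec measure" where
  "lborel_vec n = distr (\<Pi>\<^sub>M i\<in>{..<n}. lborel) (borel_vec n) (vec n)"

definition unit_sphere :: "nat \<Rightarrow> real vec set" where
  "unit_sphere n = {v \<in> carrier_vec n. sqrt (v \<bullet> v) = 1}"

definition punctured_ball :: "nat \<Rightarrow> real vec set" where
  "punctured_ball n = {v \<in> carrier_vec n. v \<noteq> 0\<^sub>v n \<and> sqrt (v \<bullet> v) \<le> 1}"

text \<open>The uniform (rotation-invariant, i.e. normalised surface) probability measure on the sphere,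
  realised as the law of \<open>v / \<parallel>v\<parallel>\<close> for \<open>v\<close> uniform in the unit ball: a Borel set
  \<open>E\<close> of the sphere gets the fraction of the ball's volume lying in the cone over \<open>E\<close>.
  The origin, a null set for \<open>n \<ge> 1\<close>, is removed so that \<open>v / \<parallel>v\<parallel>\<close>
  always lies on the sphere.\<close>

definition uniform_sphere :: "nat \<Rightarrow> real vec measure" where
  "uniform_sphere n =
     distr (uniform_measure (restrict_space (lborel_vec n) (punctured_ball n)) (punctured_ball n))
       (restrict_space (borel_vec n) (unit_sphere n))
       (\<lambda>v. (1 / sqrt (v \<bullet> v)) \<cdot>\<^sub>v v)"

end

theory Submission
  imports Defs "HOL-Real_Asymp.Real_Asymp"
begin

text \<open>
  All four statements are invariant under scaling of \<open>A\<close>, so one may think of the eigenvalues as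
  \<open>1 + (\<kappa> - 1) x\<close> with \<open>x \<in> [0, 1]\<close>. The Krylov space consists of the vectors \<open>P(A) b\<close> with
  \<open>deg P < m\<close> (\<open>krylov_eq\<close>), and the Rayleigh quotient of such a vector is a quotient of two values of
  a linear functional on polynomials. Everything therefore depends on how a polynomial of degree
  below \<open>m\<close> can distribute its mass over the spectrum, and Chebyshev polynomials answer this in
  both directions.

  Lower bounds. Let \<open>A\<close> be diagonal with one simple eigenvalue at \<open>x = 0\<close>, and with the zeros of the
  \<open>m\<close>-th Chebyshev polynomial of an interval \<open>[t, 1]\<close> as further eigenvalues, each of multiplicity about \<open>n / m\<close>.
  By Lagrange interpolation (\<open>heavy_nodes\<close>) the value of a polynomial of degree below \<open>m\<close>
  at \<open>0\<close> is controlled by its values at these nodes, with a constant of the order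
  \<open>((1 + \<surd>t) / (1 - \<surd>t))\<^bsup>2m\<^esup> / (m t)\<close>. A random \<open>b\<close> puts a weight of about \<open>1 / m\<close> on every
  cluster, but only \<open>O(ln n / n)\<close> on the simple eigenvalue, up to an event of probability
  \<open>O(1 / n\<^sup>2)\<close> (\<open>uniform_sphere_cluster_tail\<close>). Hence no Krylov vector is concentrated near \<open>x = 0\<close>,
  and the smallest Ritz value is at least \<open>1 + (\<kappa> - 1) \<tau>\<close> for \<open>\<tau>\<close> slightly below \<open>t\<close>
  (\<open>lanczos_hard_instance\<close>). Since the largest Ritz value is at most \<open>\<kappa>\<close>, the relative error of the
  condition number is at least \<open>(\<kappa> - 1) \<tau>\<close>. The first three statements differ only in the
  choice of \<open>t\<close>: close to \<open>1\<close>, constant, and \<open>1.2 / m\<^sup>2\<close>.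

  Upper bound. Chebyshev polynomials of the third kind are small on \<open>[t, 1]\<close> in the sense needed
  here and grow like \<open>((1 + \<surd>t) / (1 - \<surd>t))\<^sup>k\<close> at \<open>0\<close>. Smallness is certified by a
  polynomial identity with a sum of weighted squares (\<open>light_polynomial\<close>), so it passes to any
  symmetric matrix whose extremal eigenvalues are known. If \<open>b\<close> has a component of size \<open>\<theta>\<close> along
  both extremal eigenvectors, both extremal Ritz values have an error of at most
  \<open>t + 1 / (\<rho> \<theta>\<^sup>2)\<close> relative to the length of the spectrum, where \<open>\<rho>\<close> is the squared growth
  factor (\<open>lanczos_relative_error_le\<close>). Small components are rare by an anti-concentration
  estimate on the sphere (\<open>uniform_sphere_slab\<close>), and integration gives the moment bound.

  Probabilities on the sphere are computed with Gaussian vectors. The uniform distribution is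
  defined by the volumes of cones inside the unit ball, and for every radial integrand the part of an
  integral over a cone is the same fraction of the whole (\<open>cone_radial_integral\<close>); the Gaussian
  density is the radial function that is also a product. The extremal Ritz values are
  attained, by compactness (\<open>rayleigh_attains\<close>), and for diagonal \<open>A\<close> they depend measurably on
  \<open>b\<close>, because strict inequalities for them can be tested on countably many polynomials
  (\<open>sets_exists_poly\<close>).
\<close>

section \<open>Chebyshev polynomials\<close>

text \<open>Chebyshev polynomials of the first kind.\<close>

fun cheb :: "nat \<Rightarrow> real poly" where
  "cheb 0 = 1"
| "cheb (Suc 0) = [:0, 1:]"
| "cheb (Suc (Suc n)) = [:0, 2:] * cheb (Suc n) - cheb n"

lemma poly_cheb_cos: "poly (cheb n) (cos x) = cos (real n * x)"
proof (induction n rule: cheb.induct)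
  case (3 n)
  have "cos (real (Suc (Suc n)) * x) + cos (real n * x)
      = 2 * cos x * cos (real (Suc n) * x)"
  proof -
    have a: "real (Suc (Suc n)) * x = real (Suc n) * x + x"
      and b: "real n * x = real (Suc n) * x - x" by (simp_all add: algebra_simps)
    show ?thesis unfolding a b cos_add cos_diff by simp
  qed
  then show ?case using 3 by (simp add: algebra_simps)
qed auto

lemma degree_cheb: "degree (cheb n) \<le> n"
proof (induction n rule: cheb.induct)
  case (3 n)
  have "degree ([:0, 2:] * cheb (Suc n)) \<le> 1 + Suc n"
    by (rule order_trans[OF degree_mult_le]) (use 3 in simp)
  then show ?case using 3 by (auto intro!: degree_diff_le)
qed auto

lemma poly_cheb_joukowski:
  assumes "w \<noteq> 0"
  shows "poly (cheb n) ((w + 1 / w) / 2) = (w ^ n + 1 / w ^ n) / 2"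
proof -
  define v where "v = 1 / w"
  have wv: "w * v = 1" using assms by (simp add: v_def)
  have "poly (cheb n) ((w + v) / 2) = (w ^ n + v ^ n) / 2"
  proof (induction n rule: cheb.induct)
    case (3 n)
    have id: "2 * ((w + v) / 2) * ((w * a + v * b) / 2) - (a + b) / 2
        = (w * (w * a) + v * (v * b) + (w * v) * a + (w * v) * b - (a + b)) / 2" for a b
      by (simp add: field_simps)
    have "poly (cheb (Suc (Suc n))) ((w + v) / 2)
        = 2 * ((w + v) / 2) * ((w * w ^ n + v * v ^ n) / 2) - (w ^ n + v ^ n) / 2"
      unfolding cheb.simps poly_diff poly_mult 3 by simp
    also have "\<dots> = (w ^ Suc (Suc n) + v ^ Suc (Suc n)) / 2"
      unfolding id wv by simp
    finally show ?case .
  qed simp_all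
  then show ?thesis by (simp add: v_def power_one_over)
qed

lemma abs_poly_cheb_le:
  assumes "1 \<le> \<bar>w\<bar>"
  shows "\<bar>poly (cheb n) ((w + 1 / w) / 2)\<bar> \<le> \<bar>w\<bar> ^ n"
proof -
  have w0: "w \<noteq> 0" using assms by auto
  have 1: "1 \<le> \<bar>w\<bar> ^ n" using assms by simp
  have "\<bar>poly (cheb n) ((w + 1 / w) / 2)\<bar> \<le> (\<bar>w\<bar> ^ n + 1 / \<bar>w\<bar> ^ n) / 2"
  proof -
    have "\<bar>w ^ n + 1 / w ^ n\<bar> \<le> \<bar>w ^ n\<bar> + \<bar>1 / w ^ n\<bar>" by (rule abs_triangle_ineq)
    then show ?thesis unfolding poly_cheb_joukowski[OF w0] by (simp add: power_abs)
  qed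
  also have "1 / \<bar>w\<bar> ^ n \<le> \<bar>w\<bar> ^ n"
  proof -
    have "0 < \<bar>w\<bar> ^ n" using 1 by linarith
    then have "1 / \<bar>w\<bar> ^ n \<le> 1" using 1 by (simp only: divide_le_eq_1_pos)
    then show ?thesis using 1 by linarith
  qed
  finally show ?thesis by simp
qed

text \<open>Differentiation of \<open>T\<^sub>n (cos x) = cos (n x)\<close>. At the zeros of \<open>T\<^sub>n\<close> the
  right-hand side is \<open>\<plusminus>n\<close>, which yields the denominators of the Lagrange basis polynomials
  with these zeros as nodes.\<close>

lemma pderiv_cheb_cos:
  "poly (pderiv (cheb n)) (cos x) * sin x = real n * sin (real n * x)"
proof -
  have "((\<lambda>x. poly (cheb n) (cos x)) has_real_derivative poly (pderiv (cheb n)) (cos x) * (- sin x)) (at x)"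
    by (rule DERIV_chain2[OF poly_DERIV]) (auto intro!: derivative_eq_intros)
  moreover have "((\<lambda>x. poly (cheb n) (cos x)) has_real_derivative - sin (real n * x) * real n) (at x)"
    unfolding poly_cheb_cos by (auto intro!: derivative_eq_intros)
  ultimately show ?thesis using DERIV_unique by (fastforce simp: mult.commute)
qed

text \<open>Lagrange interpolation at the zeros \<open>u k = cos \<theta>\<^sub>k\<close> of \<open>T\<^sub>m\<close>, evaluated at a
  point \<open>v\<close> outside \<open>[-1, 1]\<close>: the \<open>k\<close>-th basis polynomial has the value
  \<open>T\<^sub>m(v) / (T\<^sub>m'(u k) (v - u k))\<close>, and \<open>\<bar>T\<^sub>m'(u k)\<bar> = m / sin \<theta>\<^sub>k\<close>. By Cauchy-Schwarz it
  remains to add up the squares of these values. With \<open>a = 1 + u k\<close> one has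
  \<open>sin\<^sup>2 \<theta>\<^sub>k = a (2 - a) \<le> 2 a \<le> (s + a)\<^sup>2 / (2 s)\<close>, so each square is at most
  \<open>T\<^sub>m(v)\<^sup>2 / (2 m\<^sup>2 s)\<close>. The factor \<open>1 / m\<close> that is left after the summation is what
  allows \<open>m\<close> to grow almost like \<open>\<surd>n\<close> in the lower bounds.\<close>

lemma cheb_extrapolation:
  fixes P :: "real poly" and s :: real and m :: nat
  defines "u \<equiv> \<lambda>k::nat. cos ((2 * real k + 1) * pi / (2 * real m))"
  assumes s: "0 < s" and deg: "degree P < m"
  shows "(poly P (- (1 + s)))\<^sup>2
    \<le> (poly (cheb m) (- (1 + s)))\<^sup>2 / (2 * real m * s) * (\<Sum>k<m. (poly P (u k))\<^sup>2)"
proof -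
  define th where "th k = (2 * real k + 1) * pi / (2 * real m)" for k :: nat
  define v where "v = - (1 + s)"
  define T where "T = poly (cheb m) v"
  have m: "0 < m" using deg by simp
  have u: "u k = cos (th k)" for k by (simp add: u_def th_def)
  have th: "0 < th k" "th k < pi" if "k < m" for k
  proof -
    show "0 < th k" using m pi_gt_zero by (simp add: th_def)
    have "2 * real k + 1 < 2 * real m" using that by linarith
    then show "th k < pi" using m by (simp add: th_def divide_less_eq mult.commute)
  qed
  have inj: "inj_on u {..<m}"
  proof (rule inj_onI)
    fix i j assume ij: "i \<in> {..<m}" "j \<in> {..<m}" "u i = u j"
    have "th i = th j"
      using ij th[of i] th[of j] cos_inj_pi[of "th i" "th j"] u by auto
    then show "i = j" using m by (simp add: th_def)
  qed
  have mth: "real m * th k = real k * pi + pi / 2" for k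
    using m by (simp add: th_def field_simps)
  have cos0: "cos (real m * th k) = 0" for k
    unfolding mth cos_add by simp
  have sin1: "(sin (real m * th k))\<^sup>2 = 1" for k
    using cos0[of k] sin_cos_squared_add[of "real m * th k"] by simp
  have root: "poly (cheb m) (u k) = 0" for k
    using cos0 by (simp add: u poly_cheb_cos)
  have "\<exists>R. cheb m = [:- u k, 1:] * R" for k
    using root[of k] by (simp add: poly_eq_0_iff_dvd dvd_def)
  then obtain R where R: "cheb m = [:- u k, 1:] * R k" for k by metis
  define L where "L k = poly (R k) (u k)" for k
  have L: "L k = poly (pderiv (cheb m)) (u k)" for k
    by (subst R[of k]) (simp only: pderiv_mult poly_add poly_mult, simp add: pderiv_pCons L_def)
  have Lsin: "(L k)\<^sup>2 * (sin (th k))\<^sup>2 = (real m)\<^sup>2" for k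
  proof -
    have "L k * sin (th k) = real m * sin (real m * th k)"
      unfolding L u by (rule pderiv_cheb_cos)
    then have "(L k * sin (th k))\<^sup>2 = (real m * sin (real m * th k))\<^sup>2" by simp
    then show ?thesis by (simp add: power_mult_distrib sin1)
  qed
  have L0: "L k \<noteq> 0" for k using Lsin[of k] m by auto
  have Rval: "poly (R k) x * (x - u k) = poly (cheb m) x" for k x
    by (subst R[of k]) (simp add: algebra_simps)
  have Roff: "poly (R k) (u i) = 0" if "i < m" "k < m" "i \<noteq> k" for i k
    using Rval[of k "u i"] root[of i] inj that by (auto dest: inj_onD)
  have cheb0: "cheb m \<noteq> 0"
  proof
    assume "cheb m = 0"
    then have "poly (cheb m) (cos 0) = 0" by simp
    then show False unfolding poly_cheb_cos by simp
  qed
  have degR: "degree (R k) < m" for k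
  proof -
    have "R k \<noteq> 0" using R[of k] cheb0 by auto
    then have "degree (cheb m) = 1 + degree (R k)" by (subst R[of k], subst degree_mult_eq) auto
    then show ?thesis using degree_cheb[of m] by simp
  qed
  define Q where "Q = (\<Sum>k<m. Polynomial.smult (poly P (u k) / L k) (R k))"
  have "P = Q"
  proof (rule poly_eqI_degree)
    show "poly P x = poly Q x" if "x \<in> u ` {..<m}" for x
    proof -
      from that obtain i where i: "i < m" "x = u i" by (auto simp only: image_iff lessThan_iff)
      have "poly Q x = (\<Sum>k<m. if k = i then poly P (u i) else 0)"
        unfolding Q_def poly_sum
        by (rule sum.cong) (use i Roff L0 in \<open>auto simp: L_def[symmetric]\<close>)
      then show ?thesis using i by simp
    qed
    have "degree Q \<le> m - 1"
      unfolding Q_def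
    proof (rule degree_sum_le)
      show "degree (Polynomial.smult (poly P (u k) / L k) (R k)) \<le> m - 1" for k
        using degree_smult_le[of "poly P (u k) / L k" "R k"] degR[of k] by linarith
    qed simp
    then show "degree Q < card (u ` {..<m})" "degree P < card (u ` {..<m})"
      using m deg by (auto simp: card_image[OF inj])
  qed
  have vu: "v - u k \<noteq> 0" for k using s cos_ge_minus_one[of "th k"] unfolding v_def u by linarith
  have "poly P v = (\<Sum>k<m. poly P (u k) * (T / (L k * (v - u k))))"
  proof -
    have "poly P v = (\<Sum>k<m. poly P (u k) / L k * poly (R k) v)"
      by (subst \<open>P = Q\<close>) (simp add: Q_def poly_sum)
    also have "\<dots> = (\<Sum>k<m. poly P (u k) * (T / (L k * (v - u k))))"
    proof (rule sum.cong[OF refl])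
      fix k
      have "poly (R k) v = T / (v - u k)"
        using vu[of k] Rval[of k v] by (simp add: T_def nonzero_eq_divide_eq)
      then show "poly P (u k) / L k * poly (R k) v = poly P (u k) * (T / (L k * (v - u k)))" by simp
    qed
    finally show ?thesis .
  qed
  then have "(poly P v)\<^sup>2 \<le> (\<Sum>k<m. (poly P (u k))\<^sup>2) * (\<Sum>k<m. (T / (L k * (v - u k)))\<^sup>2)"
    by (simp only: Cauchy_Schwarz_ineq_sum)
  also have "\<dots> \<le> (\<Sum>k<m. (poly P (u k))\<^sup>2) * (\<Sum>k<m. T\<^sup>2 / (2 * (real m)\<^sup>2 * s))"
  proof (intro mult_left_mono sum_mono sum_nonneg)
    fix k
    define a where "a = 1 + u k"
    have a: "0 \<le> a" "a \<le> 2" using cos_ge_minus_one[of "th k"] cos_le_one[of "th k"] unfolding a_def u by linarith+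
    have "(sin (th k))\<^sup>2 = a * (2 - a)"
      using sin_cos_squared_add[of "th k"] by (simp add: a_def u power2_eq_square algebra_simps)
    also have "\<dots> \<le> a * 2" using a by (intro mult_left_mono) auto
    also have "\<dots> \<le> (s + a)\<^sup>2 / (2 * s)"
      using sum_squares_ge_zero[of "s - a" 0] s by (simp add: field_simps power2_eq_square)
    finally have sn: "(sin (th k))\<^sup>2 \<le> (s + a)\<^sup>2 / (2 * s)" .
    have sa: "0 < s + a" using a s by simp
    have "(real m)\<^sup>2 \<le> (L k)\<^sup>2 * ((s + a)\<^sup>2 / (2 * s))"
      using mult_left_mono[OF sn, of "(L k)\<^sup>2"] Lsin[of k] by simp
    then have 2: "2 * (real m)\<^sup>2 * s \<le> (L k * (v - u k))\<^sup>2"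
      using s by (simp add: field_simps power_mult_distrib a_def v_def power2_eq_square)
    show "(T / (L k * (v - u k)))\<^sup>2 \<le> T\<^sup>2 / (2 * (real m)\<^sup>2 * s)"
      unfolding power_divide by (rule divide_left_mono[OF 2]) (use s m L0 vu in auto)
  qed auto
  also have "(\<Sum>k<m. T\<^sup>2 / (2 * (real m)\<^sup>2 * s)) = T\<^sup>2 / (2 * real m * s)"
    using m s by (simp add: field_simps power2_eq_square)
  finally show ?thesis by (simp add: v_def T_def mult.commute)
qed

text \<open>The extrapolation estimate transported from \<open>[-1, 1]\<close> to \<open>[t, 1]\<close>. The affine map
  sends \<open>-(1 + s)\<close> with \<open>s = 2 t / (1 - t)\<close> to \<open>0\<close>, and this point is the Joukowski image of
  \<open>-(1 + \<surd>t) / (1 - \<surd>t)\<close>. A polynomial of low degree can therefore not be large at \<open>0\<close>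
  without being noticeable at one of the nodes; eigenvalues will be placed at these nodes.\<close>

lemma heavy_nodes:
  fixes t :: real
  assumes t: "0 < t" "t < 1"
  obtains y :: "nat \<Rightarrow> real"
  where "\<And>k. t \<le> y k" "\<And>k. y k \<le> 1"
    and "\<And>P. degree P < m \<Longrightarrow> (poly P 0)\<^sup>2
      \<le> ((1 + sqrt t) / (1 - sqrt t)) ^ (2 * m) / (4 * real m * t) * (\<Sum>k<m. (poly P (y k))\<^sup>2)"
proof -
  define r where "r = sqrt t"
  have r: "0 < r" "r < 1" "t = r\<^sup>2" using t by (auto simp: r_def)
  define \<rho> where "\<rho> = (1 + r) / (1 - r)"
  have \<rho>: "1 \<le> \<rho>" using r by (simp add: \<rho>_def)
  define s where "s = 2 * t / (1 - t)"
  have s: "0 < s" using t by (simp add: s_def)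
  define u where "u k = cos ((2 * real k + 1) * pi / (2 * real m))" for k :: nat
  define y where "y k = (1 + t) / 2 + (1 - t) / 2 * u k" for k
  have u: "-1 \<le> u k" "u k \<le> 1" for k by (auto simp: u_def)
  have y1: "t \<le> y k" for k
  proof -
    have "(1 - t) / 2 * (-1) \<le> (1 - t) / 2 * u k" by (rule mult_left_mono[OF u(1)]) (use t in simp)
    then show ?thesis by (simp add: y_def field_simps)
  qed
  have y2: "y k \<le> 1" for k
  proof -
    have "(1 - t) / 2 * u k \<le> (1 - t) / 2 * 1" by (rule mult_left_mono[OF u(2)]) (use t in simp)
    then show ?thesis by (simp add: y_def field_simps)
  qed
  have main: "(poly P 0)\<^sup>2 \<le> \<rho> ^ (2 * m) / (4 * real m * t) * (\<Sum>k<m. (poly P (y k))\<^sup>2)"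
    if deg: "degree P < m" for P
  proof -
    define Q where "Q = P \<circ>\<^sub>p [:(1 + t) / 2, (1 - t) / 2:]"
    have m: "0 < m" using deg by simp
    have degQ: "degree Q < m"
      using degree_pcompose_le[of P "[:(1 + t) / 2, (1 - t) / 2:]"] deg t by (auto simp: Q_def)
    have Qu: "poly Q (u k) = poly P (y k)" for k
      by (simp add: Q_def poly_pcompose y_def algebra_simps)
    have "(1 + t) / 2 + - (1 + s) * ((1 - t) / 2) = 0"
      using t by (simp add: s_def field_simps)
    moreover have "poly Q (- (1 + s)) = poly P ((1 + t) / 2 + - (1 + s) * ((1 - t) / 2))"
      by (simp add: Q_def poly_pcompose)
    ultimately have Q0: "poly Q (- (1 + s)) = poly P 0" by simp
    have "- (1 + s) = (- \<rho> + 1 / (- \<rho>)) / 2"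
    proof -
      have "1 - t \<noteq> 0" "1 + r \<noteq> 0" "1 - r \<noteq> 0" using t r by auto
      moreover have "1 - t = (1 - r) * (1 + r)" by (simp add: r algebra_simps power2_eq_square)
      ultimately show ?thesis
        by (simp add: s_def \<rho>_def r(3) field_simps power2_eq_square)
    qed
    then have T: "\<bar>poly (cheb m) (- (1 + s))\<bar> \<le> \<rho> ^ m"
      using abs_poly_cheb_le[of "- \<rho>" m] \<rho> by (simp only: abs_minus_cancel abs_of_nonneg)
    then have "(poly (cheb m) (- (1 + s)))\<^sup>2 \<le> (\<rho> ^ m)\<^sup>2"
      by (meson T abs_ge_zero power_mono power2_abs abs_le_square_iff order_trans abs_ge_self)
    then have T2: "(poly (cheb m) (- (1 + s)))\<^sup>2 \<le> \<rho> ^ (2 * m)"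
      by (simp add: power_mult[symmetric] mult.commute)
    have "4 * real m * t \<le> 2 * real m * s"
    proof -
      have "2 * t \<le> s" using t by (simp add: s_def field_simps)
      then show ?thesis using mult_left_mono[of "2*t" s "2 * real m"] by simp
    qed
    then have "(poly (cheb m) (- (1 + s)))\<^sup>2 / (2 * real m * s) \<le> \<rho> ^ (2 * m) / (4 * real m * t)"
      using T2 m t by (intro frac_le) auto
    then have "(poly (cheb m) (- (1 + s)))\<^sup>2 / (2 * real m * s) * (\<Sum>k<m. (poly Q (u k))\<^sup>2)
      \<le> \<rho> ^ (2 * m) / (4 * real m * t) * (\<Sum>k<m. (poly Q (u k))\<^sup>2)"
      by (intro mult_right_mono sum_nonneg) auto
    then show ?thesis
      using cheb_extrapolation[OF s degQ] unfolding Q0 Qu u_def[symmetric] by (rule order_trans[rotated])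
  qed
  show thesis
    by (rule that[of y]) (use y1 y2 main in \<open>auto simp: \<rho>_def r_def\<close>)
qed

text \<open>\<open>V\<close> and \<open>W\<close> are the Chebyshev polynomials of the third and fourth kind,
  \<open>V(cos \<theta>) = cos ((k + 1/2) \<theta>) / cos (\<theta>/2)\<close> and
  \<open>W(cos \<theta>) = sin ((k + 1/2) \<theta>) / sin (\<theta>/2)\<close>. The identity is \<open>cos\<^sup>2 + sin\<^sup>2 = 1\<close>, and the
  induction step is the addition theorem. Being an identity between polynomials it can be
  evaluated at a symmetric matrix \<open>X\<close>, where it bounds \<open>(1 + X) V(X)\<^sup>2\<close> from above as soon as
  \<open>1 - X\<close> is positive semidefinite.

  To the left of \<open>-1\<close>, at \<open>-y\<close> with \<open>y = (1 + r\<^sup>2) / (1 - r\<^sup>2)\<close>, the values \<open>a, b\<close> of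
  \<open>(-1)\<^sup>k V, (-1)\<^sup>k W\<close> obey \<open>a' = y a + (1 + y) b\<close> and \<open>b' = y b + (y - 1) a\<close>. The inequality
  \<open>r a \<le> b\<close> is preserved, and with it \<open>a' \<ge> (y + (1 + y) r) a = (1 + r) / (1 - r) a\<close>.\<close>

lemma light_polynomial:
  fixes r :: real
  assumes r: "0 \<le> r" "r < 1"
  obtains V W :: "real poly"
  where "degree V \<le> k" and "[:1, 1:] * V\<^sup>2 + [:1, -1:] * W\<^sup>2 = [:2:]"
    and "((1 + r) / (1 - r)) ^ k \<le> \<bar>poly V (- ((1 + r\<^sup>2) / (1 - r\<^sup>2)))\<bar>"
proof -
  define y where "y = (1 + r\<^sup>2) / (1 - r\<^sup>2)"
  define \<rho> where "\<rho> = (1 + r) / (1 - r)"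
  have fac: "1 - r\<^sup>2 = (1 - r) * (1 + r)" by (simp add: algebra_simps power2_eq_square)
  have nz: "1 - r \<noteq> 0" "1 + r \<noteq> 0" using r by auto
  have y1: "1 \<le> y"
  proof -
    have "0 < 1 - r\<^sup>2" unfolding fac using r by simp
    then show ?thesis unfolding y_def by (simp add: le_divide_eq)
  qed
  have h: "y * ((1 - r) * (1 + r)) = 1 + r * r"
    unfolding y_def fac using nz by (simp add: power2_eq_square)
  have e1: "y + (1 + y) * r = \<rho>"
  proof -
    have "(1 + r) * ((y + (1 + y) * r) * (1 - r)) = y * ((1 - r) * (1 + r))
        + r * ((1 - r) * (1 + r)) + r * (y * ((1 - r) * (1 + r)))" by (simp add: algebra_simps)
    also have "\<dots> = (1 + r) * (1 + r)" unfolding h by (simp add: algebra_simps)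
    finally show ?thesis using nz by (simp add: \<rho>_def nonzero_eq_divide_eq)
  qed
  have e2: "y - r * (1 + y) = (1 - r) / (1 + r)"
  proof -
    have "(1 - r) * ((y - r * (1 + y)) * (1 + r)) = y * ((1 - r) * (1 + r))
        - r * ((1 - r) * (1 + r)) - r * (y * ((1 - r) * (1 + r)))" by (simp add: algebra_simps)
    also have "\<dots> = (1 - r) * (1 - r)" unfolding h by (simp add: algebra_simps)
    finally show ?thesis using nz by (simp add: nonzero_eq_divide_eq)
  qed
  have e3: "y - 1 - r * y = - r * ((1 - r) / (1 + r))"
  proof -
    have "(1 - r) * ((y - 1 - r * y) * (1 + r)) = y * ((1 - r) * (1 + r))
        - (1 - r) * (1 + r) - r * (y * ((1 - r) * (1 + r)))" by (simp add: algebra_simps)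
    also have "\<dots> = (1 - r) * (- r * (1 - r))" unfolding h by (simp add: algebra_simps)
    finally have "(y - 1 - r * y) * (1 + r) = - r * (1 - r)" using nz by (metis mult_left_cancel)
    then show ?thesis by (simp only: nonzero_eq_divide_eq[OF nz(2)] times_divide_eq_right)
  qed
  have \<rho>0: "0 \<le> \<rho>" using r by (simp add: \<rho>_def)
  have "\<exists>V W :: real poly. degree V \<le> k \<and> degree W \<le> k \<and> [:1, 1:] * V\<^sup>2 + [:1, -1:] * W\<^sup>2 = [:2:]
     \<and> \<rho> ^ k \<le> (-1) ^ k * poly V (- y) \<and> r * ((-1) ^ k * poly V (- y)) \<le> (-1) ^ k * poly W (- y)"
  proof (induction k)
    case 0
    show ?case by (rule exI[of _ 1], rule exI[of _ 1]) (use r in simp)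
  next
    case (Suc k)
    then obtain V W :: "real poly" where VW: "degree V \<le> k" "degree W \<le> k"
      "[:1, 1:] * V\<^sup>2 + [:1, -1:] * W\<^sup>2 = [:2:]"
      "\<rho> ^ k \<le> (-1) ^ k * poly V (- y)" "r * ((-1) ^ k * poly V (- y)) \<le> (-1) ^ k * poly W (- y)"
      by blast
    define V' where "V' = [:0, 1:] * V - [:1, -1:] * W"
    define W' where "W' = [:0, 1:] * W + [:1, 1:] * V"
    have dV: "degree V' \<le> Suc k"
      unfolding V'_def using VW(1,2)
      by (intro degree_diff_le order_trans[OF degree_mult_le]) auto
    have dW: "degree W' \<le> Suc k"
      unfolding W'_def using VW(1,2)
      by (intro degree_add_le order_trans[OF degree_mult_le]) auto
    have id: "[:1, 1:] * V'\<^sup>2 + [:1, -1:] * W'\<^sup>2 = [:2:]"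
    proof -
      have x: "[:1, 1:] = 1 + [:0, 1::real:]" "[:1, -1:] = 1 - [:0, 1::real:]" by (simp_all add: one_pCons)
      have "(1 + z) * (z * V - (1 - z) * W)\<^sup>2 + (1 - z) * (z * W + (1 + z) * V)\<^sup>2
          = (1 + z) * V\<^sup>2 + (1 - z) * W\<^sup>2" for z :: "real poly"
        by (simp add: power2_eq_square algebra_simps)
      from this[of "[:0, 1:]"] show ?thesis
        using VW(3) unfolding V'_def W'_def x by (simp only:)
    qed
    define a where "a = (-1) ^ k * poly V (- y)"
    define b where "b = (-1) ^ k * poly W (- y)"
    have ab: "\<rho> ^ k \<le> a" "r * a \<le> b" using VW(4,5) by (auto simp: a_def b_def)
    have a': "(-1) ^ Suc k * poly V' (- y) = y * a + (1 + y) * b"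
      by (simp add: V'_def a_def b_def algebra_simps)
    have b': "(-1) ^ Suc k * poly W' (- y) = y * b + (y - 1) * a"
      by (simp add: W'_def a_def b_def algebra_simps)
    have "\<rho> ^ Suc k \<le> \<rho> * a" using ab(1) \<rho>0 by (simp add: mult_left_mono)
    also have "\<dots> = y * a + (1 + y) * (r * a)" by (simp add: e1[symmetric] algebra_simps)
    also have "\<dots> \<le> y * a + (1 + y) * b" using ab(2) y1 by (intro add_left_mono mult_left_mono) auto
    finally have c1: "\<rho> ^ Suc k \<le> y * a + (1 + y) * b" .
    have gen: "q * b + - r * q * a = q * (b - r * a)" for q by (simp add: algebra_simps)
    have "y * b + (y - 1) * a - r * (y * a + (1 + y) * b) = (y - r * (1 + y)) * b + (y - 1 - r * y) * a"
      by (simp add: algebra_simps)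
    also have "\<dots> = (1 - r) / (1 + r) * (b - r * a)" unfolding e2 e3 by (rule gen)
    also have "\<dots> \<ge> 0" using ab(2) r by simp
    finally have c2: "r * (y * a + (1 + y) * b) \<le> y * b + (y - 1) * a" by simp
    show ?case
    proof (intro exI conjI)
      show "degree V' \<le> Suc k" "degree W' \<le> Suc k" by fact+
      show "[:1, 1:] * V'\<^sup>2 + [:1, -1:] * W'\<^sup>2 = [:2:]" by fact
      show "\<rho> ^ Suc k \<le> (-1) ^ Suc k * poly V' (- y)" unfolding a' by fact
      show "r * ((-1) ^ Suc k * poly V' (- y)) \<le> (-1) ^ Suc k * poly W' (- y)"
        unfolding a' b' by fact
    qed
  qed
  then obtain V W :: "real poly" where VW: "degree V \<le> k" "[:1, 1:] * V\<^sup>2 + [:1, -1:] * W\<^sup>2 = [:2:]"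
    "\<rho> ^ k \<le> (-1) ^ k * poly V (- y)" by blast
  have "(-1) ^ k * poly V (- y) \<le> \<bar>poly V (- y)\<bar>"
    using abs_ge_self[of "(-1) ^ k * poly V (- y)"] by (simp add: abs_mult power_abs)
  then have "\<rho> ^ k \<le> \<bar>poly V (- y)\<bar>" using VW(3) by linarith
  then show thesis using that VW unfolding \<rho>_def y_def by blast
qed

section \<open>Krylov vectors as polynomials in the matrix\<close>

text \<open>The vector \<open>P(A) b\<close>, written out coordinatewise.\<close>

definition pvec :: "real mat \<Rightarrow> real vec \<Rightarrow> real poly \<Rightarrow> real vec" where
  "pvec A b P = vec (dim_vec b) (\<lambda>i. \<Sum>k\<le>degree P. coeff P k * ((A ^\<^sub>m k) *\<^sub>v b) $ i)"

lemma sum_coeff_lessThan: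
  fixes c :: "nat \<Rightarrow> real"
  assumes "degree P < N"
  shows "(\<Sum>k\<le>degree P. coeff P k * c k) = (\<Sum>k<N. coeff P k * c k)"
  by (rule sum.mono_neutral_left) (use assms in \<open>auto simp: coeff_eq_0\<close>)

lemma pvec_carrier: "b \<in> carrier_vec n \<Longrightarrow> pvec A b P \<in> carrier_vec n"
  by (auto simp: pvec_def)

lemma pvec_index:
  assumes "b \<in> carrier_vec n" "i < n" "degree P < N"
  shows "pvec A b P $ i = (\<Sum>k<N. coeff P k * ((A ^\<^sub>m k) *\<^sub>v b) $ i)"
  using assms by (simp add: pvec_def sum_coeff_lessThan[OF assms(3)])

lemma pow_mat_Suc_mult_vec:
  assumes A: "A \<in> carrier_mat n n" and b: "b \<in> carrier_vec n"
  shows "(A ^\<^sub>m Suc k) *\<^sub>v b = A *\<^sub>v ((A ^\<^sub>m k) *\<^sub>v (b :: real vec))"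
proof -
  have c: "A ^\<^sub>m k \<in> carrier_mat n n" for k using A by simp
  have "A ^\<^sub>m Suc k = A * A ^\<^sub>m k"
  proof (induction k)
    case (Suc k)
    then show ?case using A c[of k] by (simp add: assoc_mult_mat[of _ n n _ n _ n])
  qed (use A in simp)
  then show ?thesis using assoc_mult_mat_vec[OF A c[of k] b] by simp
qed

lemma pvec_pCons:
  assumes A: "A \<in> carrier_mat n n" and b: "b \<in> carrier_vec n"
  shows "pvec A b (pCons a P) = a \<cdot>\<^sub>v b + A *\<^sub>v pvec A b P"
proof (rule eq_vecI)
  show "dim_vec (pvec A b (pCons a P)) = dim_vec (a \<cdot>\<^sub>v b + A *\<^sub>v pvec A b P)"
    using A b by (simp add: pvec_def)
  fix i assume "i < dim_vec (a \<cdot>\<^sub>v b + A *\<^sub>v pvec A b P)"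
  then have i: "i < n" using A by simp
  define N where "N = Suc (degree P)"
  define v where "v k = (A ^\<^sub>m k) *\<^sub>v b" for k
  have v: "v k \<in> carrier_vec n" for k using A b unfolding v_def
    by (intro mult_mat_vec_carrier[of _ n n]) auto
  have vS: "v (Suc k) = A *\<^sub>v v k" for k
    unfolding v_def by (rule pow_mat_Suc_mult_vec[OF A b])
  have v0: "v 0 = b" using A b by (simp add: v_def)
  have Av: "v (Suc k) $ i = (\<Sum>j<n. A $$ (i, j) * v k $ j)" for k
    unfolding vS using A i v[of k] by (simp add: scalar_prod_def row_def lessThan_atLeast0)
  have "pvec A b (pCons a P) $ i = (\<Sum>k<Suc N. coeff (pCons a P) k * v k $ i)"
    unfolding v_def by (rule pvec_index[OF b i]) (simp add: N_def le_imp_less_Suc degree_pCons_le)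
  also have "\<dots> = a * b $ i + (\<Sum>k<N. coeff P k * v (Suc k) $ i)"
    unfolding sum.lessThan_Suc_shift by (simp add: v0)
  also have "(\<Sum>k<N. coeff P k * v (Suc k) $ i) = (\<Sum>j<n. A $$ (i, j) * (\<Sum>k<N. coeff P k * v k $ j))"
    unfolding Av sum_distrib_left by (subst sum.swap) (simp add: mult_ac)
  also have "\<dots> = (A *\<^sub>v pvec A b P) $ i"
    using A i b pvec_carrier[OF b, of A P]
    by (auto simp: scalar_prod_def row_def lessThan_atLeast0 N_def v_def
        pvec_index[OF b, of _ P N A, unfolded N_def] intro!: sum.cong)
  finally show "pvec A b (pCons a P) $ i = (a \<cdot>\<^sub>v b + A *\<^sub>v pvec A b P) $ i"
    using A b i by simp
qed

lemma pvec_0: "b \<in> carrier_vec n \<Longrightarrow> pvec A b 0 = 0\<^sub>v n"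
  by (auto simp: pvec_def)

lemma mult_mat_zero_vec: "A \<in> carrier_mat n n \<Longrightarrow> A *\<^sub>v 0\<^sub>v n = (0\<^sub>v n :: real vec)"
  by (intro eq_vecI) auto

lemma pvec_shift:
  assumes "A \<in> carrier_mat n n" "b \<in> carrier_vec n"
  shows "pvec A b (pCons 0 P) = A *\<^sub>v pvec A b P"
  using pvec_pCons[OF assms, of 0 P] assms pvec_carrier[OF assms(2), of A P]
  by (auto intro!: eq_vecI)

lemma pvec_1:
  assumes "A \<in> carrier_mat n n" "b \<in> carrier_vec n"
  shows "pvec A b 1 = b"
  using pvec_pCons[OF assms, of 1 0] assms by (simp add: pvec_0 one_pCons mult_mat_zero_vec)

lemma symmetric_scalar_prod:
  fixes A :: "real mat"
  assumes A: "A \<in> carrier_mat n n" "transpose_mat A = A"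
    and x: "x \<in> carrier_vec n" and y: "y \<in> carrier_vec n"
  shows "(A *\<^sub>v x) \<bullet> y = x \<bullet> (A *\<^sub>v y)"
  using transpose_vec_mult_scalar[OF A(1) y x] A(2) x y A(1)
  by (metis comm_scalar_prod mult_mat_vec_carrier)

text \<open>The moment functional of the pair \<open>(A, b)\<close>: for symmetric \<open>A\<close> it determines all inner
  products of vectors \<open>P(A) b\<close>, so that inequalities for Ritz values become inequalities
  for a linear functional on polynomials.\<close>

definition moment :: "real mat \<Rightarrow> real vec \<Rightarrow> real poly \<Rightarrow> real" where
  "moment A b P = b \<bullet> pvec A b P"

lemma pvec_dim [simp]: "dim_vec (pvec A b P) = dim_vec b"
  by (simp add: pvec_def)

lemma pvec_add:
  assumes b: "b \<in> carrier_vec n"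
  shows "pvec A b (P + Q) = pvec A b P + pvec A b Q"
proof (rule eq_vecI)
  define N where "N = Suc (max (degree P) (degree Q))"
  have d: "degree P < N" "degree Q < N" "degree (P + Q) < N"
    unfolding N_def using degree_add_le_max[of P Q] by linarith+
  fix i assume "i < dim_vec (pvec A b P + pvec A b Q)"
  then have i: "i < n" using b by simp
  show "pvec A b (P + Q) $ i = (pvec A b P + pvec A b Q) $ i"
    using i b by (simp add: pvec_index[OF b i d(1)] pvec_index[OF b i d(2)] pvec_index[OF b i d(3)]
        sum.distrib algebra_simps)
qed simp

lemma pvec_smult:
  assumes b: "b \<in> carrier_vec n"
  shows "pvec A b (Polynomial.smult a P) = a \<cdot>\<^sub>v pvec A b P"
proof (rule eq_vecI)
  define N where "N = Suc (degree P)"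
  have d: "degree P < N" "degree (Polynomial.smult a P) < N"
    unfolding N_def using degree_smult_le[of a P] by linarith+
  fix i assume "i < dim_vec (a \<cdot>\<^sub>v pvec A b P)"
  then have i: "i < n" using b by simp
  show "pvec A b (Polynomial.smult a P) $ i = (a \<cdot>\<^sub>v pvec A b P) $ i"
    using i b by (simp add: pvec_index[OF b i d(1)] pvec_index[OF b i d(2)]
        sum_distrib_left algebra_simps)
qed simp

lemma moment_add:
  assumes b: "b \<in> carrier_vec n"
  shows "moment A b (P + Q) = moment A b P + moment A b Q"
  using b pvec_carrier[OF b, of A]
  by (simp add: moment_def pvec_add[OF b] scalar_prod_add_distrib[of _ n])

lemma moment_smult:
  assumes b: "b \<in> carrier_vec n"
  shows "moment A b (Polynomial.smult a P) = a * moment A b P"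
  using b pvec_carrier[OF b, of A P]
  by (simp add: moment_def pvec_smult[OF b])

text \<open>Symmetry moves the factors \<open>A\<close> from the left to the right argument, one coefficient
  of \<open>P\<close> at a time.\<close>

lemma pvec_scalar_prod:
  assumes A: "A \<in> carrier_mat n n" "transpose_mat A = A" and b: "b \<in> carrier_vec n"
  shows "pvec A b P \<bullet> pvec A b Q = moment A b (P * Q)"
proof (induction P arbitrary: Q rule: pCons_induct)
  case 0
  show ?case using b pvec_carrier[OF b, of A Q] by (simp add: moment_def pvec_0[OF b])
next
  case (pCons a P)
  note c = pvec_carrier[OF b, of A]
  have e: "pCons a P * Q = Polynomial.smult a Q + P * pCons 0 Q" by simp
  have lin: "moment A b (Polynomial.smult a Q + R) = a * moment A b Q + moment A b R" for R
    by (simp add: moment_add[OF b] moment_smult[OF b])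
  have "pvec A b (pCons a P) \<bullet> pvec A b Q = a * (b \<bullet> pvec A b Q) + (A *\<^sub>v pvec A b P) \<bullet> pvec A b Q"
    unfolding pvec_pCons[OF A(1) b] using A b c[of P] c[of Q]
    by (subst add_scalar_prod_distrib[of _ n]) (auto intro!: mult_mat_vec_carrier[of _ n n])
  also have "(A *\<^sub>v pvec A b P) \<bullet> pvec A b Q = pvec A b P \<bullet> pvec A b (pCons 0 Q)"
    unfolding pvec_shift[OF A(1) b] by (rule symmetric_scalar_prod[OF A c c])
  also have "\<dots> = moment A b (P * pCons 0 Q)" by (rule pCons.IH)
  finally show ?case unfolding e lin by (simp add: moment_def)
qed

definition lincomb_vec :: "nat \<Rightarrow> (nat \<Rightarrow> real vec) \<Rightarrow> nat set \<Rightarrow> (nat \<Rightarrow> real) \<Rightarrow> real vec" where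
  "lincomb_vec n v S c = vec n (\<lambda>i. \<Sum>k\<in>S. c k * v k $ i)"

lemma range_lincomb_vec_powers:
  assumes b: "b \<in> carrier_vec n" and m: "0 < m"
  shows "range (lincomb_vec n (\<lambda>k. (A ^\<^sub>m k) *\<^sub>v b) {..<m}) = {pvec A b P |P. degree P < m}"
proof (intro equalityI subsetI)
  have pv: "pvec A b P = lincomb_vec n (\<lambda>k. (A ^\<^sub>m k) *\<^sub>v b) {..<m} (coeff P)" if "degree P < m" for P
    using pvec_index[OF b _ that] b by (intro eq_vecI) (auto simp: lincomb_vec_def)
  fix x
  show "x \<in> range (lincomb_vec n (\<lambda>k. (A ^\<^sub>m k) *\<^sub>v b) {..<m})" if "x \<in> {pvec A b P |P. degree P < m}"
    using that pv by auto
  assume "x \<in> range (lincomb_vec n (\<lambda>k. (A ^\<^sub>m k) *\<^sub>v b) {..<m})"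
  then obtain c where c: "x = lincomb_vec n (\<lambda>k. (A ^\<^sub>m k) *\<^sub>v b) {..<m} c" by auto
  define P where "P = Poly (map c [0..<m])"
  have cf: "coeff P k = (if k < m then c k else 0)" for k by (auto simp: P_def nth_default_def)
  have dP: "degree P < m" using degree_lessI[of P m] cf m by auto
  have "x = pvec A b P" unfolding c pv[OF dP] lincomb_vec_def by (auto simp: cf)
  then show "x \<in> {pvec A b P |P. degree P < m}" using dP by auto
qed

text \<open>The polynomials of degree below \<open>m\<close> give a submodule that contains the generators
  \<open>A\<^sup>k b\<close>, hence their span; conversely every partial sum of such a polynomial lies in the span.
  Working with coefficient sequences instead of subsets of the generators avoids a case
  distinction when some of the \<open>A\<^sup>k b\<close> coincide.\<close>

lemma krylov_eq:
  assumes A: "A \<in> carrier_mat n n" and b: "b \<in> carrier_vec n" and m: "0 < m"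
  shows "krylov A b m = {pvec A b P |P. degree P < m}"
proof -
  interpret vec_module "TYPE(real)" n .
  have dim: "dim_vec b = n" using b by simp
  define v where "v k = (A ^\<^sub>m k) *\<^sub>v b" for k
  have v: "v k \<in> carrier_vec n" for k using A b unfolding v_def
    by (intro mult_mat_vec_carrier[of _ n n]) auto
  define W where "W = {pvec A b P |P. degree P < m}"
  have K: "krylov A b m = span (v ` {..<m})" by (simp add: krylov_def dim v_def[abs_def])
  have vc: "v ` {..<m} \<subseteq> carrier_vec n" using v by auto
  have W: "W = range (lincomb_vec n v {..<m})"
    unfolding W_def v_def range_lincomb_vec_powers[OF b m] ..
  have sub: "submodule class_ring W V"
  proof
    show "W \<subseteq> carrier V" using pvec_carrier[OF b] by (auto simp: W_def module_vec_simps)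
    show "\<zero>\<^bsub>V\<^esub> \<in> W" using m pvec_0[OF b, of A] by (auto simp: W_def module_vec_simps intro!: exI[of _ 0])
  next
    fix x y assume "x \<in> W" "y \<in> W"
    then obtain P Q where PQ: "degree P < m" "degree Q < m" "x = pvec A b P" "y = pvec A b Q"
      by (auto simp: W_def)
    have "x + y = pvec A b (P + Q)" unfolding PQ by (simp add: pvec_add[OF b])
    moreover have "degree (P + Q) < m" using degree_add_le_max[of P Q] PQ by linarith
    ultimately show "x \<oplus>\<^bsub>V\<^esub> y \<in> W" by (auto simp: W_def module_vec_simps)
  next
    fix a :: real and x assume "x \<in> W"
    then obtain P where P: "degree P < m" "x = pvec A b P" by (auto simp: W_def)
    have "a \<cdot>\<^sub>v x = pvec A b (Polynomial.smult a P)" unfolding P by (simp add: pvec_smult[OF b])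
    moreover have "degree (Polynomial.smult a P) < m" using degree_smult_le[of a P] P by linarith
    ultimately show "a \<odot>\<^bsub>V\<^esub> x \<in> W" by (auto simp: W_def module_vec_simps)
  qed
  have "v ` {..<m} \<subseteq> W"
  proof
    fix x assume "x \<in> v ` {..<m}"
    then obtain j where j: "j < m" "x = v j" by auto
    have "x = lincomb_vec n v {..<m} (\<lambda>k. if k = j then 1 else 0)"
    proof (rule eq_vecI)
      fix i assume "i < dim_vec (lincomb_vec n v {..<m} (\<lambda>k. if k = j then 1 else 0))"
      moreover have "(\<Sum>k<m. (if k = j then 1 else 0) * v k $ i) = (\<Sum>k<m. if k = j then v j $ i else 0)"
        by (rule sum.cong) auto
      ultimately show "x $ i = lincomb_vec n v {..<m} (\<lambda>k. if k = j then 1 else 0) $ i"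
        using j by (simp add: lincomb_vec_def)
    qed (use j v[of j] in \<open>simp add: lincomb_vec_def\<close>)
    then show "x \<in> W" unfolding W by blast
  qed
  from span_is_subset[OF this sub] have 1: "span (v ` {..<m}) \<subseteq> W" .
  have sm: "submodule class_ring (span (v ` {..<m})) V" by (rule span_is_submodule) (use vc in \<open>simp add: module_vec_simps\<close>)
  have own: "v ` {..<m} \<subseteq> span (v ` {..<m})" by (rule in_own_span) (use vc in \<open>simp add: module_vec_simps\<close>)
  have 2: "lincomb_vec n v {..<d} c \<in> span (v ` {..<m})" if "d \<le> m" for c d
    using that
  proof (induction d)
    case 0
    have "lincomb_vec n v {..<0} c = \<zero>\<^bsub>V\<^esub>" by (auto simp: module_vec_simps lincomb_vec_def)
    then show ?case using submodule.zero_closed[OF sm] by simp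
  next
    case (Suc d)
    have "c d \<odot>\<^bsub>V\<^esub> v d \<in> span (v ` {..<m})"
      using own Suc.prems by (intro submodule.smult_closed[OF sm]) (auto simp: class_ring_simps)
    then have "lincomb_vec n v {..<d} c \<oplus>\<^bsub>V\<^esub> (c d \<odot>\<^bsub>V\<^esub> v d) \<in> span (v ` {..<m})"
      using Suc by (intro submodule.m_closed[OF sm]) auto
    moreover have "lincomb_vec n v {..<Suc d} c = lincomb_vec n v {..<d} c \<oplus>\<^bsub>V\<^esub> (c d \<odot>\<^bsub>V\<^esub> v d)"
      using v[of d] by (intro eq_vecI) (auto simp: module_vec_simps lincomb_vec_def)
    ultimately show ?case by simp
  qed
  show ?thesis unfolding K W_def[symmetric] using 1 2[OF order_refl] W by auto
qed

section \<open>Extremal Rayleigh quotients\<close>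

lemma scalar_prod_sum: "x \<in> carrier_vec n \<Longrightarrow> y \<in> carrier_vec n \<Longrightarrow> x \<bullet> y = (\<Sum>i<n. x $ i * (y $ i :: real))"
  by (simp add: scalar_prod_def lessThan_atLeast0)

lemma scalar_prod_self_nonneg: "0 \<le> x \<bullet> (x :: real vec)"
  by (simp add: scalar_prod_def sum_nonneg)

lemma scalar_prod_self_pos:
  assumes "x \<in> carrier_vec n" "x \<noteq> 0\<^sub>v n"
  shows "0 < x \<bullet> (x :: real vec)"
proof -
  obtain i where i: "i < n" "x $ i \<noteq> 0" using assms by (metis carrier_vecD eq_vecI index_zero_vec)
  have "0 < (\<Sum>i<n. x $ i * x $ i)"
    by (rule sum_pos2[of _ i]) (use i in \<open>auto simp: zero_less_mult_iff\<close>)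
  then show ?thesis using assms by (simp add: scalar_prod_sum)
qed

lemma mult_vec_index:
  fixes A :: "real mat"
  assumes "A \<in> carrier_mat n n" "x \<in> carrier_vec n" "i < n"
  shows "(A *\<^sub>v x) $ i = (\<Sum>j<n. A $$ (i, j) * x $ j)"
  using assms by (simp add: scalar_prod_def row_def lessThan_atLeast0)

lemma rayleigh_smult:
  assumes A: "A \<in> carrier_mat n n" and x: "x \<in> carrier_vec n" and "a \<noteq> 0"
  shows "rayleigh A (a \<cdot>\<^sub>v x) = rayleigh A x"
  using assms mult_mat_vec[OF A x, of a] mult_mat_vec_carrier[OF A x]
  by (simp add: rayleigh_def)

text \<open>A spanning index set of minimal cardinality is independent, because a vanishing
  combination with a nonzero coefficient at \<open>k\<close> would make \<open>k\<close> redundant.\<close>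

lemma minimal_spanning_subset:
  assumes S: "finite S"
  obtains T where "T \<subseteq> S" "range (lincomb_vec n v T) = range (lincomb_vec n v S)"
    "\<And>c k. lincomb_vec n v T c = 0\<^sub>v n \<Longrightarrow> k \<in> T \<Longrightarrow> c k = 0"
proof -
  define T where "T = (ARG_MIN card T. T \<subseteq> S \<and> range (lincomb_vec n v T) = range (lincomb_vec n v S))"
  have T: "(T \<subseteq> S \<and> range (lincomb_vec n v T) = range (lincomb_vec n v S)) \<and>
      (\<forall>T'. T' \<subseteq> S \<and> range (lincomb_vec n v T') = range (lincomb_vec n v S) \<longrightarrow> card T \<le> card T')"
    unfolding T_def by (rule arg_min_nat_lemma[of "\<lambda>T. T \<subseteq> S \<and> range (lincomb_vec n v T) = range (lincomb_vec n v S)" S card]) auto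
  have TS: "T \<subseteq> S" and rT: "range (lincomb_vec n v T) = range (lincomb_vec n v S)"
    and min: "\<And>T'. T' \<subseteq> S \<Longrightarrow> range (lincomb_vec n v T') = range (lincomb_vec n v S) \<Longrightarrow> card T \<le> card T'"
    using T by auto
  have fin: "finite T" using TS S finite_subset by auto
  have indep: "c k = 0" if z: "lincomb_vec n v T c = 0\<^sub>v n" and k: "k \<in> T" for c k
  proof (rule ccontr)
    assume ck: "c k \<noteq> 0"
    have z': "(\<Sum>j\<in>T. c j * v j $ i) = 0" if "i < n" for i
      using arg_cong[OF z, of "\<lambda>x. x $ i"] that by (simp add: lincomb_vec_def)
    have "lincomb_vec n v T d = lincomb_vec n v (T - {k}) (\<lambda>j. d j - d k / c k * c j)" for d
    proof (rule eq_vecI)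
      fix i assume "i < dim_vec (lincomb_vec n v (T - {k}) (\<lambda>j. d j - d k / c k * c j))"
      then have i: "i < n" by (simp add: lincomb_vec_def)
      have gen: "(\<Sum>j\<in>T. d j * v j $ i) - q * (\<Sum>j\<in>T. c j * v j $ i)
          = (\<Sum>j\<in>T. (d j - q * c j) * v j $ i)" for q
        by (simp add: sum_distrib_left sum_subtractf left_diff_distrib mult.assoc)
      have "(\<Sum>j\<in>T. d j * v j $ i) = (\<Sum>j\<in>T. (d j - d k / c k * c j) * v j $ i)"
        unfolding gen[symmetric] z'[OF i] by simp
      also have "\<dots> = (\<Sum>j\<in>T - {k}. (d j - d k / c k * c j) * v j $ i)"
        using ck by (subst sum.remove[OF fin k]) simp
      finally show "lincomb_vec n v T d $ i = lincomb_vec n v (T - {k}) (\<lambda>j. d j - d k / c k * c j) $ i"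
        using i by (simp add: lincomb_vec_def)
    qed (simp add: lincomb_vec_def)
    then have 1: "range (lincomb_vec n v T) \<subseteq> range (lincomb_vec n v (T - {k}))" by auto
    have "lincomb_vec n v (T - {k}) d = lincomb_vec n v T (d(k := 0))" for d
    proof -
      have "(\<Sum>j\<in>T. (d(k := 0)) j * v j $ i) = (\<Sum>j\<in>T - {k}. d j * v j $ i)" for i
        by (subst sum.remove[OF fin k]) (auto intro!: sum.cong)
      then show ?thesis unfolding lincomb_vec_def by simp
    qed
    then have 2: "range (lincomb_vec n v (T - {k})) \<subseteq> range (lincomb_vec n v T)" by auto
    have "card T \<le> card (T - {k})"
      by (rule min) (use TS 1 2 rT in auto)
    then show False using card_Diff1_less[OF fin k] by simp
  qed
  show thesis using that[OF TS rT] indep by blast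
qed

text \<open>Over independent vectors the coefficient sequences of Euclidean norm \<open>1\<close> form a
  compact set on which the linear combination does not vanish, so the Rayleigh quotient is
  continuous there and has a minimum; homogeneity extends it to all nonzero vectors of the
  span. Compactness is that of a product of intervals in the topology of pointwise
  convergence. The factor \<open>s\<close> treats the minimum (\<open>s = 1\<close>) and the maximum (\<open>s = -1\<close>) alike.\<close>

lemma rayleigh_attains:
  fixes s :: real
  assumes A: "A \<in> carrier_mat n n" and S: "finite S"
    and ne: "x0 \<in> range (lincomb_vec n v S)" "x0 \<noteq> 0\<^sub>v n"
  obtains x where "x \<in> range (lincomb_vec n v S)" "x \<noteq> 0\<^sub>v n"
    "\<And>y. y \<in> range (lincomb_vec n v S) \<Longrightarrow> y \<noteq> 0\<^sub>v n \<Longrightarrow> s * rayleigh A x \<le> s * rayleigh A y"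
proof -
  obtain T where T: "T \<subseteq> S" "range (lincomb_vec n v T) = range (lincomb_vec n v S)"
    and indep: "\<And>c k. lincomb_vec n v T c = 0\<^sub>v n \<Longrightarrow> k \<in> T \<Longrightarrow> c k = 0"
    using minimal_spanning_subset[OF S, of n v] by blast
  have fin: "finite T" using T S finite_subset by auto
  have lc: "lincomb_vec n v T c \<in> carrier_vec n" for c by (simp add: lincomb_vec_def)
  \<comment> \<open>Coefficients outside \<open>T\<close> are fixed at \<open>0\<close>, so that \<open>K\<close> is a closed part of a product of compact sets.\<close>
  define K where "K = PiE UNIV (\<lambda>k. if k \<in> T then {-1..1} else {0 :: real}) \<inter> {c. (\<Sum>k\<in>T. (c k)\<^sup>2) = 1}"
  have compK: "compact K"
  proof -
    have "compactin (product_topology (\<lambda>i::nat. euclidean :: real topology) UNIV)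
        (PiE UNIV (\<lambda>k. if k \<in> T then {-1..1} else {0 :: real}))"
      unfolding compactin_PiE by auto
    then have 1: "compact (PiE UNIV (\<lambda>k::nat. if k \<in> T then {-1..1} else {0 :: real}))"
      by (simp add: euclidean_product_topology)
    have 2: "closed {c :: nat \<Rightarrow> real. (\<Sum>k\<in>T. (c k)\<^sup>2) = 1}"
      by (intro closed_Collect_eq continuous_intros continuous_on_product_coordinates)
    show ?thesis unfolding K_def using compact_Int_closed[OF 1 2] .
  qed
  have Knz: "lincomb_vec n v T c \<noteq> 0\<^sub>v n" if "c \<in> K" for c
  proof
    assume "lincomb_vec n v T c = 0\<^sub>v n"
    then have "(\<Sum>k\<in>T. (c k)\<^sup>2) = 0" using indep by (intro sum.neutral) auto
    then show False using that by (simp add: K_def)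
  qed
  have lift: "\<exists>c\<in>K. rayleigh A (lincomb_vec n v T c) = rayleigh A y" if y: "y \<in> range (lincomb_vec n v S)" "y \<noteq> 0\<^sub>v n" for y
  proof -
    obtain d where d: "y = lincomb_vec n v T d" using y(1) unfolding T(2)[symmetric] by auto
    define N where "N = sqrt (\<Sum>k\<in>T. (d k)\<^sup>2)"
    have "(\<Sum>k\<in>T. (d k)\<^sup>2) \<noteq> 0"
    proof
      assume "(\<Sum>k\<in>T. (d k)\<^sup>2) = 0"
      then have "d k = 0" if "k \<in> T" for k using that fin by (simp add: sum_nonneg_eq_0_iff)
      then have "y = 0\<^sub>v n" unfolding d lincomb_vec_def by (intro eq_vecI) auto
      then show False using y by simp
    qed
    then have N: "0 < N" "N\<^sup>2 = (\<Sum>k\<in>T. (d k)\<^sup>2)"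
      unfolding N_def by (auto simp: less_le sum_nonneg)
    define c where "c k = (if k \<in> T then d k / N else 0)" for k
    have s1: "(\<Sum>k\<in>T. (c k)\<^sup>2) = 1"
    proof -
      have "(\<Sum>k\<in>T. (c k)\<^sup>2) = (\<Sum>k\<in>T. (d k)\<^sup>2) / N\<^sup>2"
        unfolding sum_divide_distrib by (rule sum.cong) (auto simp: c_def power_divide)
      also have "\<dots> = 1" using N by (simp flip: N(2))
      finally show ?thesis .
    qed
    have cle: "\<bar>c k\<bar> \<le> 1" if "k \<in> T" for k
    proof -
      have "(c k)\<^sup>2 \<le> 1" unfolding s1[symmetric] by (rule member_le_sum) (use that fin in auto)
      then show ?thesis by (simp add: abs_square_le_1)
    qed
    have "c k = 0" if "k \<notin> T" for k using that by (simp add: c_def)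
    then have "c \<in> K" using s1 cle unfolding K_def
      by (auto simp: abs_le_iff)
    moreover have "lincomb_vec n v T c = (1 / N) \<cdot>\<^sub>v y"
      unfolding d lincomb_vec_def by (intro eq_vecI) (auto simp: c_def sum_distrib_left intro!: sum.cong)
    moreover have "rayleigh A ((1 / N) \<cdot>\<^sub>v y) = rayleigh A y"
      by (rule rayleigh_smult[OF A]) (use N d lc in auto)
    ultimately show ?thesis by (intro bexI[of _ c]) simp_all
  qed
  have "K \<noteq> {}" using lift[OF ne] by auto
  moreover have "continuous_on K (\<lambda>c. s * rayleigh A (lincomb_vec n v T c))"
  proof -
    have coord: "continuous_on K (\<lambda>c. lincomb_vec n v T c $ i)" if "i < n" for i
      unfolding lincomb_vec_def using that 
      by (auto intro!: continuous_intros continuous_on_subset[OF continuous_on_product_coordinates])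
    have "continuous_on K (\<lambda>c. s * ((\<Sum>i<n. lincomb_vec n v T c $ i * (\<Sum>j<n. A $$ (i, j) * lincomb_vec n v T c $ j)) /
        (\<Sum>i<n. lincomb_vec n v T c $ i * lincomb_vec n v T c $ i)))"
      using scalar_prod_self_pos[OF lc Knz]
      by (intro continuous_intros coord) (auto simp: scalar_prod_sum[OF lc lc] less_le)
    then show ?thesis
      by (simp add: rayleigh_def scalar_prod_sum[OF lc lc] scalar_prod_sum[OF lc mult_mat_vec_carrier[OF A lc]]
        mult_vec_index[OF A lc] del: index_mult_mat_vec)
  qed
  ultimately obtain c where c: "c \<in> K" "\<And>d. d \<in> K \<Longrightarrow> s * rayleigh A (lincomb_vec n v T c) \<le> s * rayleigh A (lincomb_vec n v T d)"
    using continuous_attains_inf[OF compK] by blast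
  show thesis
  proof (rule that[of "lincomb_vec n v T c"])
    show "lincomb_vec n v T c \<in> range (lincomb_vec n v S)" using T by auto
    show "lincomb_vec n v T c \<noteq> 0\<^sub>v n" by (rule Knz[OF c(1)])
    show "s * rayleigh A (lincomb_vec n v T c) \<le> s * rayleigh A y" if "y \<in> range (lincomb_vec n v S)" "y \<noteq> 0\<^sub>v n" for y
      using lift[OF that] c(2) by metis
  qed
qed

lemma eq_0_if_quadratic_nonneg:
  fixes a K :: real
  assumes "\<And>t. 0 \<le> 2 * t * a + t\<^sup>2 * K"
  shows "a = 0"
proof (rule ccontr)
  assume a: "a \<noteq> 0"
  define c where "c = \<bar>K\<bar> + 1"
  have c: "0 < c" "K < c * 2" unfolding c_def by (auto simp: abs_if)
  have "2 * (- a / c) * a + (- a / c)\<^sup>2 * K = a\<^sup>2 / c\<^sup>2 * (K - 2 * c)"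
    using c by (simp add: field_simps power2_eq_square)
  also have "\<dots> < 0" using a c by (intro mult_pos_neg) auto
  finally show False using assms[of "- a / c"] by linarith
qed

text \<open>A vector \<open>u\<close> at which the Rayleigh quotient is extremal is an eigenvector: with the
  residual \<open>y = A u - \<mu> u\<close>, the quadratic form of \<open>s (A - \<mu>)\<close> at \<open>u + t y\<close> is nonnegative
  for all \<open>t\<close> and vanishes at \<open>t = 0\<close>, so its linear coefficient \<open>2 s (y \<bullet> y)\<close> vanishes.\<close>

lemma extremal_eigenvector:
  fixes A :: "real mat"
  assumes A: "A \<in> carrier_mat n n" "transpose_mat A = A" and n: "0 < n" and s: "s \<noteq> 0"
  obtains u \<mu> where "u \<in> carrier_vec n" "u \<bullet> u = 1" "A *\<^sub>v u = \<mu> \<cdot>\<^sub>v u"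
    "\<And>x. x \<in> carrier_vec n \<Longrightarrow> s * (\<mu> * (x \<bullet> x)) \<le> s * (x \<bullet> (A *\<^sub>v x))"
proof -
  have rng: "range (lincomb_vec n (unit_vec n) {..<n}) = carrier_vec n"
  proof (intro equalityI subsetI)
    fix x :: "real vec" assume x: "x \<in> carrier_vec n"
    have "x = lincomb_vec n (unit_vec n) {..<n} (\<lambda>k. x $ k)"
    proof (rule eq_vecI)
      fix i assume "i < dim_vec (lincomb_vec n (unit_vec n) {..<n} (\<lambda>k. x $ k))"
      then have i: "i < n" by (simp add: lincomb_vec_def)
      have "(\<Sum>k<n. x $ k * unit_vec n k $ i) = (\<Sum>k<n. if k = i then x $ i else 0)"
        by (rule sum.cong) (use i in \<open>auto simp: unit_vec_def\<close>)
      then show "x $ i = lincomb_vec n (unit_vec n) {..<n} (\<lambda>k. x $ k) $ i"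
        using i by (simp add: lincomb_vec_def)
    qed (use x in \<open>simp add: lincomb_vec_def\<close>)
    then show "x \<in> range (lincomb_vec n (unit_vec n) {..<n})" by blast
  qed (auto simp: lincomb_vec_def)
  have "unit_vec n 0 \<in> range (lincomb_vec n (unit_vec n) {..<n})" unfolding rng by simp
  moreover have "(unit_vec n 0 :: real vec) \<noteq> 0\<^sub>v n"
    using n by (metis index_unit_vec(2) index_zero_vec(1) zero_neq_one)
  ultimately obtain x0 where x0: "x0 \<in> carrier_vec n" "x0 \<noteq> 0\<^sub>v n"
    "\<And>y. y \<in> carrier_vec n \<Longrightarrow> y \<noteq> 0\<^sub>v n \<Longrightarrow> s * rayleigh A x0 \<le> s * rayleigh A y"
    using rayleigh_attains[OF A(1), of "{..<n}" "unit_vec n 0" "unit_vec n" s] unfolding rng by blast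
  define N where "N = sqrt (x0 \<bullet> x0)"
  define \<mu> where "\<mu> = rayleigh A x0"
  have N: "0 < N" "N * N = x0 \<bullet> x0" unfolding N_def using scalar_prod_self_pos[OF x0(1,2)] by auto
  define u where "u = (1 / N) \<cdot>\<^sub>v x0"
  have u: "u \<in> carrier_vec n" using x0 by (simp add: u_def)
  have uu: "u \<bullet> u = 1" unfolding u_def using x0 N by (simp flip: N(2))
  have Av: "A *\<^sub>v x \<in> carrier_vec n" if "x \<in> carrier_vec n" for x
    using A(1) that by (rule mult_mat_vec_carrier)
  have bound: "s * (\<mu> * (x \<bullet> x)) \<le> s * (x \<bullet> (A *\<^sub>v x))" if x: "x \<in> carrier_vec n" for x
  proof (cases "x = 0\<^sub>v n")
    case True
    then show ?thesis using A by (simp add: mult_mat_zero_vec)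
  next
    case False
    have p: "0 < x \<bullet> x" by (rule scalar_prod_self_pos[OF x False])
    have "s * \<mu> * (x \<bullet> x) \<le> s * rayleigh A x * (x \<bullet> x)"
      using x0(3)[OF x False] p unfolding \<mu>_def by (intro mult_right_mono) auto
    then show ?thesis using p by (simp add: rayleigh_def mult.assoc)
  qed
  have uAu: "u \<bullet> (A *\<^sub>v u) = \<mu>"
  proof -
    have "rayleigh A u = \<mu>" unfolding u_def \<mu>_def
      by (rule rayleigh_smult[OF A(1) x0(1)]) (use N in simp)
    then show ?thesis using uu by (simp add: rayleigh_def)
  qed
  define y where "y = A *\<^sub>v u - \<mu> \<cdot>\<^sub>v u"
  have y: "y \<in> carrier_vec n" unfolding y_def using Av[OF u] u by auto
  have yu: "y \<bullet> (A *\<^sub>v u) - \<mu> * (y \<bullet> u) = y \<bullet> y"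
    using scalar_prod_minus_distrib[OF y Av[OF u], of "\<mu> \<cdot>\<^sub>v u", folded y_def] y u by simp
  have "s * (y \<bullet> y) = 0"
  proof (rule eq_0_if_quadratic_nonneg)
    fix t :: real
    define z where "z = u + t \<cdot>\<^sub>v y"
    have z: "z \<in> carrier_vec n" using u y by (simp add: z_def)
    have Az: "A *\<^sub>v z = A *\<^sub>v u + t \<cdot>\<^sub>v (A *\<^sub>v y)"
      unfolding z_def using A u y by (simp add: mult_add_distrib_mat_vec[of _ n n] mult_mat_vec[of _ n n])
    have c: "u \<bullet> (A *\<^sub>v y) = y \<bullet> (A *\<^sub>v u)" "u \<bullet> y = y \<bullet> u"
      using symmetric_scalar_prod[OF A u y] u y Av by (metis comm_scalar_prod)+
    have "z \<bullet> (A *\<^sub>v z) = \<mu> + 2 * t * (y \<bullet> (A *\<^sub>v u)) + t * t * (y \<bullet> (A *\<^sub>v y))"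
      unfolding Az unfolding z_def using u y Av[OF u] Av[OF y]
      by (simp add: scalar_prod_add_distrib[of _ n] add_scalar_prod_distrib[of _ n] c uAu algebra_simps)
    moreover have "z \<bullet> z = 1 + 2 * t * (y \<bullet> u) + t * t * (y \<bullet> y)"
      unfolding z_def using u y
      by (simp add: scalar_prod_add_distrib[of _ n] add_scalar_prod_distrib[of _ n] c uu algebra_simps)
    moreover have "0 \<le> s * (z \<bullet> (A *\<^sub>v z)) - s * (\<mu> * (z \<bullet> z))" using bound[OF z] by simp
    ultimately have "0 \<le> 2 * t * (s * (y \<bullet> (A *\<^sub>v u) - \<mu> * (y \<bullet> u)))
        + t * t * (s * (y \<bullet> (A *\<^sub>v y) - \<mu> * (y \<bullet> y)))"
      by (simp add: algebra_simps)
    then show "0 \<le> 2 * t * (s * (y \<bullet> y)) + t\<^sup>2 * (s * (y \<bullet> (A *\<^sub>v y) - \<mu> * (y \<bullet> y)))"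
      unfolding yu by (simp add: power2_eq_square)
  qed
  then have "y = 0\<^sub>v n" using s scalar_prod_self_pos[OF y] by auto
  have eig: "A *\<^sub>v u = \<mu> \<cdot>\<^sub>v u"
  proof (intro eq_vecI)
    fix i assume "i < dim_vec (\<mu> \<cdot>\<^sub>v u)"
    then have i: "i < n" using u by simp
    have "y $ i = (A *\<^sub>v u) $ i - (\<mu> \<cdot>\<^sub>v u) $ i" unfolding y_def using i u by (subst index_minus_vec) auto
    then show "(A *\<^sub>v u) $ i = (\<mu> \<cdot>\<^sub>v u) $ i" using i \<open>y = 0\<^sub>v n\<close> by simp
  qed (use u A in auto)
  show thesis by (rule that[OF u uu eig bound])
qed

lemma spectrum_extremum:
  fixes A :: "real mat"
  assumes A: "A \<in> carrier_mat n n" and u: "u \<in> carrier_vec n" "u \<bullet> u = 1" "A *\<^sub>v u = \<mu> \<cdot>\<^sub>v u"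
    and bound: "\<And>x. x \<in> carrier_vec n \<Longrightarrow> s * (\<mu> * (x \<bullet> x)) \<le> s * (x \<bullet> (A *\<^sub>v x))"
  shows "\<mu> \<in> spectrum A" and "l \<in> spectrum A \<Longrightarrow> s * \<mu> \<le> s * l"
proof -
  show "\<mu> \<in> spectrum A" unfolding spectrum_def eigenvalue_def eigenvector_def
    using A u by (auto intro!: exI[of _ u])
  assume "l \<in> spectrum A"
  then obtain w where w: "w \<in> carrier_vec n" "w \<noteq> 0\<^sub>v n" "A *\<^sub>v w = l \<cdot>\<^sub>v w"
    using A unfolding spectrum_def eigenvalue_def eigenvector_def by auto
  have "(s * \<mu>) * (w \<bullet> w) \<le> (s * l) * (w \<bullet> w)" using bound[OF w(1)] w by (simp add: mult.assoc)
  then show "s * \<mu> \<le> s * l" by (rule mult_right_le_imp_le[OF _ scalar_prod_self_pos[OF w(1,2)]])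
qed

lemma eig_min_eqI:
  assumes A: "A \<in> carrier_mat n n" and u: "u \<in> carrier_vec n" "u \<bullet> u = 1" "A *\<^sub>v u = \<mu> \<cdot>\<^sub>v u"
    and bound: "\<And>x. x \<in> carrier_vec n \<Longrightarrow> \<mu> * (x \<bullet> x) \<le> x \<bullet> (A *\<^sub>v x)"
  shows "eig_min A = \<mu>"
  unfolding eig_min_def using spectrum_extremum[OF A u, of 1] bound
  by (intro Min_eqI card_finite_spectrum[OF A]) auto

lemma eig_max_eqI:
  assumes A: "A \<in> carrier_mat n n" and u: "u \<in> carrier_vec n" "u \<bullet> u = 1" "A *\<^sub>v u = \<mu> \<cdot>\<^sub>v u"
    and bound: "\<And>x. x \<in> carrier_vec n \<Longrightarrow> x \<bullet> (A *\<^sub>v x) \<le> \<mu> * (x \<bullet> x)"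
  shows "eig_max A = \<mu>"
  unfolding eig_max_def using spectrum_extremum[OF A u, of "-1"] bound
  by (intro Max_eqI card_finite_spectrum[OF A]) auto

lemma spd_extremal_eigenvalues:
  assumes A: "A \<in> spd_mats n" and n: "0 < n"
  shows "\<exists>u\<in>carrier_vec n. u \<bullet> u = 1 \<and> A *\<^sub>v u = eig_min A \<cdot>\<^sub>v u"
    and "\<exists>w\<in>carrier_vec n. w \<bullet> w = 1 \<and> A *\<^sub>v w = eig_max A \<cdot>\<^sub>v w"
    and "x \<in> carrier_vec n \<Longrightarrow> eig_min A * (x \<bullet> x) \<le> x \<bullet> (A *\<^sub>v x)"
    and "x \<in> carrier_vec n \<Longrightarrow> x \<bullet> (A *\<^sub>v x) \<le> eig_max A * (x \<bullet> x)"
    and "0 < eig_min A"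
proof -
  have Ac: "A \<in> carrier_mat n n" "transpose_mat A = A"
    and pos: "\<And>x. x \<in> carrier_vec n \<Longrightarrow> x \<noteq> 0\<^sub>v n \<Longrightarrow> 0 < x \<bullet> (A *\<^sub>v x)"
    using A by (auto simp: spd_mats_def)
  obtain u \<mu> where u: "u \<in> carrier_vec n" "u \<bullet> u = 1" "A *\<^sub>v u = \<mu> \<cdot>\<^sub>v u"
    "\<And>x. x \<in> carrier_vec n \<Longrightarrow> 1 * (\<mu> * (x \<bullet> x)) \<le> 1 * (x \<bullet> (A *\<^sub>v x))"
    by (rule extremal_eigenvector[OF Ac n, of 1]) auto
  obtain w \<nu> where w: "w \<in> carrier_vec n" "w \<bullet> w = 1" "A *\<^sub>v w = \<nu> \<cdot>\<^sub>v w"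
    "\<And>x. x \<in> carrier_vec n \<Longrightarrow> -1 * (\<nu> * (x \<bullet> x)) \<le> -1 * (x \<bullet> (A *\<^sub>v x))"
    by (rule extremal_eigenvector[OF Ac n, of "-1"]) auto
  have m: "eig_min A = \<mu>" by (rule eig_min_eqI[OF Ac(1) u(1-3)]) (use u(4) in simp)
  have M: "eig_max A = \<nu>" by (rule eig_max_eqI[OF Ac(1) w(1-3)]) (use w(4) in simp)
  show "\<exists>u\<in>carrier_vec n. u \<bullet> u = 1 \<and> A *\<^sub>v u = eig_min A \<cdot>\<^sub>v u" using u m by auto
  show "\<exists>w\<in>carrier_vec n. w \<bullet> w = 1 \<and> A *\<^sub>v w = eig_max A \<cdot>\<^sub>v w" using w M by auto
  show "eig_min A * (x \<bullet> x) \<le> x \<bullet> (A *\<^sub>v x)" if "x \<in> carrier_vec n" using u(4)[OF that] m by simp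
  show "x \<bullet> (A *\<^sub>v x) \<le> eig_max A * (x \<bullet> x)" if "x \<in> carrier_vec n" using w(4)[OF that] M by simp
  have "u \<noteq> 0\<^sub>v n" using u by auto
  then show "0 < eig_min A" using pos[OF u(1)] u m by simp
qed

lemma rayleigh_krylov_attains:
  assumes A: "A \<in> carrier_mat n n" and b: "b \<in> carrier_vec n" "b \<noteq> 0\<^sub>v n" and m: "0 < m"
  obtains x where "x \<in> krylov A b m" "x \<noteq> 0\<^sub>v n"
    "\<And>y. y \<in> krylov A b m \<Longrightarrow> y \<noteq> 0\<^sub>v n \<Longrightarrow> s * rayleigh A x \<le> s * rayleigh A y"
proof -
  have "b \<in> krylov A b m" unfolding krylov_eq[OF A b(1) m]
    using m pvec_1[OF A b(1)] by (auto intro!: exI[of _ 1])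
  then show thesis
    using rayleigh_attains[OF A, of "{..<m}" b "\<lambda>k. (A ^\<^sub>m k) *\<^sub>v b" s] b(2) that
    unfolding range_lincomb_vec_powers[OF b(1) m] krylov_eq[OF A b(1) m] by blast
qed

text \<open>That the extremum is attained is what gives \<open>LEAST\<close> and \<open>GREATEST\<close> in the definitions
  of the Ritz values their intended meaning.\<close>

lemma ritz_min_attained:
  assumes A: "A \<in> carrier_mat n n" and b: "b \<in> carrier_vec n" "b \<noteq> 0\<^sub>v n" and m: "0 < m"
  shows "\<exists>x\<in>krylov A b m. x \<noteq> 0\<^sub>v n \<and> ritz_min A b m = rayleigh A x"
    and "x \<in> krylov A b m \<Longrightarrow> x \<noteq> 0\<^sub>v n \<Longrightarrow> ritz_min A b m \<le> rayleigh A x"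
proof -
  obtain x0 where x0: "x0 \<in> krylov A b m" "x0 \<noteq> 0\<^sub>v n"
    "\<And>y. y \<in> krylov A b m \<Longrightarrow> y \<noteq> 0\<^sub>v n \<Longrightarrow> 1 * rayleigh A x0 \<le> 1 * rayleigh A y"
    using rayleigh_krylov_attains[OF A b m, of 1] by blast
  have d: "dim_vec b = n" using b by simp
  have e: "ritz_min A b m = rayleigh A x0"
    unfolding ritz_min_def d by (rule Least_equality) (use x0 in auto)
  show "\<exists>x\<in>krylov A b m. x \<noteq> 0\<^sub>v n \<and> ritz_min A b m = rayleigh A x" using x0 e by auto
  show "ritz_min A b m \<le> rayleigh A x" if "x \<in> krylov A b m" "x \<noteq> 0\<^sub>v n" using x0(3)[OF that] e by simp
qed

lemma ritz_max_attained:
  assumes A: "A \<in> carrier_mat n n" and b: "b \<in> carrier_vec n" "b \<noteq> 0\<^sub>v n" and m: "0 < m"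
  shows "\<exists>x\<in>krylov A b m. x \<noteq> 0\<^sub>v n \<and> ritz_max A b m = rayleigh A x"
    and "x \<in> krylov A b m \<Longrightarrow> x \<noteq> 0\<^sub>v n \<Longrightarrow> rayleigh A x \<le> ritz_max A b m"
proof -
  obtain x0 where x0: "x0 \<in> krylov A b m" "x0 \<noteq> 0\<^sub>v n"
    "\<And>y. y \<in> krylov A b m \<Longrightarrow> y \<noteq> 0\<^sub>v n \<Longrightarrow> - 1 * rayleigh A x0 \<le> - 1 * rayleigh A y"
    using rayleigh_krylov_attains[OF A b m, of "- 1"] by blast
  have d: "dim_vec b = n" using b by simp
  have e: "ritz_max A b m = rayleigh A x0"
    unfolding ritz_max_def d by (rule Greatest_equality) (use x0 in auto)
  show "\<exists>x\<in>krylov A b m. x \<noteq> 0\<^sub>v n \<and> ritz_max A b m = rayleigh A x" using x0 e by auto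
  show "rayleigh A x \<le> ritz_max A b m" if "x \<in> krylov A b m" "x \<noteq> 0\<^sub>v n" using x0(3)[OF that] e by simp
qed

section \<open>Accuracy of the extremal Ritz values\<close>

lemma moment_linear_square:
  assumes A: "A \<in> carrier_mat n n" "transpose_mat A = A" and b: "b \<in> carrier_vec n"
  shows "moment A b ([:\<alpha>, \<beta>:] * P\<^sup>2)
    = \<alpha> * (pvec A b P \<bullet> pvec A b P) + \<beta> * (pvec A b P \<bullet> (A *\<^sub>v pvec A b P))"
proof -
  have "[:\<alpha>, \<beta>:] * P\<^sup>2 = Polynomial.smult \<alpha> (P * P) + Polynomial.smult \<beta> (P * pCons 0 P)"
    by (simp add: power2_eq_square)
  then show ?thesis
    by (simp only: moment_add[OF b] moment_smult[OF b] pvec_scalar_prod[OF A b, symmetric]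
        pvec_shift[OF A(1) b])
qed

lemma pvec_eigenvector:
  assumes A: "A \<in> carrier_mat n n" "transpose_mat A = A" and b: "b \<in> carrier_vec n"
    and u: "u \<in> carrier_vec n" "A *\<^sub>v u = \<mu> \<cdot>\<^sub>v u"
  shows "u \<bullet> pvec A b P = poly P \<mu> * (u \<bullet> b)"
proof (induction P rule: pCons_induct)
  case 0
  show ?case using u by (simp add: pvec_0[OF b])
next
  case (pCons a P)
  note c = pvec_carrier[OF b, of A P]
  have "u \<bullet> pvec A b (pCons a P) = a * (u \<bullet> b) + u \<bullet> (A *\<^sub>v pvec A b P)"
    unfolding pvec_pCons[OF A(1) b] using u b mult_mat_vec_carrier[OF A(1) c]
    by (simp add: scalar_prod_add_distrib[of _ n])
  also have "u \<bullet> (A *\<^sub>v pvec A b P) = \<mu> * (u \<bullet> pvec A b P)"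
    using symmetric_scalar_prod[OF A u(1) c] u c by simp
  finally show ?case using pCons.IH by (simp add: algebra_simps)
qed

lemma scalar_prod_Cauchy_Schwarz:
  assumes "x \<in> carrier_vec n" "y \<in> carrier_vec n"
  shows "(x \<bullet> y)\<^sup>2 \<le> (x \<bullet> x) * (y \<bullet> (y :: real vec))"
  using assms Cauchy_Schwarz_ineq_sum[of "\<lambda>i. x $ i" "\<lambda>i. y $ i" "{..<n}"]
  by (simp add: scalar_prod_sum power2_eq_square)

text \<open>The linear polynomial \<open>X = \<alpha> + \<beta> x\<close> is a normalised distance from the extremal
  eigenvalue \<open>\<mu>\<close>: it vanishes at \<open>\<mu>\<close>, and \<open>X(A) \<le> 1\<close>. Let \<open>Y\<close> be the affine function of \<open>X\<close>
  that maps \<open>[r\<^sup>2, 1]\<close> to \<open>[-1, 1]\<close> and substitute it into the identity of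
  \<open>light_polynomial\<close>. With \<open>P = V \<circ> Y\<close> and \<open>Q = W \<circ> Y\<close> this gives
  \<open>(X - r\<^sup>2) P\<^sup>2 + (1 - X) Q\<^sup>2 = 1 - r\<^sup>2\<close>. Applying the moment functional and discarding the
  nonnegative second term bounds the form of \<open>X - r\<^sup>2\<close> at \<open>P(A) b\<close> by \<open>b \<bullet> b\<close>, while the
  component of \<open>P(A) b\<close> along \<open>u\<close> is amplified exponentially in \<open>k\<close>. Choosing \<open>\<beta> > 0\<close> or
  \<open>\<beta> < 0\<close> covers the two ends of the spectrum.\<close>

lemma krylov_near_eigenvector:
  assumes A: "A \<in> carrier_mat n n" "transpose_mat A = A" and b: "b \<in> carrier_vec n"
    and u: "u \<in> carrier_vec n" "u \<bullet> u = 1" "A *\<^sub>v u = \<mu> \<cdot>\<^sub>v u"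
    and zero: "\<alpha> + \<beta> * \<mu> = 0"
    and le1: "\<And>x. x \<in> carrier_vec n \<Longrightarrow> \<alpha> * (x \<bullet> x) + \<beta> * (x \<bullet> (A *\<^sub>v x)) \<le> x \<bullet> x"
    and r: "0 \<le> r" "r < 1"
  obtains P where "degree P \<le> k"
    "((1 + r) / (1 - r)) ^ (2 * k) * (u \<bullet> b)\<^sup>2 \<le> pvec A b P \<bullet> pvec A b P"
    "\<alpha> * (pvec A b P \<bullet> pvec A b P) + \<beta> * (pvec A b P \<bullet> (A *\<^sub>v pvec A b P))
      \<le> r\<^sup>2 * (pvec A b P \<bullet> pvec A b P) + b \<bullet> b"
proof -
  obtain V W :: "real poly" where VW: "degree V \<le> k" "[:1, 1:] * V\<^sup>2 + [:1, -1:] * W\<^sup>2 = [:2:]"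
    "((1 + r) / (1 - r)) ^ k \<le> \<bar>poly V (- ((1 + r\<^sup>2) / (1 - r\<^sup>2)))\<bar>"
    by (rule light_polynomial[OF r])
  define t where "t = r\<^sup>2"
  have t: "0 \<le> t" "t < 1" using r by (auto simp: t_def power_less_one_iff)
  define Y where "Y = [:(2 * \<alpha> - (1 + t)) / (1 - t), 2 * \<beta> / (1 - t):]"
  define P where "P = V \<circ>\<^sub>p Y"
  define Q where "Q = W \<circ>\<^sub>p Y"
  define p where "p = pvec A b P"
  have p: "p \<in> carrier_vec n" unfolding p_def by (rule pvec_carrier[OF b])
  have dP: "degree P \<le> k"
  proof -
    have "degree P \<le> degree V * degree Y" unfolding P_def by (rule degree_pcompose_le)
    also have "\<dots> \<le> degree V * 1" unfolding Y_def by (intro mult_left_mono) auto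
    finally show ?thesis using VW(1) by simp
  qed
  have "2 * \<alpha> + 2 * \<beta> * \<mu> = 0" using zero by linarith
  have Ymu: "poly Y \<mu> = - ((1 + t) / (1 - t))"
  proof -
    have "poly Y \<mu> = (2 * \<alpha> - (1 + t) + 2 * \<beta> * \<mu>) / (1 - t)"
      by (simp add: Y_def add_divide_distrib diff_divide_distrib mult_ac)
    also have "2 * \<alpha> - (1 + t) + 2 * \<beta> * \<mu> = - (1 + t)"
      using \<open>2 * \<alpha> + 2 * \<beta> * \<mu> = 0\<close> by linarith
    finally show ?thesis by (simp only: minus_divide_left)
  qed
  have up: "u \<bullet> p = poly V (- ((1 + t) / (1 - t))) * (u \<bullet> b)"
    unfolding p_def pvec_eigenvector[OF A b u(1,3)] by (simp add: P_def poly_pcompose Ymu)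
  have "((1 + r) / (1 - r)) ^ (2 * k) * (u \<bullet> b)\<^sup>2 \<le> (poly V (- ((1 + t) / (1 - t))))\<^sup>2 * (u \<bullet> b)\<^sup>2"
  proof (rule mult_right_mono)
    have "(((1 + r) / (1 - r)) ^ k)\<^sup>2 \<le> \<bar>poly V (- ((1 + t) / (1 - t)))\<bar>\<^sup>2"
      using VW(3) r unfolding t_def by (intro power_mono) auto
    then show "((1 + r) / (1 - r)) ^ (2 * k) \<le> (poly V (- ((1 + t) / (1 - t))))\<^sup>2"
      by (simp add: power_mult[symmetric] mult.commute)
  qed simp
  also have "\<dots> = (u \<bullet> p)\<^sup>2" unfolding up by (simp add: power_mult_distrib)
  also have "\<dots> \<le> p \<bullet> p" using scalar_prod_Cauchy_Schwarz[OF u(1) p] u(2) by simp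
  finally have 1: "((1 + r) / (1 - r)) ^ (2 * k) * (u \<bullet> b)\<^sup>2 \<le> p \<bullet> p" .
  have id: "[:\<alpha> - t, \<beta>:] * P\<^sup>2 + [:1 - \<alpha>, - \<beta>:] * Q\<^sup>2 = [:1 - t:]"
  proof -
    have "([:1, 1:] * V\<^sup>2 + [:1, -1:] * W\<^sup>2) \<circ>\<^sub>p Y = [:2:] \<circ>\<^sub>p Y" using VW(2) by simp
    then have e: "([:1, 1:] \<circ>\<^sub>p Y) * P\<^sup>2 + ([:1, -1:] \<circ>\<^sub>p Y) * Q\<^sup>2 = [:2:]"
      by (simp only: pcompose_add pcompose_mult power2_eq_square P_def Q_def pcompose_const)
    have c: "[:1, 1:] \<circ>\<^sub>p Y = Polynomial.smult (2 / (1 - t)) [:\<alpha> - t, \<beta>:]"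
      "[:1, -1:] \<circ>\<^sub>p Y = Polynomial.smult (2 / (1 - t)) [:1 - \<alpha>, - \<beta>:]"
      using t by (simp_all add: Y_def pcompose_pCons field_simps)
    have "Polynomial.smult ((1 - t) / 2) (([:1, 1:] \<circ>\<^sub>p Y) * P\<^sup>2 + ([:1, -1:] \<circ>\<^sub>p Y) * Q\<^sup>2)
        = [:\<alpha> - t, \<beta>:] * P\<^sup>2 + [:1 - \<alpha>, - \<beta>:] * Q\<^sup>2"
    proof -
      have h: "(1 - t) / 2 * (2 / (1 - t)) = 1" using t by simp
      show ?thesis unfolding c smult_add_right mult_smult_left smult_smult h by simp
    qed
    moreover have "Polynomial.smult ((1 - t) / 2) [:2:] = [:1 - t:]" by simp
    ultimately show ?thesis unfolding e by (simp only:)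
  qed
  have "moment A b ([:\<alpha> - t, \<beta>:] * P\<^sup>2) + moment A b ([:1 - \<alpha>, - \<beta>:] * Q\<^sup>2) = (1 - t) * (b \<bullet> b)"
  proof -
    have "moment A b [:1 - t:] = (1 - t) * moment A b 1"
      using moment_smult[OF b, of A "1 - t" 1] by (simp add: one_pCons)
    also have "moment A b 1 = b \<bullet> b" unfolding moment_def pvec_1[OF A(1) b] ..
    finally show ?thesis unfolding id[symmetric] moment_add[OF b] .
  qed
  moreover have "0 \<le> moment A b ([:1 - \<alpha>, - \<beta>:] * Q\<^sup>2)"
    unfolding moment_linear_square[OF A b] using le1[OF pvec_carrier[OF b, of A Q]]
    by (simp add: algebra_simps)
  moreover have "(1 - t) * (b \<bullet> b) \<le> b \<bullet> b"
    using t scalar_prod_self_nonneg[of b] by (simp add: algebra_simps)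
  ultimately have "moment A b ([:\<alpha> - t, \<beta>:] * P\<^sup>2) \<le> b \<bullet> b" by linarith
  then have 2: "\<alpha> * (p \<bullet> p) + \<beta> * (p \<bullet> (A *\<^sub>v p)) \<le> r\<^sup>2 * (p \<bullet> p) + b \<bullet> b"
    unfolding moment_linear_square[OF A b] p_def[symmetric] t_def by (simp add: algebra_simps)
  show thesis by (rule that[of P, folded p_def]) (fact dP 1 2)+
qed

lemma ritz_bounds:
  assumes A: "A \<in> spd_mats n" and n: "0 < n" and b: "b \<in> carrier_vec n" "b \<noteq> 0\<^sub>v n" and m: "0 < m"
  shows "eig_min A \<le> ritz_min A b m" "ritz_max A b m \<le> eig_max A"
    "ritz_min A b m \<le> ritz_max A b m" "0 < ritz_min A b m"
proof -
  have Ac: "A \<in> carrier_mat n n" using A by (auto simp: spd_mats_def)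
  note e = spd_extremal_eigenvalues(3-5)[OF A n]
  have K: "krylov A b m \<subseteq> carrier_vec n" unfolding krylov_eq[OF Ac b(1) m] using pvec_carrier[OF b(1)] by auto
  obtain x where x: "x \<in> krylov A b m" "x \<noteq> 0\<^sub>v n" "ritz_min A b m = rayleigh A x"
    using ritz_min_attained(1)[OF Ac b m] by auto
  obtain y where y: "y \<in> krylov A b m" "y \<noteq> 0\<^sub>v n" "ritz_max A b m = rayleigh A y"
    using ritz_max_attained(1)[OF Ac b m] by auto
  show 1: "eig_min A \<le> ritz_min A b m"
    unfolding x(3) rayleigh_def using e(1)[of x] scalar_prod_self_pos[of x n] K x by (auto simp: le_divide_eq)
  show "ritz_max A b m \<le> eig_max A"
    unfolding y(3) rayleigh_def using e(2)[of y] scalar_prod_self_pos[of y n] K y by (auto simp: divide_le_eq)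
  show "ritz_min A b m \<le> ritz_max A b m" using ritz_max_attained(2)[OF Ac b m x(1,2)] x by simp
  show "0 < ritz_min A b m" using 1 e(3) by linarith
qed

lemma lanczos_relative_error_range:
  assumes A: "A \<in> spd_mats n" and n: "0 < n" and b: "b \<in> carrier_vec n" "b \<noteq> 0\<^sub>v n" and m: "0 < m"
  shows "0 \<le> (cond_num A - lanczos_cond A b m) / cond_num A"
    and "(cond_num A - lanczos_cond A b m) / cond_num A \<le> 1"
    and "0 < lanczos_cond A b m" "lanczos_cond A b m \<le> cond_num A"
proof -
  note R = ritz_bounds[OF A n b m]
  note e = spd_extremal_eigenvalues(5)[OF A n]
  show l: "0 < lanczos_cond A b m" unfolding lanczos_cond_def using R by auto
  show le: "lanczos_cond A b m \<le> cond_num A" unfolding lanczos_cond_def cond_num_def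
    by (rule frac_le) (use R e in auto)
  show "0 \<le> (cond_num A - lanczos_cond A b m) / cond_num A"
    "(cond_num A - lanczos_cond A b m) / cond_num A \<le> 1"
    using l le by (auto simp: divide_le_eq)
qed

text \<open>Applied at both ends of the spectrum, \<open>krylov_near_eigenvector\<close> shows that each extremal
  Ritz value misses its eigenvalue by at most \<open>(\<lambda>\<^sub>1 - \<lambda>\<^sub>n) e\<close>, where \<open>e\<close> is the bracket on the
  right-hand side. The loss in the quotient of the two Ritz values is at most \<open>\<kappa> + 1\<close> times
  \<open>e (\<lambda>\<^sub>1 - \<lambda>\<^sub>n) / \<lambda>\<^sub>1 \<le> e\<close>.\<close>

lemma lanczos_relative_error_le:
  assumes A: "A \<in> spd_mats n" and n: "0 < n" and b: "b \<in> carrier_vec n" "b \<bullet> b = 1"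
    and u: "u \<in> carrier_vec n" "u \<bullet> u = 1" "A *\<^sub>v u = eig_min A \<cdot>\<^sub>v u"
    and w: "w \<in> carrier_vec n" "w \<bullet> w = 1" "A *\<^sub>v w = eig_max A \<cdot>\<^sub>v w"
    and r: "0 \<le> r" "r < 1" and \<theta>: "0 < \<theta>" "\<theta>\<^sup>2 \<le> (u \<bullet> b)\<^sup>2" "\<theta>\<^sup>2 \<le> (w \<bullet> b)\<^sup>2"
  shows "(cond_num A - lanczos_cond A b (Suc k)) / cond_num A
    \<le> (cond_num A + 1) * (r\<^sup>2 + 1 / (((1 + r) / (1 - r)) ^ (2 * k) * \<theta>\<^sup>2))"
proof -
  define e where "e = r\<^sup>2 + 1 / (((1 + r) / (1 - r)) ^ (2 * k) * \<theta>\<^sup>2)"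
  define l where "l = eig_min A"
  define L where "L = eig_max A"
  define D where "D = L - l"
  define \<rho> where "\<rho> = ((1 + r) / (1 - r)) ^ (2 * k)"
  have Ac: "A \<in> carrier_mat n n" "transpose_mat A = A" using A by (auto simp: spd_mats_def)
  have b0: "b \<noteq> 0\<^sub>v n" using b by auto
  note R = ritz_bounds[OF A n b(1) b0, of "Suc k", simplified, folded l_def L_def]
  have lo: "\<And>x. x \<in> carrier_vec n \<Longrightarrow> l * (x \<bullet> x) \<le> x \<bullet> (A *\<^sub>v x)"
    and hi: "\<And>x. x \<in> carrier_vec n \<Longrightarrow> x \<bullet> (A *\<^sub>v x) \<le> L * (x \<bullet> x)"
    and l: "0 < l"
    unfolding l_def L_def using spd_extremal_eigenvalues(3-5)[OF A n] by auto
  have \<rho>: "0 < \<rho>" unfolding \<rho>_def using r by simp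
  have e0: "0 \<le> e" unfolding e_def using \<rho> by (simp add: \<rho>_def[symmetric])
  have L: "l \<le> L" using R by linarith
  have one: "(\<alpha> * (p \<bullet> p) + \<beta> * (p \<bullet> (A *\<^sub>v p))) \<le> e * (p \<bullet> p) \<and> 0 < p \<bullet> p"
    if "\<rho> * (z \<bullet> b)\<^sup>2 \<le> p \<bullet> p" "\<theta>\<^sup>2 \<le> (z \<bullet> b)\<^sup>2"
      "\<alpha> * (p \<bullet> p) + \<beta> * (p \<bullet> (A *\<^sub>v p)) \<le> r\<^sup>2 * (p \<bullet> p) + b \<bullet> b" for p z \<alpha> \<beta>
  proof -
    have 1: "\<rho> * \<theta>\<^sup>2 \<le> p \<bullet> p" using that(1,2) mult_left_mono[of "\<theta>\<^sup>2" "(z \<bullet> b)\<^sup>2" \<rho>] \<rho> by linarith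
    have 2: "0 < \<rho> * \<theta>\<^sup>2" using \<rho> \<theta> by simp
    have "1 \<le> 1 / (\<rho> * \<theta>\<^sup>2) * (p \<bullet> p)" using 1 2 by (simp add: le_divide_eq)
    then have "\<alpha> * (p \<bullet> p) + \<beta> * (p \<bullet> (A *\<^sub>v p)) \<le> r\<^sup>2 * (p \<bullet> p) + 1 / (\<rho> * \<theta>\<^sup>2) * (p \<bullet> p)"
      using that(3) b by linarith
    then show ?thesis using 1 2 unfolding e_def \<rho>_def[symmetric] distrib_right by linarith
  qed
  have mainD: "ritz_min A b (Suc k) \<le> l + D * e \<and> L - D * e \<le> ritz_max A b (Suc k)"
  proof (cases "D = 0")
    case True
    then show ?thesis using R unfolding D_def by auto
  next
    case False
    then have D: "0 < D" using L by (simp add: D_def)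
    have c1: "- l / D + 1 / D * l = 0" "L / D + - (1 / D) * L = 0" by simp_all
    have c2: "- l / D * (x \<bullet> x) + 1 / D * (x \<bullet> (A *\<^sub>v x)) \<le> x \<bullet> x"
      and c3: "L / D * (x \<bullet> x) + - (1 / D) * (x \<bullet> (A *\<^sub>v x)) \<le> x \<bullet> x"
      if x: "x \<in> carrier_vec n" for x
    proof -
      have "- l / D * (x \<bullet> x) + 1 / D * (x \<bullet> (A *\<^sub>v x)) = (x \<bullet> (A *\<^sub>v x) - l * (x \<bullet> x)) / D"
        by (simp add: diff_divide_distrib)
      also have "\<dots> \<le> x \<bullet> x" using hi[OF x] D by (simp add: divide_le_eq D_def algebra_simps)
      finally show "- l / D * (x \<bullet> x) + 1 / D * (x \<bullet> (A *\<^sub>v x)) \<le> x \<bullet> x" .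
      have "L / D * (x \<bullet> x) + - (1 / D) * (x \<bullet> (A *\<^sub>v x)) = (L * (x \<bullet> x) - x \<bullet> (A *\<^sub>v x)) / D"
        by (simp add: diff_divide_distrib)
      also have "\<dots> \<le> x \<bullet> x" using lo[OF x] D by (simp add: divide_le_eq D_def algebra_simps)
      finally show "L / D * (x \<bullet> x) + - (1 / D) * (x \<bullet> (A *\<^sub>v x)) \<le> x \<bullet> x" .
    qed
    obtain P where P: "degree P \<le> k" "\<rho> * (u \<bullet> b)\<^sup>2 \<le> pvec A b P \<bullet> pvec A b P"
      "- l / D * (pvec A b P \<bullet> pvec A b P) + 1 / D * (pvec A b P \<bullet> (A *\<^sub>v pvec A b P))
        \<le> r\<^sup>2 * (pvec A b P \<bullet> pvec A b P) + b \<bullet> b"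
      using krylov_near_eigenvector[OF Ac b(1) u[folded l_def] c1(1) c2 r, where k = k, folded \<rho>_def] by blast
    obtain Q where Q: "degree Q \<le> k" "\<rho> * (w \<bullet> b)\<^sup>2 \<le> pvec A b Q \<bullet> pvec A b Q"
      "L / D * (pvec A b Q \<bullet> pvec A b Q) + - (1 / D) * (pvec A b Q \<bullet> (A *\<^sub>v pvec A b Q))
        \<le> r\<^sup>2 * (pvec A b Q \<bullet> pvec A b Q) + b \<bullet> b"
      using krylov_near_eigenvector[OF Ac b(1) w[folded L_def] c1(2) c3 r, where k = k, folded \<rho>_def] by blast
    define p where "p = pvec A b P"
    define q where "q = pvec A b Q"
    have p: "- l / D * (p \<bullet> p) + 1 / D * (p \<bullet> (A *\<^sub>v p)) \<le> e * (p \<bullet> p)" "0 < p \<bullet> p"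
      using one[OF P(2) \<theta>(2) P(3)] unfolding p_def by auto
    have q: "L / D * (q \<bullet> q) + - (1 / D) * (q \<bullet> (A *\<^sub>v q)) \<le> e * (q \<bullet> q)" "0 < q \<bullet> q"
      using one[OF Q(2) \<theta>(3) Q(3)] unfolding q_def by auto
    have pK: "p \<in> krylov A b (Suc k)" "q \<in> krylov A b (Suc k)"
      unfolding krylov_eq[OF Ac(1) b(1) zero_less_Suc] p_def q_def using P Q by (auto simp: less_Suc_eq_le)
    have nz: "p \<noteq> 0\<^sub>v n" "q \<noteq> 0\<^sub>v n" using p(2) q(2) by auto
    have "ritz_min A b (Suc k) \<le> rayleigh A p"
      by (rule ritz_min_attained(2)[OF Ac(1) b(1) b0 zero_less_Suc pK(1) nz(1)])
    also have "rayleigh A p \<le> l + D * e"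
      unfolding rayleigh_def using p D by (simp add: divide_le_eq field_simps)
    finally have 1: "ritz_min A b (Suc k) \<le> l + D * e" .
    have "L - D * e \<le> rayleigh A q"
      unfolding rayleigh_def using q D by (simp add: le_divide_eq field_simps)
    also have "\<dots> \<le> ritz_max A b (Suc k)"
      by (rule ritz_max_attained(2)[OF Ac(1) b(1) b0 zero_less_Suc pK(2) nz(2)])
    finally show ?thesis using 1 by simp
  qed
  define a where "a = ritz_max A b (Suc k)"
  define c where "c = ritz_min A b (Suc k)"
  have ac: "c \<le> l + D * e" "L - D * e \<le> a" "l \<le> c" "a \<le> L" "0 < c" "c \<le> a"
    using mainD R by (auto simp: a_def c_def)
  have L0: "0 < L" using l L by linarith
  have "(cond_num A - lanczos_cond A b (Suc k)) / cond_num A = (c * L - a * l) / (c * L)"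
    unfolding cond_num_def lanczos_cond_def using l L0 ac
    by (simp add: a_def[symmetric] c_def[symmetric] l_def[symmetric] L_def[symmetric] field_simps)
  also have "\<dots> \<le> (D * e * (L + l)) / (l * L)"
  proof (rule frac_le)
    have "c * L \<le> (l + D * e) * L" "(L - D * e) * l \<le> a * l"
      using ac L0 l by (auto intro: mult_right_mono)
    then show "c * L - a * l \<le> D * e * (L + l)" by (simp add: algebra_simps)
    show "0 \<le> D * e * (L + l)" using e0 L l L0 by (auto simp: D_def intro!: mult_nonneg_nonneg)
    show "0 < l * L" "l * L \<le> c * L" using l L0 ac by (auto intro: mult_right_mono)
  qed
  also have "\<dots> = (L / l + 1) * e * (D / L)" using l L0 by (simp add: field_simps)
  also have "\<dots> \<le> (L / l + 1) * e * 1"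
    using l L0 e0 L by (intro mult_left_mono mult_nonneg_nonneg) (auto simp: D_def)
  finally show ?thesis unfolding e_def[symmetric] cond_num_def l_def L_def by simp
qed

section \<open>Cones and radial functions under Lebesgue measure\<close>

abbreviation lebn :: "nat \<Rightarrow> (nat \<Rightarrow> real) measure" where
  "lebn n \<equiv> Pi\<^sub>M {..<n} (\<lambda>_. lborel)"

definition sqsum :: "nat \<Rightarrow> (nat \<Rightarrow> real) \<Rightarrow> real" where
  "sqsum n x = (\<Sum>i<n. (x i)\<^sup>2)"

lemma sqsum_nonneg: "0 \<le> sqsum n x"
  by (simp add: sqsum_def sum_nonneg)

lemma measurable_sqsum [measurable]: "sqsum n \<in> borel_measurable (lebn n)"
  unfolding sqsum_def[abs_def] by measurable

interpretation lebn: product_sigma_finite "\<lambda>_::nat. lborel :: real measure" ..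

text \<open>A product measure is determined by its values on boxes, where the claim reduces to the
  scaling of one-dimensional Lebesgue measure.\<close>

lemma emeasure_lebn_scale:
  assumes c: "0 < c" and S: "S \<in> sets (lebn n)"
  shows "emeasure (lebn n) S
    = ennreal (c ^ n) * emeasure (lebn n) {x \<in> space (lebn n). (\<lambda>i\<in>{..<n}. c * x i) \<in> S}"
proof -
  define h where "h = (\<lambda>x. \<lambda>i\<in>{..<n}. c * x i)"
  have h [measurable]: "h \<in> lebn n \<rightarrow>\<^sub>M lebn n" unfolding h_def by measurable
  have "scale_measure (ennreal (c ^ n)) (distr (lebn n) (lebn n) h) = lebn n"
  proof (rule lebn.PiM_eqI)
    fix A :: "nat \<Rightarrow> real set" assume A: "\<And>i. i \<in> {..<n} \<Longrightarrow> A i \<in> sets lborel"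
    have A' [measurable]: "(*) c -` A i \<in> sets lborel" if "i < n" for i
      using measurable_sets[of "(*) c" borel borel "A i"] A that by simp
    have "emeasure (distr (lebn n) (lebn n) h) (Pi\<^sub>E {..<n} A)
        = emeasure (lebn n) (h -` Pi\<^sub>E {..<n} A \<inter> space (lebn n))"
      using A by (intro emeasure_distr h sets_PiM_I_finite) auto
    also have "h -` Pi\<^sub>E {..<n} A \<inter> space (lebn n) = Pi\<^sub>E {..<n} (\<lambda>i. (*) c -` A i)"
      by (auto simp: h_def space_PiM PiE_iff)
    also have "emeasure (lebn n) \<dots> = (\<Prod>i<n. emeasure lborel ((*) c -` A i))"
      by (rule lebn.emeasure_PiM) (use A' in auto)
    finally have 1: "emeasure (distr (lebn n) (lebn n) h) (Pi\<^sub>E {..<n} A) = (\<Prod>i<n. emeasure lborel ((*) c -` A i))" .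
    have 2: "emeasure lborel (A i) = ennreal c * emeasure lborel ((*) c -` A i)" if "i < n" for i
    proof -
      have Ai: "A i \<in> sets borel" using A that by simp
      have "emeasure lborel (A i) = emeasure (density (distr lborel borel ((*) c)) (\<lambda>_. \<bar>c\<bar>)) (A i)"
        using lborel_distr_mult'[of c] c by simp
      also have "\<dots> = ennreal c * emeasure (distr lborel borel ((*) c)) (A i)"
        using Ai c by (simp add: emeasure_density nn_integral_cmult)
      also have "emeasure (distr lborel borel ((*) c)) (A i) = emeasure lborel ((*) c -` A i)"
        using Ai by (subst emeasure_distr) auto
      finally show ?thesis .
    qed
    have "(\<Prod>i<n. emeasure lborel (A i)) = (\<Prod>i<n. ennreal c * emeasure lborel ((*) c -` A i))"
      by (rule prod.cong) (use 2 in auto)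
    also have "\<dots> = ennreal (c ^ n) * (\<Prod>i<n. emeasure lborel ((*) c -` A i))"
      using c by (simp add: prod.distrib ennreal_power)
    finally show "emeasure (scale_measure (ennreal (c ^ n)) (distr (lebn n) (lebn n) h)) (Pi\<^sub>E {..<n} A)
        = (\<Prod>i<n. emeasure lborel (A i))"
      by (simp add: 1)
  qed auto
  from arg_cong[OF this, of "\<lambda>N. emeasure N S"]
  have "emeasure (lebn n) S = ennreal (c ^ n) * emeasure (distr (lebn n) (lebn n) h) S" by simp
  also have "emeasure (distr (lebn n) (lebn n) h) S = emeasure (lebn n) {x \<in> space (lebn n). h x \<in> S}"
    using S by (subst emeasure_distr[OF h]) (auto intro!: arg_cong[where f = "emeasure (lebn n)"])
  finally show ?thesis unfolding h_def .
qed

lemma emeasure_lebn_box: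
  assumes "0 \<le> a"
  shows "emeasure (lebn n) (Pi\<^sub>E {..<n} (\<lambda>_. {-a..a})) = ennreal ((2 * a) ^ n)"
  using assms by (subst lebn.emeasure_PiM) (simp_all add: ennreal_power)

lemma lebn_ball_finite: "emeasure (lebn n) {x \<in> space (lebn n). sqsum n x < r\<^sup>2} < \<infinity>"
proof -
  have "{x \<in> space (lebn n). sqsum n x < r\<^sup>2} \<subseteq> Pi\<^sub>E {..<n} (\<lambda>_. {-\<bar>r\<bar>..\<bar>r\<bar>})"
  proof
    fix x assume x: "x \<in> {x \<in> space (lebn n). sqsum n x < r\<^sup>2}"
    have "\<bar>x i\<bar> \<le> \<bar>r\<bar>" if "i < n" for i
    proof -
      have "(x i)\<^sup>2 \<le> sqsum n x" unfolding sqsum_def by (rule member_le_sum) (use that in auto)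
      then have "(x i)\<^sup>2 \<le> r\<^sup>2" using x by auto
      then show ?thesis by (rule abs_le_square_iff[THEN iffD2])
    qed
    then show "x \<in> Pi\<^sub>E {..<n} (\<lambda>_. {-\<bar>r\<bar>..\<bar>r\<bar>})"
      using x by (simp add: space_PiM PiE_iff abs_le_iff minus_le_iff)
  qed
  then have "emeasure (lebn n) {x \<in> space (lebn n). sqsum n x < r\<^sup>2}
      \<le> emeasure (lebn n) (Pi\<^sub>E {..<n} (\<lambda>_. {-\<bar>r\<bar>..\<bar>r\<bar>}))"
    by (intro emeasure_mono sets_PiM_I_finite) auto
  also have "\<dots> < \<infinity>" by (simp add: emeasure_lebn_box)
  finally show ?thesis .
qed

lemma lebn_ball_pos: "0 < emeasure (lebn n) {x \<in> space (lebn n). sqsum n x < 1}"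
proof -
  define a where "a = 1 / (real n + 1)"
  have a: "0 < a" by (simp add: a_def)
  have "Pi\<^sub>E {..<n} (\<lambda>_. {-a..a}) \<subseteq> {x \<in> space (lebn n). sqsum n x < 1}"
  proof
    fix x assume x: "x \<in> Pi\<^sub>E {..<n} (\<lambda>_. {-a..a})"
    have "sqsum n x \<le> (\<Sum>i<n. a\<^sup>2)" unfolding sqsum_def
    proof (rule sum_mono)
      fix i assume "i \<in> {..<n}"
      then have "x i \<in> {-a..a}" using x by (rule PiE_mem[rotated])
      then have "\<bar>x i\<bar> \<le> \<bar>a\<bar>" using a by auto
      then show "(x i)\<^sup>2 \<le> a\<^sup>2" by (simp only: abs_le_square_iff)
    qed
    also have "\<dots> = real n * a\<^sup>2" by simp
    also have "\<dots> < 1"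
    proof -
      have "real n < (real n + 1)\<^sup>2" by (simp add: power2_eq_square algebra_simps add_pos_nonneg)
      then show ?thesis by (simp add: a_def power_divide)
    qed
    finally show "x \<in> {x \<in> space (lebn n). sqsum n x < 1}" using x by (auto simp: space_PiM PiE_iff)
  qed
  then have "emeasure (lebn n) (Pi\<^sub>E {..<n} (\<lambda>_. {-a..a})) \<le> emeasure (lebn n) {x \<in> space (lebn n). sqsum n x < 1}"
    by (intro emeasure_mono) measurable
  moreover have "0 < emeasure (lebn n) (Pi\<^sub>E {..<n} (\<lambda>_. {-a..a}))" using a by (simp add: emeasure_lebn_box)
  ultimately show ?thesis by (rule less_le_trans[rotated])
qed

lemma lebn_origin_null:
  assumes "0 < n"
  shows "AE x in lebn n. sqsum n x \<noteq> 0"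
proof -
  have "{x \<in> space (lebn n). sqsum n x = 0} \<subseteq> Pi\<^sub>E {..<n} (\<lambda>_. {-0..0})"
  proof
    fix x assume x: "x \<in> {x \<in> space (lebn n). sqsum n x = 0}"
    then have "x i = 0" if "i < n" for i
      using that by (simp add: sqsum_def sum_nonneg_eq_0_iff)
    then show "x \<in> Pi\<^sub>E {..<n} (\<lambda>_. {-0..0})"
    proof (intro PiE_I)
      fix i
      show "x i \<in> {-0..0}" if "i \<in> {..<n}" using that \<open>\<And>i. i < n \<Longrightarrow> x i = 0\<close> by simp
      show "x i = undefined" if "i \<notin> {..<n}" using that x by (auto simp: space_PiM PiE_def extensional_def)
    qed
  qed
  then have "emeasure (lebn n) {x \<in> space (lebn n). sqsum n x = 0} \<le> emeasure (lebn n) (Pi\<^sub>E {..<n} (\<lambda>_. {-0..0}))"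
    by (intro emeasure_mono sets_PiM_I_finite) auto
  also have "\<dots> = 0" using emeasure_lebn_box[of 0 n] assms by simp
  finally show ?thesis by (subst AE_iff_measurable[OF _ refl]) (auto, measurable)
qed

definition cone_pred :: "nat \<Rightarrow> ((nat \<Rightarrow> real) \<Rightarrow> bool) \<Rightarrow> bool" where
  "cone_pred n \<Phi> \<longleftrightarrow> (\<forall>x\<in>space (lebn n). \<forall>c>0. \<Phi> (\<lambda>i\<in>{..<n}. c * x i) \<longleftrightarrow> \<Phi> x)"

text \<open>By scaling, the volume of a cone inside the ball of radius \<open>\<rho>\<close> is \<open>\<rho>\<^sup>n\<close> times its volume
  inside the unit ball. The law of the squared length on the cone and the law on the whole
  space thus agree on balls up to a constant factor, hence as measures, and so do the
  integrals of radial functions.\<close>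

lemma cone_radial_integral:
  assumes \<Phi>: "cone_pred n \<Phi>" and [measurable]: "Measurable.pred (lebn n) \<Phi>"
    and f [measurable]: "f \<in> borel_measurable borel"
  shows "emeasure (lebn n) {x \<in> space (lebn n). sqsum n x < 1}
      * (\<integral>\<^sup>+x. (if \<Phi> x then 1 else 0) * f (sqsum n x) \<partial>lebn n)
    = emeasure (lebn n) {x \<in> space (lebn n). \<Phi> x \<and> sqsum n x < 1} * (\<integral>\<^sup>+x. f (sqsum n x) \<partial>lebn n)"
proof -
  \<comment> \<open>The sign makes balls correspond to upper half-lines, which are the sets needed to identify two measures on the line.\<close>
  define \<nu> where "\<nu> \<Psi> = distr (density (lebn n) (\<lambda>x. if \<Psi> x then 1 else 0)) borel (\<lambda>x. - sqsum n x)" for \<Psi>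
  define V where "V \<Psi> = emeasure (lebn n) {x \<in> space (lebn n). \<Psi> x \<and> sqsum n x < 1}" for \<Psi>
  have \<nu>: "emeasure (\<nu> \<Psi>) {y <..} = (if y < 0 then ennreal (sqrt (- y) ^ n) * V \<Psi> else 0)"
    if cone: "cone_pred n \<Psi>" and [measurable]: "Measurable.pred (lebn n) \<Psi>" for \<Psi> y
  proof -
    have "emeasure (\<nu> \<Psi>) {y <..} = emeasure (lebn n) {x \<in> space (lebn n). \<Psi> x \<and> sqsum n x < - y}"
    proof -
      have "emeasure (\<nu> \<Psi>) {y <..} = (\<integral>\<^sup>+x. (if \<Psi> x then 1 else 0) * indicator ((\<lambda>x. - sqsum n x) -` {y<..} \<inter> space (lebn n)) x \<partial>lebn n)"
        unfolding \<nu>_def by (subst emeasure_distr) (auto simp: emeasure_density)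
      also have "\<dots> = (\<integral>\<^sup>+x. indicator {x \<in> space (lebn n). \<Psi> x \<and> sqsum n x < - y} x \<partial>lebn n)"
        by (rule nn_integral_cong) (auto split: split_indicator)
      finally show ?thesis by simp
    qed
    also have "\<dots> = (if y < 0 then ennreal (sqrt (- y) ^ n) * V \<Psi> else 0)"
    proof (cases "y < 0")
      case True
      define c where "c = sqrt (- y)"
      have c: "0 < c" "c\<^sup>2 = - y" using True by (auto simp: c_def)
      have "emeasure (lebn n) {x \<in> space (lebn n). \<Psi> x \<and> sqsum n x < - y}
          = ennreal (c ^ n) * emeasure (lebn n) {x \<in> space (lebn n).
              (\<lambda>i\<in>{..<n}. c * x i) \<in> {x \<in> space (lebn n). \<Psi> x \<and> sqsum n x < - y}}"
        by (rule emeasure_lebn_scale[OF c(1)]) measurable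
      also have "{x \<in> space (lebn n). (\<lambda>i\<in>{..<n}. c * x i) \<in> {x \<in> space (lebn n). \<Psi> x \<and> sqsum n x < - y}}
          = {x \<in> space (lebn n). \<Psi> x \<and> sqsum n x < 1}"
      proof -
        have "sqsum n (\<lambda>i\<in>{..<n}. c * x i) = c\<^sup>2 * sqsum n x" for x
          by (simp add: sqsum_def power_mult_distrib sum_distrib_left)
        moreover have "c\<^sup>2 * s < - y \<longleftrightarrow> s < 1" for s
          unfolding c(2)[symmetric] using c(1) by simp
        ultimately show ?thesis using cone c(1) by (auto simp: cone_pred_def space_PiM)
      qed
      finally show ?thesis using True by (simp add: V_def c_def)
    next
      case False
      have "{x \<in> space (lebn n). \<Psi> x \<and> sqsum n x < - y} = {}"
      proof -
        have "\<not> sqsum n x < - y" for x using False sqsum_nonneg[of n x] by linarith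
        then show ?thesis by simp
      qed
      then show ?thesis using False by (simp only: emeasure_empty if_False)
    qed
    finally show ?thesis .
  qed
  have true: "cone_pred n (\<lambda>_. True)" by (simp add: cone_pred_def)
  have Vfin: "V \<Psi> < \<infinity>" for \<Psi>
  proof -
    have "V \<Psi> \<le> emeasure (lebn n) {x \<in> space (lebn n). sqsum n x < 1\<^sup>2}"
      unfolding V_def by (rule emeasure_mono) auto
    then show ?thesis using lebn_ball_finite[of n 1] by (rule le_less_trans)
  qed
  have "scale_measure (V (\<lambda>_. True)) (\<nu> \<Phi>) = scale_measure (V \<Phi>) (\<nu> (\<lambda>_. True))"
  proof (rule measure_eqI_lessThan)
    show "emeasure (scale_measure (V (\<lambda>_. True)) (\<nu> \<Phi>)) {y<..}
        = emeasure (scale_measure (V \<Phi>) (\<nu> (\<lambda>_. True))) {y<..}" for y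
      by (simp add: \<nu> \<Phi> true mult_ac)
    show "emeasure (scale_measure (V (\<lambda>_. True)) (\<nu> \<Phi>)) {y<..} < \<infinity>" for y
      using Vfin by (simp add: \<nu>[OF \<Phi>] ennreal_mult_less_top)
  qed (auto simp: \<nu>_def)
  then have "(\<integral>\<^sup>+y. f (- y) \<partial>scale_measure (V (\<lambda>_. True)) (\<nu> \<Phi>)) = (\<integral>\<^sup>+y. f (- y) \<partial>scale_measure (V \<Phi>) (\<nu> (\<lambda>_. True)))"
    by simp
  then have "V (\<lambda>_. True) * (\<integral>\<^sup>+y. f (- y) \<partial>\<nu> \<Phi>) = V \<Phi> * (\<integral>\<^sup>+y. f (- y) \<partial>\<nu> (\<lambda>_. True))"
    by (simp add: nn_integral_scale_measure \<nu>_def)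
  moreover have "(\<integral>\<^sup>+y. f (- y) \<partial>\<nu> \<Psi>) = (\<integral>\<^sup>+x. (if \<Psi> x then 1 else 0) * f (sqsum n x) \<partial>lebn n)"
    if [measurable]: "Measurable.pred (lebn n) \<Psi>" for \<Psi>
    unfolding \<nu>_def by (simp add: nn_integral_distr nn_integral_density)
  ultimately show ?thesis by (simp add: V_def)
qed

section \<open>The uniform distribution on the sphere\<close>

lemma space_borel_vec: "space (borel_vec n) = carrier_vec n"
  by (simp add: borel_vec_def space_vimage_algebra)

lemma measurable_vec_index [measurable]:
  assumes "i < n"
  shows "(\<lambda>v. v $ i) \<in> borel_measurable (borel_vec n)"
proof -
  have 1: "(\<lambda>v. \<lambda>i\<in>{..<n}. v $ i) \<in> borel_vec n \<rightarrow>\<^sub>M (\<Pi>\<^sub>M i\<in>{..<n}. borel)"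
    unfolding borel_vec_def by (rule measurable_vimage_algebra1) (auto simp: space_PiM)
  have "(\<lambda>v. (\<lambda>i\<in>{..<n}. v $ i) i) \<in> borel_measurable (borel_vec n)"
    by (rule measurable_compose[OF 1]) (use assms in simp)
  then show ?thesis using assms by simp
qed

lemma measurable_into_borel_vec:
  assumes "g \<in> space N \<rightarrow> carrier_vec n" "\<And>i. i < n \<Longrightarrow> (\<lambda>x. g x $ i) \<in> borel_measurable N"
  shows "g \<in> N \<rightarrow>\<^sub>M borel_vec n"
  unfolding borel_vec_def
  by (rule measurable_vimage_algebra2[OF assms(1)], rule measurable_restrict) (use assms(2) in auto)

lemma measurable_vec [measurable]: "vec n \<in> lebn n \<rightarrow>\<^sub>M borel_vec n"
proof (rule measurable_into_borel_vec)
  fix i assume i: "i < n"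
  have "(\<lambda>x. x i) \<in> borel_measurable (lebn n)"
    using measurable_component_singleton[of i "{..<n}" "\<lambda>_. lborel"] i by simp
  then show "(\<lambda>x. vec n x $ i) \<in> borel_measurable (lebn n)" using i by simp
qed auto

lemma measurable_scalar_prod_self [measurable]: "(\<lambda>v. v \<bullet> v) \<in> borel_measurable (borel_vec n)"
proof -
  have "(\<lambda>v. \<Sum>i<n. v $ i * v $ i) \<in> borel_measurable (borel_vec n)" by measurable
  moreover have "(v \<bullet> v) = (\<Sum>i<n. v $ i * v $ i)" if "v \<in> space (borel_vec n)" for v :: "real vec"
    using that by (simp add: space_borel_vec scalar_prod_sum)
  ultimately show ?thesis by (subst measurable_cong) auto
qed

lemma scalar_prod_self_eq_0: "v \<in> carrier_vec n \<Longrightarrow> v \<bullet> v = 0 \<longleftrightarrow> v = (0\<^sub>v n :: real vec)"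
  by (cases "v = 0\<^sub>v n") (auto dest: scalar_prod_self_pos)

lemma scalar_prod_vec_self: "vec n x \<bullet> vec n x = sqsum n x"
  by (simp add: scalar_prod_sum[of _ n] sqsum_def power2_eq_square)

lemma sets_punctured_ball: "punctured_ball n \<in> sets (borel_vec n)"
proof -
  have "punctured_ball n = {v \<in> space (borel_vec n). v \<bullet> v \<noteq> 0 \<and> v \<bullet> v \<le> 1}"
  proof -
    show ?thesis by (auto simp: punctured_ball_def space_borel_vec scalar_prod_self_eq_0)
  qed
  also have "\<dots> \<in> sets (borel_vec n)" by measurable
  finally show ?thesis .
qed

lemma sets_punctured_ball_pred:
  assumes "Measurable.pred (borel_vec n) \<Psi>"
  shows "{v \<in> punctured_ball n. \<Psi> v} \<in> sets (borel_vec n)"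
proof -
  have "{v \<in> punctured_ball n. \<Psi> v} = punctured_ball n \<inter> {v \<in> space (borel_vec n). \<Psi> v}"
    by (auto simp: punctured_ball_def space_borel_vec)
  then show ?thesis using sets_punctured_ball[of n] assms by auto
qed

lemma space_uniform_sphere: "space (uniform_sphere n) = unit_sphere n"
  by (auto simp: uniform_sphere_def space_restrict_space space_borel_vec unit_sphere_def)

lemma sets_uniform_sphere: "sets (uniform_sphere n) = sets (restrict_space (borel_vec n) (unit_sphere n))"
  by (simp add: uniform_sphere_def)

lemma emeasure_lborel_vec_ball:
  assumes "Measurable.pred (borel_vec n) \<Psi>"
  shows "emeasure (lborel_vec n) {v \<in> punctured_ball n. \<Psi> v}
    = emeasure (lebn n) {x \<in> space (lebn n). \<Psi> (vec n x) \<and> sqsum n x \<noteq> 0 \<and> sqsum n x \<le> 1}"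
proof -
  note S = sets_punctured_ball_pred[OF assms]
  have eq: "vec n -` {v \<in> punctured_ball n. \<Psi> v} \<inter> space (lebn n)
      = {x \<in> space (lebn n). \<Psi> (vec n x) \<and> sqsum n x \<noteq> 0 \<and> sqsum n x \<le> 1}"
  proof -
    have "(vec n x \<noteq> 0\<^sub>v n) = (sqsum n x \<noteq> 0)" for x
      using scalar_prod_self_eq_0[of "vec n x" n] scalar_prod_vec_self[of n x] by simp
    then show ?thesis by (auto simp: punctured_ball_def scalar_prod_vec_self)
  qed
  show ?thesis unfolding lborel_vec_def by (subst emeasure_distr[OF measurable_vec S]) (simp only: eq)
qed

lemma emeasure_ball_prob:
  assumes \<Psi>: "Measurable.pred (borel_vec n) \<Psi>"
  defines "U \<equiv> uniform_measure (restrict_space (lborel_vec n) (punctured_ball n)) (punctured_ball n)"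
  shows "emeasure U {v \<in> punctured_ball n. \<Psi> v}
    = emeasure (lebn n) {x \<in> space (lebn n). \<Psi> (vec n x) \<and> sqsum n x \<noteq> 0 \<and> sqsum n x \<le> 1}
      / emeasure (lebn n) {x \<in> space (lebn n). sqsum n x \<noteq> 0 \<and> sqsum n x \<le> 1}"
proof -
  let ?R = "restrict_space (lborel_vec n) (punctured_ball n)"
  have sl: "sets (lborel_vec n) = sets (borel_vec n)" "space (lborel_vec n) = carrier_vec n"
    by (auto simp: lborel_vec_def space_borel_vec)
  have pbc: "punctured_ball n \<subseteq> carrier_vec n" by (auto simp: punctured_ball_def)
  have pb: "punctured_ball n \<inter> space (lborel_vec n) \<in> sets (lborel_vec n)"
    using sets_punctured_ball[of n] pbc by (simp add: sl Int_absorb2)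
  have R: "{v \<in> punctured_ball n. \<Psi> v} \<in> sets ?R" if "Measurable.pred (borel_vec n) \<Psi>" for \<Psi>
    using sets_punctured_ball_pred[OF that] pb by (subst sets_restrict_space_iff) (auto simp: sl)
  have "emeasure U {v \<in> punctured_ball n. \<Psi> v}
      = emeasure ?R (punctured_ball n \<inter> {v \<in> punctured_ball n. \<Psi> v}) / emeasure ?R (punctured_ball n)"
    unfolding U_def using R[of "\<lambda>_. True"] R[OF \<Psi>] by (intro emeasure_uniform_measure) simp_all
  also have "punctured_ball n \<inter> {v \<in> punctured_ball n. \<Psi> v} = {v \<in> punctured_ball n. \<Psi> v}" by auto
  also have "emeasure ?R {v \<in> punctured_ball n. \<Psi> v} = emeasure (lborel_vec n) {v \<in> punctured_ball n. \<Psi> v}"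
    by (rule emeasure_restrict_space[OF pb]) auto
  also have "emeasure ?R (punctured_ball n) = emeasure (lborel_vec n) {v \<in> punctured_ball n. True}"
    using emeasure_restrict_space[OF pb, of "punctured_ball n"] by simp
  finally show ?thesis
    using emeasure_lborel_vec_ball[OF \<Psi>] emeasure_lborel_vec_ball[where n = n and \<Psi> = "\<lambda>_. True"] by simp
qed

lemma measurable_normalise:
  defines "U \<equiv> \<lambda>n. uniform_measure (restrict_space (lborel_vec n) (punctured_ball n)) (punctured_ball n)"
  shows "(\<lambda>v. (1 / sqrt (v \<bullet> v)) \<cdot>\<^sub>v v) \<in> U n \<rightarrow>\<^sub>M restrict_space (borel_vec n) (unit_sphere n)"
proof (rule measurable_restrict_space2)
  have sp: "space (U n) = punctured_ball n"
    by (auto simp: U_def space_restrict_space lborel_vec_def space_borel_vec punctured_ball_def)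
  have st: "sets (U n) = sets (restrict_space (borel_vec n) (punctured_ball n))"
    by (simp add: U_def sets_restrict_space lborel_vec_def)
  show "(\<lambda>v. (1 / sqrt (v \<bullet> v)) \<cdot>\<^sub>v v) \<in> space (U n) \<rightarrow> unit_sphere n"
  proof
    fix v assume "v \<in> space (U n)"
    then have v: "v \<in> carrier_vec n" "v \<noteq> 0\<^sub>v n" by (auto simp: sp punctured_ball_def)
    have "0 < v \<bullet> v" by (rule scalar_prod_self_pos[OF v])
    then have "((1 / sqrt (v \<bullet> v)) \<cdot>\<^sub>v v) \<bullet> ((1 / sqrt (v \<bullet> v)) \<cdot>\<^sub>v v) = 1"
      using v(1) by simp
    then show "(1 / sqrt (v \<bullet> v)) \<cdot>\<^sub>v v \<in> unit_sphere n" using v by (simp add: unit_sphere_def)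
  qed
  have "(\<lambda>v. (1 / sqrt (v \<bullet> v)) \<cdot>\<^sub>v v) \<in> borel_vec n \<rightarrow>\<^sub>M borel_vec n"
  proof (rule measurable_into_borel_vec)
    fix i assume i: "i < n"
    have "(\<lambda>v. (1 / sqrt (v \<bullet> v)) * v $ i) \<in> borel_measurable (borel_vec n)" using i by measurable
    moreover have "((1 / sqrt (v \<bullet> v)) \<cdot>\<^sub>v v) $ i = (1 / sqrt (v \<bullet> v)) * v $ i"
      if "v \<in> space (borel_vec n)" for v :: "real vec"
      using that i by (simp add: space_borel_vec)
    ultimately show "(\<lambda>v. ((1 / sqrt (v \<bullet> v)) \<cdot>\<^sub>v v) $ i) \<in> borel_measurable (borel_vec n)"
      by (subst measurable_cong) auto
  qed (auto simp: space_borel_vec)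
  then have "(\<lambda>v. (1 / sqrt (v \<bullet> v)) \<cdot>\<^sub>v v) \<in> restrict_space (borel_vec n) (punctured_ball n) \<rightarrow>\<^sub>M borel_vec n"
    by (rule measurable_restrict_space1)
  then show "(\<lambda>v. (1 / sqrt (v \<bullet> v)) \<cdot>\<^sub>v v) \<in> U n \<rightarrow>\<^sub>M borel_vec n"
    using measurable_cong_sets[OF st refl] by blast
qed

text \<open>For a predicate that is invariant under positive scaling, normalising a vector of the
  punctured ball does not change its truth value.\<close>

lemma emeasure_uniform_sphere:
  assumes \<Psi>: "Measurable.pred (borel_vec n) \<Psi>"
    and cone: "\<And>v c. v \<in> carrier_vec n \<Longrightarrow> 0 < c \<Longrightarrow> \<Psi> (c \<cdot>\<^sub>v v) \<longleftrightarrow> \<Psi> v"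
  shows "{b \<in> space (uniform_sphere n). \<Psi> b} \<in> sets (uniform_sphere n)"
    and "emeasure (uniform_sphere n) {b \<in> space (uniform_sphere n). \<Psi> b}
    = emeasure (lebn n) {x \<in> space (lebn n). \<Psi> (vec n x) \<and> sqsum n x \<noteq> 0 \<and> sqsum n x \<le> 1}
      / emeasure (lebn n) {x \<in> space (lebn n). sqsum n x \<noteq> 0 \<and> sqsum n x \<le> 1}"
proof -
  let ?U = "uniform_measure (restrict_space (lborel_vec n) (punctured_ball n)) (punctured_ball n)"
  have sp: "space ?U = punctured_ball n"
    by (auto simp: space_restrict_space lborel_vec_def space_borel_vec punctured_ball_def)
  have usc: "unit_sphere n \<subseteq> carrier_vec n" by (auto simp: unit_sphere_def)
  have "{b \<in> unit_sphere n. \<Psi> b} = unit_sphere n \<inter> {v \<in> space (borel_vec n). \<Psi> v}"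
    using usc by (auto simp: space_borel_vec)
  then have S: "{b \<in> unit_sphere n. \<Psi> b} \<in> sets (restrict_space (borel_vec n) (unit_sphere n))"
    using \<Psi> by (auto simp: sets_restrict_space)
  then show "{b \<in> space (uniform_sphere n). \<Psi> b} \<in> sets (uniform_sphere n)"
    by (simp add: space_uniform_sphere sets_uniform_sphere)
  have "emeasure (uniform_sphere n) {b \<in> unit_sphere n. \<Psi> b}
      = emeasure ?U ((\<lambda>v. (1 / sqrt (v \<bullet> v)) \<cdot>\<^sub>v v) -` {b \<in> unit_sphere n. \<Psi> b} \<inter> space ?U)"
    unfolding uniform_sphere_def by (rule emeasure_distr[OF measurable_normalise S])
  also have "(\<lambda>v. (1 / sqrt (v \<bullet> v)) \<cdot>\<^sub>v v) -` {b \<in> unit_sphere n. \<Psi> b} \<inter> space ?U = {v \<in> punctured_ball n. \<Psi> v}"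
  proof -
    have "(1 / sqrt (v \<bullet> v)) \<cdot>\<^sub>v v \<in> unit_sphere n" if "v \<in> punctured_ball n" for v
      using measurable_space[OF measurable_normalise, of v n, unfolded sp, OF that]
      by (simp add: space_restrict_space space_borel_vec)
    moreover have "\<Psi> ((1 / sqrt (v \<bullet> v)) \<cdot>\<^sub>v v) \<longleftrightarrow> \<Psi> v" if "v \<in> punctured_ball n" for v
    proof (rule cone)
      show "v \<in> carrier_vec n" using that by (auto simp: punctured_ball_def)
      have "0 < v \<bullet> v" by (rule scalar_prod_self_pos) (use that in \<open>auto simp: punctured_ball_def\<close>)
      then show "0 < 1 / sqrt (v \<bullet> v)" by simp
    qed
    ultimately show ?thesis unfolding sp by auto
  qed
  finally show "emeasure (uniform_sphere n) {b \<in> space (uniform_sphere n). \<Psi> b}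
    = emeasure (lebn n) {x \<in> space (lebn n). \<Psi> (vec n x) \<and> sqsum n x \<noteq> 0 \<and> sqsum n x \<le> 1}
      / emeasure (lebn n) {x \<in> space (lebn n). sqsum n x \<noteq> 0 \<and> sqsum n x \<le> 1}"
    by (simp add: emeasure_ball_prob[OF \<Psi>] space_uniform_sphere)
qed

section \<open>Gaussian vectors\<close>

definition gaussn :: "nat \<Rightarrow> (nat \<Rightarrow> real) measure" where
  "gaussn n = Pi\<^sub>M {..<n} (\<lambda>_. density lborel (\<lambda>x. ennreal (std_normal_density x)))"

interpretation std_normal: prob_space "density lborel (\<lambda>x. ennreal (std_normal_density x))"
  by (rule prob_space_normal_density) simp

interpretation gauss: product_sigma_finite "\<lambda>_::nat. density lborel (\<lambda>x. ennreal (std_normal_density x))"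
  by standard

interpretation gaussp: product_prob_space "\<lambda>_::nat. density lborel (\<lambda>x. ennreal (std_normal_density x))" "{..<n}" for n
  by standard

lemma prob_space_gaussn: "prob_space (gaussn n)"
  unfolding gaussn_def by (intro prob_space_PiM std_normal.prob_space_axioms)

lemma sets_gaussn [measurable_cong]: "sets (gaussn n) = sets (lebn n)"
  unfolding gaussn_def by (rule sets_PiM_cong) auto

lemma space_gaussn: "space (gaussn n) = space (lebn n)"
  by (rule sets_eq_imp_space_eq[OF sets_gaussn])

lemma gaussn_eq_density:
  "gaussn n = density (lebn n) (\<lambda>x. ennreal ((1 / sqrt (2 * pi)) ^ n * exp (- sqsum n x / 2)))"
    (is "_ = ?D")
  unfolding gaussn_def
proof (rule gauss.PiM_eqI[symmetric])
  show "sets ?D = sets (Pi\<^sub>M {..<n} (\<lambda>_. density lborel (\<lambda>x. ennreal (std_normal_density x))))"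
    using sets_gaussn[of n] by (simp add: gaussn_def)
  fix A :: "nat \<Rightarrow> real set"
  assume "\<And>i. i \<in> {..<n} \<Longrightarrow> A i \<in> sets (density lborel (\<lambda>x. ennreal (std_normal_density x)))"
  then have A [measurable]: "A i \<in> sets borel" if "i < n" for i using that by simp
  have box: "Pi\<^sub>E {..<n} A \<in> sets (lebn n)" by (rule sets_PiM_I_finite) (use A in auto)
  have "emeasure ?D (Pi\<^sub>E {..<n} A)
      = (\<integral>\<^sup>+x. ennreal ((1 / sqrt (2 * pi)) ^ n * exp (- sqsum n x / 2)) * indicator (Pi\<^sub>E {..<n} A) x \<partial>lebn n)"
    using box by (intro emeasure_density) measurable
  also have "\<dots> = (\<integral>\<^sup>+x. (\<Prod>i<n. ennreal (std_normal_density (x i)) * indicator (A i) (x i)) \<partial>lebn n)"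
  proof (rule nn_integral_cong)
    fix x assume x: "x \<in> space (lebn n)"
    have "exp (- sqsum n x / 2) = (\<Prod>i<n. exp (- (x i)\<^sup>2 / 2))"
      by (simp add: sqsum_def sum_divide_distrib sum_negf[symmetric] exp_sum[symmetric])
    then have "(1 / sqrt (2 * pi)) ^ n * exp (- sqsum n x / 2) = (\<Prod>i<n. std_normal_density (x i))"
      unfolding std_normal_density_def by (simp only: prod.distrib prod_constant card_lessThan)
    then have 1: "ennreal ((1 / sqrt (2 * pi)) ^ n * exp (- sqsum n x / 2)) = (\<Prod>i<n. ennreal (std_normal_density (x i)))"
      by (simp add: prod_ennreal)
    have 2: "(indicator (Pi\<^sub>E {..<n} A) x :: ennreal) = (\<Prod>i<n. indicator (A i) (x i))"
      using x by (auto simp: indicator_def space_PiM PiE_iff prod_zero_iff)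
    show "ennreal ((1 / sqrt (2 * pi)) ^ n * exp (- sqsum n x / 2)) * indicator (Pi\<^sub>E {..<n} A) x
        = (\<Prod>i<n. ennreal (std_normal_density (x i)) * indicator (A i) (x i))"
      unfolding 1 2 by (simp add: prod.distrib)
  qed
  also have "\<dots> = (\<Prod>i<n. \<integral>\<^sup>+x. ennreal (std_normal_density x) * indicator (A i) x \<partial>lborel)"
    by (rule lebn.product_nn_integral_prod) (use A in auto)
  also have "\<dots> = (\<Prod>i<n. emeasure (density lborel (\<lambda>x. ennreal (std_normal_density x))) (A i))"
    by (rule prod.cong) (use A in \<open>auto simp: emeasure_density\<close>)
  finally show "emeasure ?D (Pi\<^sub>E {..<n} A) = (\<Prod>i<n. emeasure (density lborel (\<lambda>x. ennreal (std_normal_density x))) (A i))" .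
qed simp

text \<open>Direction and length of a Gaussian vector are independent, and the direction is uniformly
  distributed: the Gaussian density is a radial function, so \<open>cone_radial_integral\<close> applies
  to it, and the proportionality factor is identified with the help of the indicator function
  of the punctured ball.\<close>

lemma gaussn_cone_radial:
  assumes n: "0 < n" and \<Psi>: "Measurable.pred (borel_vec n) \<Psi>"
    and cone: "\<And>v c. v \<in> carrier_vec n \<Longrightarrow> 0 < c \<Longrightarrow> \<Psi> (c \<cdot>\<^sub>v v) \<longleftrightarrow> \<Psi> v"
    and T [measurable]: "T \<in> sets borel"
  shows "emeasure (gaussn n) {x \<in> space (gaussn n). \<Psi> (vec n x) \<and> sqsum n x \<in> T}
    = emeasure (uniform_sphere n) {b \<in> space (uniform_sphere n). \<Psi> b}
      * emeasure (gaussn n) {x \<in> space (gaussn n). sqsum n x \<in> T}"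
proof -
  define \<Phi> where "\<Phi> x = \<Psi> (vec n x)" for x
  have \<Phi> [measurable]: "Measurable.pred (lebn n) \<Phi>"
    unfolding \<Phi>_def by (rule measurable_compose[OF measurable_vec \<Psi>])
  have cp: "cone_pred n \<Phi>"
    unfolding cone_pred_def
  proof (intro ballI allI impI)
    fix x c assume "(0::real) < c"
    have "vec n (\<lambda>i\<in>{..<n}. c * x i) = c \<cdot>\<^sub>v vec n x" by (intro eq_vecI) auto
    then show "\<Phi> (\<lambda>i\<in>{..<n}. c * x i) = \<Phi> x" unfolding \<Phi>_def using cone[of "vec n x" c] \<open>0 < c\<close> by simp
  qed
  define a where "a = emeasure (lebn n) {x \<in> space (lebn n). sqsum n x < 1}"
  define a\<Phi> where "a\<Phi> = emeasure (lebn n) {x \<in> space (lebn n). \<Phi> x \<and> sqsum n x < 1}"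
  have a: "a \<noteq> 0" "a \<noteq> \<infinity>"
    using lebn_ball_pos[of n] lebn_ball_finite[of n 1] by (auto simp: a_def)
  have rad: "a * (\<integral>\<^sup>+x. (if \<Phi> x then 1 else 0) * f (sqsum n x) \<partial>lebn n) = a\<Phi> * (\<integral>\<^sup>+x. f (sqsum n x) \<partial>lebn n)"
    if "f \<in> borel_measurable borel" for f
    unfolding a_def a\<Phi>_def by (rule cone_radial_integral[OF cp \<Phi> that])
  define B where "B = emeasure (lebn n) {x \<in> space (lebn n). sqsum n x \<noteq> 0 \<and> sqsum n x \<le> 1}"
  define B\<Phi> where "B\<Phi> = emeasure (lebn n) {x \<in> space (lebn n). \<Phi> x \<and> sqsum n x \<noteq> 0 \<and> sqsum n x \<le> 1}"
  define P where "P = emeasure (uniform_sphere n) {b \<in> space (uniform_sphere n). \<Psi> b}"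
  have P: "P = B\<Phi> / B" unfolding P_def B_def B\<Phi>_def \<Phi>_def by (rule emeasure_uniform_sphere(2)[OF \<Psi> cone])
  have B: "B \<noteq> 0" "B \<noteq> \<infinity>"
  proof -
    have "a = emeasure (lebn n) {x \<in> space (lebn n). sqsum n x \<noteq> 0 \<and> sqsum n x < 1}"
      unfolding a_def using lebn_origin_null[OF n] by (intro emeasure_eq_AE) (auto, measurable)
    also have "\<dots> \<le> B" unfolding B_def by (rule emeasure_mono) (auto, measurable)
    finally show "B \<noteq> 0" using a by auto
    have "B \<le> emeasure (lebn n) {x \<in> space (lebn n). sqsum n x < 2\<^sup>2}"
      unfolding B_def by (rule emeasure_mono) (auto, measurable)
    also have "\<dots> < \<infinity>" by (rule lebn_ball_finite)
    finally show "B \<noteq> \<infinity>" by auto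
  qed
  have aP: "a\<Phi> = a * P"
  proof -
    define f :: "real \<Rightarrow> ennreal" where "f q = indicator {q. q \<noteq> 0 \<and> q \<le> 1} q" for q
    have [measurable]: "f \<in> borel_measurable borel" unfolding f_def by measurable
    have "(\<integral>\<^sup>+x. f (sqsum n x) \<partial>lebn n) = (\<integral>\<^sup>+x. indicator {x \<in> space (lebn n). sqsum n x \<noteq> 0 \<and> sqsum n x \<le> 1} x \<partial>lebn n)"
      by (rule nn_integral_cong) (auto simp: f_def split: split_indicator)
    also have "\<dots> = B" unfolding B_def by (rule nn_integral_indicator) measurable
    finally have 1: "(\<integral>\<^sup>+x. f (sqsum n x) \<partial>lebn n) = B" .
    have "(\<integral>\<^sup>+x. (if \<Phi> x then 1 else 0) * f (sqsum n x) \<partial>lebn n)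
        = (\<integral>\<^sup>+x. indicator {x \<in> space (lebn n). \<Phi> x \<and> sqsum n x \<noteq> 0 \<and> sqsum n x \<le> 1} x \<partial>lebn n)"
      by (rule nn_integral_cong) (auto simp: f_def split: split_indicator)
    also have "\<dots> = B\<Phi>" unfolding B\<Phi>_def by (rule nn_integral_indicator) measurable
    finally have "a * B\<Phi> = a\<Phi> * B" using rad[of f] 1 by simp
    then have "a * B\<Phi> / B = a\<Phi>" using B by (simp add: mult_divide_eq_ennreal infinity_ennreal_def)
    then show ?thesis by (simp add: P ennreal_times_divide)
  qed
  define f :: "real \<Rightarrow> ennreal" where
    "f q = ennreal ((1 / sqrt (2 * pi)) ^ n * exp (- q / 2)) * indicator T q" for q
  have f [measurable]: "f \<in> borel_measurable borel" unfolding f_def by measurable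
  have G: "emeasure (gaussn n) {x \<in> space (gaussn n). X x \<and> sqsum n x \<in> T}
      = (\<integral>\<^sup>+x. (if X x then 1 else 0) * f (sqsum n x) \<partial>lebn n)"
    if [measurable]: "Measurable.pred (lebn n) X" for X
    unfolding gaussn_eq_density
  proof (subst emeasure_density)
    show "(\<integral>\<^sup>+x. ennreal ((1 / sqrt (2 * pi)) ^ n * exp (- sqsum n x / 2)) *
        indicator {x \<in> space (density (lebn n) (\<lambda>x. ennreal ((1 / sqrt (2 * pi)) ^ n * exp (- sqsum n x / 2)))). X x \<and> sqsum n x \<in> T} x \<partial>lebn n)
      = (\<integral>\<^sup>+x. (if X x then 1 else 0) * f (sqsum n x) \<partial>lebn n)"
      by (rule nn_integral_cong) (auto simp: f_def split: split_indicator)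
  qed (simp_all, measurable)
  have "a * emeasure (gaussn n) {x \<in> space (gaussn n). \<Psi> (vec n x) \<and> sqsum n x \<in> T}
      = a\<Phi> * emeasure (gaussn n) {x \<in> space (gaussn n). True \<and> sqsum n x \<in> T}"
  proof -
    have "emeasure (gaussn n) {x \<in> space (gaussn n). True \<and> sqsum n x \<in> T} = (\<integral>\<^sup>+x. f (sqsum n x) \<partial>lebn n)"
      using G[of "\<lambda>_. True"] by simp
    then show ?thesis using rad[OF f] G[OF \<Phi>] unfolding \<Phi>_def by (simp only:)
  qed
  then have "a * emeasure (gaussn n) {x \<in> space (gaussn n). \<Psi> (vec n x) \<and> sqsum n x \<in> T}
      = a * (P * emeasure (gaussn n) {x \<in> space (gaussn n). sqsum n x \<in> T})"
    by (simp add: aP mult.assoc)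
  then show ?thesis using a unfolding ennreal_mult_cancel_left P_def by auto
qed

lemma uniform_sphere_eq_gaussn:
  assumes n: "0 < n" and \<Psi>: "Measurable.pred (borel_vec n) \<Psi>"
    and cone: "\<And>v c. v \<in> carrier_vec n \<Longrightarrow> 0 < c \<Longrightarrow> \<Psi> (c \<cdot>\<^sub>v v) \<longleftrightarrow> \<Psi> v"
  shows "emeasure (uniform_sphere n) {b \<in> space (uniform_sphere n). \<Psi> b}
    = emeasure (gaussn n) {x \<in> space (gaussn n). \<Psi> (vec n x)}"
  using gaussn_cone_radial[OF n \<Psi> cone, of UNIV] prob_space.emeasure_space_1[OF prob_space_gaussn, of n]
  by simp

lemma prob_space_uniform_sphere:
  assumes "0 < n"
  shows "prob_space (uniform_sphere n)"
proof
  show "emeasure (uniform_sphere n) (space (uniform_sphere n)) = 1"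
    using uniform_sphere_eq_gaussn[OF assms, of "\<lambda>_. True"] prob_space.emeasure_space_1[OF prob_space_gaussn, of n]
    by simp
qed

text \<open>The integrand is \<open>1 / \<surd>(1 - 2 a)\<close> times a centred normal density of variance
  \<open>1 / (1 - 2 a)\<close>.\<close>

lemma std_normal_exp_square:
  assumes "2 * a < 1"
  shows "(\<integral>\<^sup>+x. ennreal (exp (a * x\<^sup>2)) \<partial>density lborel (\<lambda>x. ennreal (std_normal_density x))) = ennreal (1 / sqrt (1 - 2 * a))"
proof -
  define s where "s = 1 / sqrt (1 - 2 * a)"
  have s: "0 < s" "s\<^sup>2 = 1 / (1 - 2 * a)" using assms by (auto simp: s_def power_divide)
  have eq: "std_normal_density x * exp (a * x\<^sup>2) = s * normal_density 0 s x" for x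
  proof -
    have "normal_density 0 s x = 1 / (sqrt (2 * pi) * s) * exp (- x\<^sup>2 / (2 * s\<^sup>2))"
      using s(1) by (simp add: normal_density_def real_sqrt_mult)
    moreover have "- x\<^sup>2 / (2 * s\<^sup>2) = - x\<^sup>2 / 2 + a * x\<^sup>2" unfolding s(2) using assms by (simp add: field_simps)
    ultimately have "s * normal_density 0 s x = 1 / sqrt (2 * pi) * exp (- x\<^sup>2 / 2 + a * x\<^sup>2)" using s(1) by simp
    then show ?thesis unfolding std_normal_density_def exp_add by simp
  qed
  have "(\<integral>\<^sup>+x. ennreal (exp (a * x\<^sup>2)) \<partial>density lborel (\<lambda>x. ennreal (std_normal_density x)))
      = (\<integral>\<^sup>+x. ennreal (std_normal_density x) * ennreal (exp (a * x\<^sup>2)) \<partial>lborel)"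
    by (rule nn_integral_density) auto
  also have "\<dots> = (\<integral>\<^sup>+x. ennreal s * ennreal (normal_density 0 s x) \<partial>lborel)"
    using s(1) by (intro nn_integral_cong) (simp add: ennreal_mult'[symmetric] eq)
  also have "\<dots> = ennreal s * (\<integral>\<^sup>+x. ennreal (normal_density 0 s x) \<partial>lborel)"
    by (rule nn_integral_cmult) auto
  also have "(\<integral>\<^sup>+x. ennreal (normal_density 0 s x) \<partial>lborel) = 1"
    using prob_space.emeasure_space_1[OF prob_space_normal_density[OF s(1), of 0]]
    by (simp add: emeasure_density)
  finally show ?thesis by (simp add: s_def)
qed

text \<open>The exponential Markov inequality: the expectation of the exponential of a diagonal
  quadratic form factorises over the coordinates.\<close>

lemma gaussn_quadratic_tail:
  assumes a: "\<And>i. i < n \<Longrightarrow> 2 * a i < 1"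
  shows "emeasure (gaussn n) {x \<in> space (gaussn n). c \<le> (\<Sum>i<n. a i * (x i)\<^sup>2)}
    \<le> ennreal (exp (- c) * (\<Prod>i<n. 1 / sqrt (1 - 2 * a i)))"
proof -
  have m [measurable]: "(\<lambda>x. \<Sum>i<n. a i * (x i)\<^sup>2) \<in> borel_measurable (gaussn n)"
    unfolding gaussn_def by measurable
  have "emeasure (gaussn n) {x \<in> space (gaussn n). c \<le> (\<Sum>i<n. a i * (x i)\<^sup>2)}
      = (\<integral>\<^sup>+x. indicator {x \<in> space (gaussn n). c \<le> (\<Sum>i<n. a i * (x i)\<^sup>2)} x \<partial>gaussn n)"
    by (rule nn_integral_indicator[symmetric]) measurable
  also have "\<dots> \<le> (\<integral>\<^sup>+x. ennreal (exp (- c)) * (\<Prod>i<n. ennreal (exp (a i * (x i)\<^sup>2))) \<partial>gaussn n)"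
  proof (rule nn_integral_mono)
    fix x
    have "ennreal (exp (- c)) * (\<Prod>i<n. ennreal (exp (a i * (x i)\<^sup>2))) = ennreal (exp ((\<Sum>i<n. a i * (x i)\<^sup>2) - c))"
      by (simp add: prod_ennreal exp_sum[symmetric] ennreal_mult'[symmetric] exp_add[symmetric])
    moreover have "indicator {x \<in> space (gaussn n). c \<le> (\<Sum>i<n. a i * (x i)\<^sup>2)} x
        \<le> ennreal (exp ((\<Sum>i<n. a i * (x i)\<^sup>2) - c))"
      by (auto split: split_indicator)
    ultimately show "indicator {x \<in> space (gaussn n). c \<le> (\<Sum>i<n. a i * (x i)\<^sup>2)} x
        \<le> ennreal (exp (- c)) * (\<Prod>i<n. ennreal (exp (a i * (x i)\<^sup>2)))" by simp
  qed
  also have "\<dots> = ennreal (exp (- c)) * (\<integral>\<^sup>+x. (\<Prod>i<n. ennreal (exp (a i * (x i)\<^sup>2))) \<partial>gaussn n)"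
    by (rule nn_integral_cmult) (unfold gaussn_def, measurable)
  also have "(\<integral>\<^sup>+x. (\<Prod>i<n. ennreal (exp (a i * (x i)\<^sup>2))) \<partial>gaussn n)
      = (\<Prod>i<n. \<integral>\<^sup>+x. ennreal (exp (a i * x\<^sup>2)) \<partial>density lborel (\<lambda>x. ennreal (std_normal_density x)))"
    unfolding gaussn_def by (rule gauss.product_nn_integral_prod) auto
  also have "\<dots> = (\<Prod>i<n. ennreal (1 / sqrt (1 - 2 * a i)))"
    by (rule prod.cong) (use a std_normal_exp_square in auto)
  also have "ennreal (exp (- c)) * \<dots> = ennreal (exp (- c) * (\<Prod>i<n. 1 / sqrt (1 - 2 * a i)))"
    using a by (subst prod_ennreal) (auto intro!: ennreal_mult'[symmetric] simp: less_imp_le)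
  finally show ?thesis .
qed

section \<open>Coordinates of a random direction\<close>

text \<open>A sum of independent centred normal variables is normal, and the variances add up to
  \<open>u \<bullet> u = 1\<close>. The coordinates with \<open>u $ i = 0\<close> are left out, since a normal density
  needs a positive deviation.\<close>

lemma gaussn_linear_distributed:
  assumes u: "u \<in> carrier_vec n" "u \<bullet> u = 1"
  shows "distributed (gaussn n) lborel (\<lambda>x. \<Sum>i<n. u $ i * x i) (\<lambda>x. ennreal (std_normal_density x))"
proof -
  interpret G: prob_space "gaussn n" by (rule prob_space_gaussn)
  let ?N = "density lborel (\<lambda>x. ennreal (std_normal_density x))"
  define I where "I = {i. i < n \<and> u $ i \<noteq> 0}"
  have I: "finite I" "I \<subseteq> {..<n}" by (auto simp: I_def)
  have sum_I: "(\<Sum>i<n. u $ i * f i) = (\<Sum>i\<in>I. u $ i * f i)" for f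
    by (rule sum.mono_neutral_right) (auto simp: I_def)
  have uI: "(\<Sum>i\<in>I. (u $ i)\<^sup>2) = 1"
    using u sum_I[of "\<lambda>i. u $ i"] by (simp add: scalar_prod_sum power2_eq_square)
  have ne: "I \<noteq> {}" using uI by auto
  have coord: "(\<lambda>x. x i) \<in> gaussn n \<rightarrow>\<^sub>M ?N" if "i < n" for i
    unfolding gaussn_def by (rule measurable_component_singleton) (use that in simp)
  have distr: "distr (gaussn n) ?N (\<lambda>x. x i) = ?N" if "i < n" for i
    unfolding gaussn_def by (rule gaussp.PiM_component) (use that in simp)
  have "G.indep_vars (\<lambda>_. ?N) (\<lambda>i x. x i) {..<n}"
  proof (subst G.indep_vars_iff_distr_eq_PiM')
    show "{..<n} \<noteq> {}" using I ne by auto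
    show "G.random_variable ?N (\<lambda>x. x i)" if "i \<in> {..<n}" for i using coord that by simp
    have "distr (gaussn n) (Pi\<^sub>M {..<n} (\<lambda>i. ?N)) (\<lambda>x. \<lambda>i\<in>{..<n}. x i) = distr (gaussn n) (gaussn n) (\<lambda>x. x)"
    proof (rule distr_cong)
      fix x assume "x \<in> space (gaussn n)"
      then show "(\<lambda>i\<in>{..<n}. x i) = x" by (auto simp: space_gaussn space_PiM)
    qed (auto simp: gaussn_def)
    also have "\<dots> = gaussn n" by (rule distr_id2) simp
    also have "\<dots> = (\<Pi>\<^sub>M i\<in>{..<n}. distr (gaussn n) ?N (\<lambda>x. x i))"
      unfolding gaussn_def by (rule PiM_cong) (use distr in \<open>auto simp: gaussn_def\<close>)
    finally show "distr (gaussn n) (Pi\<^sub>M {..<n} (\<lambda>i. ?N)) (\<lambda>x. \<lambda>i\<in>{..<n}. x i)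
      = (\<Pi>\<^sub>M i\<in>{..<n}. distr (gaussn n) ?N (\<lambda>x. x i))" .
  qed
  then have "G.indep_vars (\<lambda>_. ?N) (\<lambda>i x. x i) I" by (rule G.indep_vars_subset) (rule I(2))
  then have ind: "G.indep_vars (\<lambda>_. borel) (\<lambda>i x. u $ i * x i) I"
    by (rule G.indep_vars_compose2) simp
  have normal: "distributed (gaussn n) lborel (\<lambda>x. u $ i * x i) (normal_density 0 \<bar>u $ i\<bar>)" if "i \<in> I" for i
  proof -
    have i: "i < n" "u $ i \<noteq> 0" using that by (auto simp: I_def)
    have "distr (gaussn n) lborel (\<lambda>x. x i) = distr (gaussn n) ?N (\<lambda>x. x i)"
      by (rule distr_cong) auto
    then have "distributed (gaussn n) lborel (\<lambda>x. x i) (normal_density 0 1)"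
      unfolding distributed_def using coord[OF i(1)] distr[OF i(1)] by (auto simp: measurable_cong_sets[of _ _ ?N lborel])
    from G.normal_density_affine[OF this, of "u $ i" 0] show ?thesis using i by simp
  qed
  have "distributed (gaussn n) lborel (\<lambda>x. \<Sum>i\<in>I. u $ i * x i)
      (normal_density (\<Sum>i\<in>I. 0) (sqrt (\<Sum>i\<in>I. \<bar>u $ i\<bar>\<^sup>2)))"
    by (rule G.sum_indep_normal[OF I(1) ne ind _ normal]) (auto simp: I_def)
  then show ?thesis unfolding sum_I by (simp add: uI)
qed

lemma gaussn_slab:
  assumes u: "u \<in> carrier_vec n" "u \<bullet> u = 1" and z: "0 \<le> z"
  shows "emeasure (gaussn n) {x \<in> space (gaussn n). \<bar>\<Sum>i<n. u $ i * x i\<bar> \<le> z} \<le> ennreal z"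
proof -
  note D = gaussn_linear_distributed[OF u]
  have "emeasure (gaussn n) {x \<in> space (gaussn n). \<bar>\<Sum>i<n. u $ i * x i\<bar> \<le> z}
      = emeasure (gaussn n) ((\<lambda>x. \<Sum>i<n. u $ i * x i) -` {-z..z} \<inter> space (gaussn n))"
    by (rule arg_cong[where f = "emeasure (gaussn n)"]) (auto simp: abs_le_iff)
  also have "\<dots> = (\<integral>\<^sup>+x. ennreal (std_normal_density x) * indicator {-z..z} x \<partial>lborel)"
    by (rule distributed_emeasure[OF D]) simp
  also have "\<dots> \<le> (\<integral>\<^sup>+x. ennreal (1 / 2) * indicator {-z..z} x \<partial>lborel)"
  proof (rule nn_integral_mono, rule mult_right_mono)
    fix x :: real
    have "std_normal_density x \<le> 1 / sqrt (2 * pi) * 1"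
      unfolding std_normal_density_def by (intro mult_left_mono) auto
    also have "\<dots> \<le> 1 / 2"
    proof -
      have "(2::real) = sqrt 4" by simp
      also have "\<dots> \<le> sqrt (2 * pi)" by (rule real_sqrt_le_mono) (use pi_gt3 in simp)
      finally show ?thesis by (simp add: frac_le)
    qed
    finally show "ennreal (std_normal_density x) \<le> ennreal (1 / 2)" by (rule ennreal_leI)
  qed simp
  also have "\<dots> = ennreal (1 / 2) * ennreal (2 * z)"
    using z by (subst nn_integral_cmult_indicator) auto
  also have "\<dots> = ennreal z" using z by (subst ennreal_mult[symmetric]) auto
  finally show ?thesis .
qed

text \<open>The exponential Markov inequality with exponent \<open>1/4\<close> bounds the complementary
  probability by \<open>(2 / e)\<^bsup>n/2\<^esup>\<close>.\<close>

lemma gaussn_ball: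
  assumes n: "100 \<le> n"
  shows "ennreal (1 / 2) \<le> emeasure (gaussn n) {x \<in> space (gaussn n). sqsum n x \<in> {..2 * real n}}"
proof -
  interpret G: prob_space "gaussn n" by (rule prob_space_gaussn)
  have m [measurable]: "sqsum n \<in> borel_measurable (gaussn n)"
    using measurable_sqsum[of n] by (simp cong: measurable_cong_sets add: sets_gaussn)
  have "emeasure (gaussn n) {x \<in> space (gaussn n). real n / 2 \<le> (\<Sum>i<n. 1 / 4 * (x i)\<^sup>2)}
    \<le> ennreal (exp (- (real n / 2)) * (\<Prod>i<n. 1 / sqrt (1 - 2 * (1 / 4))))"
    by (rule gaussn_quadratic_tail) simp
  also have "exp (- (real n / 2)) * (\<Prod>i<n. 1 / sqrt (1 - 2 * (1 / 4))) = (exp (- (1 / 2)) * sqrt 2) ^ n"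
    by (simp add: power_mult_distrib real_sqrt_divide flip: exp_of_nat_mult)
  also have "\<dots> \<le> (exp (- (1 / 2)) * sqrt 2) ^ 8"
  proof (rule power_decreasing)
    have "sqrt 2 \<le> exp (1 / 2)"
    proof (rule real_le_lsqrt)
      have "(2::real) \<le> exp 1" using exp_ge_add_one_self[of 1] by simp
      then show "2 \<le> (exp (1 / 2 :: real))\<^sup>2" by (simp add: exp_double[symmetric])
    qed simp_all
    then show "exp (- (1 / 2)) * sqrt 2 \<le> 1" by (simp add: exp_minus divide_simps)
  qed (use n in auto)
  also have "\<dots> \<le> 1 / 2"
  proof -
    have "(5 / 2 :: real) \<le> exp 1"
      using exp_lower_Taylor_quadratic[of 1] by simp
    then have "(5 / 2 :: real) ^ 4 \<le> exp 1 ^ 4" by (rule power_mono) simp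
    then have e4: "625 / 16 \<le> exp (4 :: real)" by (simp add: power_divide flip: exp_of_nat_mult)
    have "(exp (- (1 / 2 :: real)) * sqrt 2) ^ 8 = exp (- 4) * 16"
    proof -
      have "sqrt 2 ^ (2 * 4) = (sqrt 2 ^ 2) ^ 4" by (rule power_mult)
      then have "sqrt 2 ^ 8 = 16" by simp
      then show ?thesis by (simp add: power_mult_distrib flip: exp_of_nat_mult)
    qed
    also have "\<dots> \<le> 1 / 2" using e4 by (simp add: exp_minus divide_simps)
    finally show ?thesis .
  qed
  finally have t: "emeasure (gaussn n) {x \<in> space (gaussn n). real n / 2 \<le> (\<Sum>i<n. 1 / 4 * (x i)\<^sup>2)} \<le> ennreal (1 / 2)"
    by (simp add: ennreal_leI)
  have eq: "{x \<in> space (gaussn n). real n / 2 \<le> (\<Sum>i<n. 1 / 4 * (x i)\<^sup>2)} = {x \<in> space (gaussn n). 2 * real n \<le> sqsum n x}"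
  proof -
    have s: "(\<Sum>i<n. 1 / 4 * (x i)\<^sup>2) = 1 / 4 * sqsum n x" for x
      unfolding sqsum_def by (rule sum_distrib_left[symmetric])
    show ?thesis unfolding s by auto
  qed
  have "1 - ennreal (1 / 2) \<le> 1 - emeasure (gaussn n) {x \<in> space (gaussn n). 2 * real n \<le> sqsum n x}"
    using t unfolding eq by (rule ennreal_minus_mono[OF order_refl])
  also have "\<dots> = emeasure (gaussn n) (space (gaussn n) - {x \<in> space (gaussn n). 2 * real n \<le> sqsum n x})"
    by (subst emeasure_compl) (auto simp: G.emeasure_space_1)
  also have "\<dots> \<le> emeasure (gaussn n) {x \<in> space (gaussn n). sqsum n x \<in> {..2 * real n}}"
    by (rule emeasure_mono) auto
  also have "1 - ennreal (1 / 2) = ennreal (1 / 2)"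
    unfolding ennreal_1[symmetric] by (subst ennreal_minus) simp_all
  finally show ?thesis .
qed

text \<open>Direction and length being independent, the event for the direction together with
  \<open>\<bar>x\<bar>\<^sup>2 \<le> 2 n\<close> has at least half the probability of the former, and it forces the standard
  normal variable \<open>u \<bullet> x\<close> into an interval of length \<open>2 \<theta> \<surd>(2 n)\<close>. The resulting bound is
  \<open>2 \<surd>2 \<theta> \<surd>n\<close>. It is proportional to \<open>\<theta>\<close> without an additive error, which is essential
  because \<open>\<theta>\<close> may be far smaller than any tail probability of the length.\<close>

lemma uniform_sphere_slab:
  assumes n: "100 \<le> n" and u: "u \<in> carrier_vec n" "u \<bullet> u = 1" and \<theta>: "0 \<le> \<theta>"
  shows "{b \<in> space (uniform_sphere n). (u \<bullet> b)\<^sup>2 < \<theta>\<^sup>2} \<in> sets (uniform_sphere n)"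
    and "measure (uniform_sphere n) {b \<in> space (uniform_sphere n). (u \<bullet> b)\<^sup>2 < \<theta>\<^sup>2} \<le> 3 * \<theta> * sqrt (real n)"
proof -
  have n0: "0 < n" using n by simp
  interpret U: prob_space "uniform_sphere n" by (rule prob_space_uniform_sphere[OF n0])
  define \<Psi> where "\<Psi> v \<longleftrightarrow> (\<Sum>i<n. u $ i * v $ i)\<^sup>2 < \<theta>\<^sup>2 * (v \<bullet> v)" for v
  have \<Psi>: "Measurable.pred (borel_vec n) \<Psi>" unfolding \<Psi>_def by measurable
  have cone: "\<Psi> (c \<cdot>\<^sub>v v) \<longleftrightarrow> \<Psi> v" if v: "v \<in> carrier_vec n" and c: "0 < c" for v c
  proof -
    have "(\<Sum>i<n. u $ i * (c \<cdot>\<^sub>v v) $ i) = c * (\<Sum>i<n. u $ i * v $ i)"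
      using v by (auto simp: sum_distrib_left intro!: sum.cong)
    moreover have "(c \<cdot>\<^sub>v v) \<bullet> (c \<cdot>\<^sub>v v) = c\<^sup>2 * (v \<bullet> v)" using v by (simp add: power2_eq_square)
    moreover have "c\<^sup>2 * s < \<theta>\<^sup>2 * (c\<^sup>2 * t) \<longleftrightarrow> s < \<theta>\<^sup>2 * t" for s t
      using c mult_less_cancel_left_pos[of "c\<^sup>2" s "\<theta>\<^sup>2 * t"] by (simp add: mult.left_commute)
    ultimately show ?thesis unfolding \<Psi>_def by (simp only: power_mult_distrib)
  qed
  have ev: "{b \<in> space (uniform_sphere n). (u \<bullet> b)\<^sup>2 < \<theta>\<^sup>2} = {b \<in> space (uniform_sphere n). \<Psi> b}"
    using u unfolding space_uniform_sphere \<Psi>_def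
    by (auto simp: unit_sphere_def scalar_prod_sum real_sqrt_eq_1_iff)
  show "{b \<in> space (uniform_sphere n). (u \<bullet> b)\<^sup>2 < \<theta>\<^sup>2} \<in> sets (uniform_sphere n)"
    unfolding ev by (rule emeasure_uniform_sphere(1)[OF \<Psi> cone])
  define z where "z = \<theta> * sqrt (2 * real n)"
  have z: "0 \<le> z" using \<theta> by (simp add: z_def)
  have "emeasure (uniform_sphere n) {b \<in> space (uniform_sphere n). \<Psi> b} * ennreal (1 / 2)
      \<le> emeasure (uniform_sphere n) {b \<in> space (uniform_sphere n). \<Psi> b}
        * emeasure (gaussn n) {x \<in> space (gaussn n). sqsum n x \<in> {..2 * real n}}"
    by (rule mult_left_mono[OF gaussn_ball[OF n]]) simp
  also have "\<dots> = emeasure (gaussn n) {x \<in> space (gaussn n). \<Psi> (vec n x) \<and> sqsum n x \<in> {..2 * real n}}"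
    by (rule gaussn_cone_radial[OF n0 \<Psi> cone, symmetric]) auto
  also have "\<dots> \<le> emeasure (gaussn n) {x \<in> space (gaussn n). \<bar>\<Sum>i<n. u $ i * x i\<bar> \<le> z}"
  proof (rule emeasure_mono)
    show "{x \<in> space (gaussn n). \<Psi> (vec n x) \<and> sqsum n x \<in> {..2 * real n}}
      \<subseteq> {x \<in> space (gaussn n). \<bar>\<Sum>i<n. u $ i * x i\<bar> \<le> z}"
    proof safe
      fix x assume x: "\<Psi> (vec n x)" "sqsum n x \<le> 2 * real n"
      have "(\<Sum>i<n. u $ i * x i)\<^sup>2 \<le> \<theta>\<^sup>2 * sqsum n x" using x(1) unfolding \<Psi>_def scalar_prod_vec_self by simp
      also have "\<dots> \<le> \<theta>\<^sup>2 * (2 * real n)" by (rule mult_left_mono[OF x(2)]) simp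
      also have "\<dots> = z\<^sup>2" by (simp add: z_def power_mult_distrib)
      finally have "\<bar>\<Sum>i<n. u $ i * x i\<bar> \<le> \<bar>z\<bar>" by (simp only: abs_le_square_iff)
      then show "\<bar>\<Sum>i<n. u $ i * x i\<bar> \<le> z" using z by simp
    qed
    show "{x \<in> space (gaussn n). \<bar>\<Sum>i<n. u $ i * x i\<bar> \<le> z} \<in> sets (gaussn n)"
      unfolding gaussn_def by measurable
  qed
  also have "\<dots> \<le> ennreal z" by (rule gaussn_slab[OF u z])
  finally have "ennreal (measure (uniform_sphere n) {b \<in> space (uniform_sphere n). \<Psi> b} * (1 / 2)) \<le> ennreal z"
    unfolding U.emeasure_eq_measure by (subst ennreal_mult) auto
  then have "measure (uniform_sphere n) {b \<in> space (uniform_sphere n). \<Psi> b} \<le> 2 * z"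
    using z by (simp add: ennreal_le_iff)
  also have "2 * z \<le> 3 * \<theta> * sqrt (real n)"
  proof -
    have "sqrt 2 \<le> 3 / 2" by (rule real_le_lsqrt) (auto simp: power2_eq_square)
    then have "2 * (sqrt 2) * (\<theta> * sqrt (real n)) \<le> 3 * (\<theta> * sqrt (real n))"
      using \<theta> by (intro mult_right_mono) auto
    then show ?thesis by (simp add: z_def real_sqrt_mult mult_ac)
  qed
  finally show "measure (uniform_sphere n) {b \<in> space (uniform_sphere n). (u \<bullet> b)\<^sup>2 < \<theta>\<^sup>2} \<le> 3 * \<theta> * sqrt (real n)"
    unfolding ev .
qed

text \<open>The event is a cone, so it may be estimated for Gaussian vectors, by the exponential Markov
  inequality with weight \<open>1/4\<close> on the coordinate \<open>0\<close> and \<open>-q/4\<close> on the cluster \<open>I\<close>.\<close>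

lemma uniform_sphere_cluster_tail:
  assumes n: "0 < n" and I: "I \<subseteq> {..<n}" "0 \<notin> I" and q: "0 \<le> q"
  shows "{b \<in> space (uniform_sphere n). q * (\<Sum>i\<in>I. (b $ i)\<^sup>2) < (b $ 0)\<^sup>2} \<in> sets (uniform_sphere n)"
    and "measure (uniform_sphere n) {b \<in> space (uniform_sphere n). q * (\<Sum>i\<in>I. (b $ i)\<^sup>2) < (b $ 0)\<^sup>2}
      \<le> sqrt 2 * (1 / sqrt (1 + q / 2)) ^ card I"
proof -
  interpret U: prob_space "uniform_sphere n" by (rule prob_space_uniform_sphere[OF n])
  have fin: "finite I" using I finite_subset by auto
  define \<Psi> where "\<Psi> v \<longleftrightarrow> q * (\<Sum>i\<in>I. (v $ i)\<^sup>2) < (v $ 0)\<^sup>2" for v :: "real vec"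
  have \<Psi>: "Measurable.pred (borel_vec n) \<Psi>"
  proof -
    have "(\<lambda>v. \<Sum>i\<in>I. (v $ i)\<^sup>2) \<in> borel_measurable (borel_vec n)"
      using I by (intro borel_measurable_sum borel_measurable_power measurable_vec_index) auto
    moreover have "(\<lambda>v. v $ 0) \<in> borel_measurable (borel_vec n)" by (rule measurable_vec_index[OF n])
    ultimately show ?thesis unfolding \<Psi>_def by measurable
  qed
  have cone: "\<Psi> (c \<cdot>\<^sub>v v) \<longleftrightarrow> \<Psi> v" if v: "v \<in> carrier_vec n" and c: "0 < c" for v c
  proof -
    have "(\<Sum>i\<in>I. ((c \<cdot>\<^sub>v v) $ i)\<^sup>2) = c\<^sup>2 * (\<Sum>i\<in>I. (v $ i)\<^sup>2)"
      unfolding sum_distrib_left using v I by (intro sum.cong) (auto simp: power_mult_distrib subset_iff)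
    moreover have "((c \<cdot>\<^sub>v v) $ 0)\<^sup>2 = c\<^sup>2 * (v $ 0)\<^sup>2" using v n by (simp add: power_mult_distrib)
    moreover have "q * (c\<^sup>2 * s) < c\<^sup>2 * t \<longleftrightarrow> q * s < t" for s t
      using c mult_less_cancel_left_pos[of "c\<^sup>2" "q * s" t] by (simp add: mult.left_commute)
    ultimately show ?thesis unfolding \<Psi>_def by simp
  qed
  show "{b \<in> space (uniform_sphere n). q * (\<Sum>i\<in>I. (b $ i)\<^sup>2) < (b $ 0)\<^sup>2} \<in> sets (uniform_sphere n)"
    using emeasure_uniform_sphere(1)[OF \<Psi> cone] unfolding \<Psi>_def .
  define a where "a i = (if i = 0 then 1 / 4 else if i \<in> I then - q / 4 else 0)" for i :: nat
  have suma: "(\<Sum>i<n. a i * (x i)\<^sup>2) = ((x 0)\<^sup>2 - q * (\<Sum>i\<in>I. (x i)\<^sup>2)) / 4" for x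
  proof -
    have "(\<Sum>i<n. a i * (x i)\<^sup>2) = (\<Sum>i\<in>insert 0 I. a i * (x i)\<^sup>2)"
      by (rule sum.mono_neutral_right) (use I n in \<open>auto simp: a_def\<close>)
    also have "\<dots> = a 0 * (x 0)\<^sup>2 + (\<Sum>i\<in>I. a i * (x i)\<^sup>2)" using fin I by simp
    also have "(\<Sum>i\<in>I. a i * (x i)\<^sup>2) = (\<Sum>i\<in>I. - q / 4 * (x i)\<^sup>2)"
      by (rule sum.cong) (use I in \<open>auto simp: a_def\<close>)
    also have "\<dots> = - q / 4 * (\<Sum>i\<in>I. (x i)\<^sup>2)" by (rule sum_distrib_left[symmetric])
    finally show ?thesis by (simp add: a_def diff_divide_distrib)
  qed
  have proda: "(\<Prod>i<n. 1 / sqrt (1 - 2 * a i)) = sqrt 2 * (1 / sqrt (1 + q / 2)) ^ card I"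
  proof -
    have "(\<Prod>i<n. 1 / sqrt (1 - 2 * a i)) = (\<Prod>i\<in>insert 0 I. 1 / sqrt (1 - 2 * a i))"
      by (rule prod.mono_neutral_right) (use I n in \<open>auto simp: a_def\<close>)
    also have "\<dots> = 1 / sqrt (1 - 2 * a 0) * (\<Prod>i\<in>I. 1 / sqrt (1 - 2 * a i))" using fin I by simp
    also have "(\<Prod>i\<in>I. 1 / sqrt (1 - 2 * a i)) = (\<Prod>i\<in>I. 1 / sqrt (1 + q / 2))"
      by (rule prod.cong) (use I in \<open>auto simp: a_def\<close>)
    finally show ?thesis by (simp add: a_def real_sqrt_divide)
  qed
  have "emeasure (uniform_sphere n) {b \<in> space (uniform_sphere n). \<Psi> b}
      = emeasure (gaussn n) {x \<in> space (gaussn n). \<Psi> (vec n x)}"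
    by (rule uniform_sphere_eq_gaussn[OF n \<Psi> cone])
  also have "\<dots> \<le> emeasure (gaussn n) {x \<in> space (gaussn n). 0 \<le> (\<Sum>i<n. a i * (x i)\<^sup>2)}"
  proof (rule emeasure_mono)
    have s: "(\<Sum>i\<in>I. (vec n x $ i)\<^sup>2) = (\<Sum>i\<in>I. (x i)\<^sup>2)" for x
      by (rule sum.cong) (use I in auto)
    have z: "vec n x $ 0 = x 0" for x using n by simp
    have "\<Psi> (vec n x) \<longleftrightarrow> q * (\<Sum>i\<in>I. (x i)\<^sup>2) < (x 0)\<^sup>2" for x
      unfolding \<Psi>_def s z ..
    then show "{x \<in> space (gaussn n). \<Psi> (vec n x)} \<subseteq> {x \<in> space (gaussn n). 0 \<le> (\<Sum>i<n. a i * (x i)\<^sup>2)}"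
      unfolding suma by auto
    show "{x \<in> space (gaussn n). 0 \<le> (\<Sum>i<n. a i * (x i)\<^sup>2)} \<in> sets (gaussn n)"
      unfolding gaussn_def by measurable
  qed
  also have "\<dots> \<le> ennreal (exp (- 0) * (\<Prod>i<n. 1 / sqrt (1 - 2 * a i)))"
    by (rule gaussn_quadratic_tail) (use q in \<open>auto simp: a_def\<close>)
  finally have "ennreal (measure (uniform_sphere n) {b \<in> space (uniform_sphere n). \<Psi> b})
      \<le> ennreal (sqrt 2 * (1 / sqrt (1 + q / 2)) ^ card I)"
    unfolding proda by (simp add: U.emeasure_eq_measure)
  then show "measure (uniform_sphere n) {b \<in> space (uniform_sphere n). q * (\<Sum>i\<in>I. (b $ i)\<^sup>2) < (b $ 0)\<^sup>2}
      \<le> sqrt 2 * (1 / sqrt (1 + q / 2)) ^ card I"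
    using q unfolding \<Psi>_def by (subst (asm) ennreal_le_iff) auto
qed

section \<open>Diagonal matrices\<close>

definition diagm :: "nat \<Rightarrow> (nat \<Rightarrow> real) \<Rightarrow> real mat" where
  "diagm n d = mat n n (\<lambda>(i, j). if i = j then d i else 0)"

lemma diagm_carrier [simp]: "diagm n d \<in> carrier_mat n n"
  by (simp add: diagm_def)

lemma diagm_transpose: "transpose_mat (diagm n d) = diagm n d"
  by (rule eq_matI) (auto simp: diagm_def)

lemma diagm_mult_vec:
  assumes "x \<in> carrier_vec n"
  shows "diagm n d *\<^sub>v x = vec n (\<lambda>i. d i * x $ i)"
proof (rule eq_vecI)
  fix i assume "i < dim_vec (vec n (\<lambda>i. d i * x $ i))"
  then have i: "i < n" by simp
  have "(diagm n d *\<^sub>v x) $ i = (\<Sum>j<n. diagm n d $$ (i, j) * x $ j)"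
    by (rule mult_vec_index[OF diagm_carrier assms i])
  also have "\<dots> = (\<Sum>j<n. if j = i then d i * x $ i else 0)"
    by (rule sum.cong) (use i in \<open>auto simp: diagm_def\<close>)
  finally show "(diagm n d *\<^sub>v x) $ i = vec n (\<lambda>i. d i * x $ i) $ i" using i by simp
qed (simp add: diagm_def)

lemma diagm_quadratic_form:
  assumes "x \<in> carrier_vec n"
  shows "x \<bullet> (diagm n d *\<^sub>v x) = (\<Sum>i<n. d i * (x $ i)\<^sup>2)"
  unfolding diagm_mult_vec[OF assms] using assms
  by (subst scalar_prod_sum[of _ n]) (auto simp: power2_eq_square intro!: sum.cong)

lemma scalar_prod_self_sum: "x \<in> carrier_vec n \<Longrightarrow> x \<bullet> x = (\<Sum>i<n. (x $ i :: real)\<^sup>2)"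
  by (simp add: scalar_prod_sum power2_eq_square)

lemma diagm_pvec:
  assumes b: "b \<in> carrier_vec n"
  shows "pvec (diagm n d) b P = vec n (\<lambda>i. poly P (d i) * b $ i)"
proof (induction P rule: pCons_induct)
  case 0
  show ?case using b by (auto simp: pvec_0)
next
  case (pCons a P)
  show ?case unfolding pvec_pCons[OF diagm_carrier b] diagm_mult_vec[OF pvec_carrier[OF b]]
    unfolding pCons.IH using b by (intro eq_vecI) (auto simp: algebra_simps)
qed

lemma diagm_spd:
  assumes "\<And>i. i < n \<Longrightarrow> 0 < d i"
  shows "diagm n d \<in> spd_mats n"
proof -
  have "0 < x \<bullet> (diagm n d *\<^sub>v x)" if x: "x \<in> carrier_vec n" "x \<noteq> 0\<^sub>v n" for x
  proof -
    obtain i where i: "i < n" "x $ i \<noteq> 0" using x by (metis carrier_vecD eq_vecI index_zero_vec)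
    show ?thesis unfolding diagm_quadratic_form[OF x(1)]
      by (rule sum_pos2[of _ i]) (use i assms in \<open>auto intro!: mult_nonneg_nonneg intro: less_imp_le\<close>)
  qed
  then show ?thesis by (auto simp: spd_mats_def diagm_transpose)
qed

lemma diagm_unit_vec:
  assumes "i < n"
  shows "unit_vec n i \<in> carrier_vec n" "unit_vec n i \<bullet> unit_vec n i = (1 :: real)"
    "diagm n d *\<^sub>v unit_vec n i = d i \<cdot>\<^sub>v unit_vec n i"
  using assms by (auto simp: diagm_mult_vec)

lemma diagm_eig_min:
  assumes "i < n" "\<And>j. j < n \<Longrightarrow> d i \<le> d j"
  shows "eig_min (diagm n d) = d i"
proof (rule eig_min_eqI[OF diagm_carrier diagm_unit_vec[OF assms(1)]])
  fix x :: "real vec" assume x: "x \<in> carrier_vec n"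
  show "d i * (x \<bullet> x) \<le> x \<bullet> (diagm n d *\<^sub>v x)"
    unfolding diagm_quadratic_form[OF x] scalar_prod_self_sum[OF x] sum_distrib_left
    by (rule sum_mono, rule mult_right_mono) (use assms in auto)
qed

lemma diagm_eig_max:
  assumes "i < n" "\<And>j. j < n \<Longrightarrow> d j \<le> d i"
  shows "eig_max (diagm n d) = d i"
proof (rule eig_max_eqI[OF diagm_carrier diagm_unit_vec[OF assms(1)]])
  fix x :: "real vec" assume x: "x \<in> carrier_vec n"
  show "x \<bullet> (diagm n d *\<^sub>v x) \<le> d i * (x \<bullet> x)"
    unfolding diagm_quadratic_form[OF x] scalar_prod_self_sum[OF x] sum_distrib_left
    by (rule sum_mono, rule mult_right_mono) (use assms in auto)
qed

lemma diagm_shifted_form: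
  assumes b: "b \<in> carrier_vec n"
  shows "pvec (diagm n d) b P \<bullet> (diagm n d *\<^sub>v pvec (diagm n d) b P)
      - a * (pvec (diagm n d) b P \<bullet> pvec (diagm n d) b P)
    = (\<Sum>i<n. (d i - a) * (poly P (d i))\<^sup>2 * (b $ i)\<^sup>2)"
proof -
  note c = pvec_carrier[OF b, of "diagm n d" P]
  have "pvec (diagm n d) b P $ i = poly P (d i) * b $ i" if "i < n" for i
    unfolding diagm_pvec[OF b] using that by simp
  then show ?thesis
    unfolding diagm_quadratic_form[OF c] scalar_prod_self_sum[OF c] sum_distrib_left sum_subtractf[symmetric]
    by (intro sum.cong) (auto simp: power_mult_distrib algebra_simps)
qed

text \<open>A single quadratic form decides whether a Krylov vector pushes the Rayleigh quotient
  beyond \<open>a\<close>. It serves both for the measurability of the Ritz values and for bounding them.\<close>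

lemma diagm_rayleigh_beyond:
  assumes b: "b \<in> carrier_vec n" and m: "0 < m"
  shows "(\<exists>x\<in>krylov (diagm n d) b m. x \<noteq> 0\<^sub>v n \<and> s * a < s * rayleigh (diagm n d) x)
    \<longleftrightarrow> (\<exists>P. degree P < m \<and> 0 < (\<Sum>i<n. s * (d i - a) * (poly P (d i))\<^sup>2 * (b $ i)\<^sup>2))"
proof -
  have "x \<noteq> 0\<^sub>v n \<and> s * a < s * rayleigh (diagm n d) x
      \<longleftrightarrow> 0 < (\<Sum>i<n. s * (d i - a) * (poly P (d i))\<^sup>2 * (b $ i)\<^sup>2)"
    if x: "x = pvec (diagm n d) b P" for x P
  proof -
    have c: "x \<in> carrier_vec n" unfolding x by (rule pvec_carrier[OF b])
    have "(\<Sum>i<n. s * (d i - a) * (poly P (d i))\<^sup>2 * (b $ i)\<^sup>2)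
        = s * (x \<bullet> (diagm n d *\<^sub>v x) - a * (x \<bullet> x))"
      unfolding x diagm_shifted_form[OF b] sum_distrib_left by (simp add: mult.assoc)
    moreover have "s * a < s * rayleigh (diagm n d) x \<longleftrightarrow> 0 < s * (x \<bullet> (diagm n d *\<^sub>v x) - a * (x \<bullet> x))"
      if "x \<noteq> 0\<^sub>v n"
      using scalar_prod_self_pos[OF c that] by (simp add: rayleigh_def less_divide_eq algebra_simps)
    ultimately show ?thesis by (cases "x = 0\<^sub>v n") (auto simp: mult_mat_zero_vec)
  qed
  then show ?thesis unfolding krylov_eq[OF diagm_carrier b m] by blast
qed

lemma diagm_ritz_max_greater:
  assumes b: "b \<in> carrier_vec n" "b \<noteq> 0\<^sub>v n" and m: "0 < m"
  shows "a < ritz_max (diagm n d) b m \<longleftrightarrow>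
    (\<exists>P. degree P < m \<and> 0 < (\<Sum>i<n. (d i - a) * (poly P (d i))\<^sup>2 * (b $ i)\<^sup>2))"
proof -
  note R = ritz_max_attained[OF diagm_carrier[of n d] b m]
  have "a < ritz_max (diagm n d) b m \<longleftrightarrow> (\<exists>x\<in>krylov (diagm n d) b m. x \<noteq> 0\<^sub>v n \<and> 1 * a < 1 * rayleigh (diagm n d) x)"
    using R(1) R(2) by (auto intro: less_le_trans)
  then show ?thesis unfolding diagm_rayleigh_beyond[OF b(1) m] by simp
qed

lemma diagm_ritz_min_less:
  assumes b: "b \<in> carrier_vec n" "b \<noteq> 0\<^sub>v n" and m: "0 < m"
  shows "ritz_min (diagm n d) b m < a \<longleftrightarrow>
    (\<exists>P. degree P < m \<and> 0 < (\<Sum>i<n. (a - d i) * (poly P (d i))\<^sup>2 * (b $ i)\<^sup>2))"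
proof -
  note R = ritz_min_attained[OF diagm_carrier[of n d] b m]
  have "ritz_min (diagm n d) b m < a \<longleftrightarrow> (\<exists>x\<in>krylov (diagm n d) b m. x \<noteq> 0\<^sub>v n \<and> -1 * a < -1 * rayleigh (diagm n d) x)"
    using R(1) R(2) by (auto intro: le_less_trans)
  then show ?thesis unfolding diagm_rayleigh_beyond[OF b(1) m] by simp
qed

lemma measurable_sphere_index:
  assumes "i < n"
  shows "(\<lambda>b. b $ i) \<in> borel_measurable (uniform_sphere n)"
proof -
  have "(\<lambda>b. b $ i) \<in> borel_measurable (restrict_space (borel_vec n) (unit_sphere n))"
    by (rule measurable_restrict_space1[OF measurable_vec_index[OF assms]])
  then show ?thesis by (simp cong: measurable_cong_sets add: sets_uniform_sphere)
qed

text \<open>For fixed \<open>b\<close> the condition on \<open>P\<close> is an open condition on its coefficient sequence. The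
  existential quantifier can therefore be restricted to a countable dense set of sequences.\<close>

lemma sets_exists_poly:
  fixes g d :: "nat \<Rightarrow> real"
  shows "{b \<in> space (uniform_sphere n). \<exists>P. degree P < m \<and> 0 < (\<Sum>i<n. g i * (poly P (d i))\<^sup>2 * (b $ i)\<^sup>2)}
    \<in> sets (uniform_sphere n)"
proof (cases "m = 0")
  case False
  obtain D :: "(nat \<Rightarrow> real) set" where D: "countable D"
    "\<And>X. open X \<Longrightarrow> X \<noteq> {} \<Longrightarrow> \<exists>c\<in>D. c \<in> X"
    using countable_dense_exists by blast
  define H where "H b c = (\<Sum>i<n. g i * (\<Sum>k<m. c k * d i ^ k)\<^sup>2 * (b $ i)\<^sup>2)" for b and c :: "nat \<Rightarrow> real"
  have ex: "(\<exists>P. degree P < m \<and> 0 < (\<Sum>i<n. g i * (poly P (d i))\<^sup>2 * (b $ i)\<^sup>2)) \<longleftrightarrow> (\<exists>c\<in>D. 0 < H b c)" for b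
  proof
    assume "\<exists>P. degree P < m \<and> 0 < (\<Sum>i<n. g i * (poly P (d i))\<^sup>2 * (b $ i)\<^sup>2)"
    then obtain P where P: "degree P < m" "0 < (\<Sum>i<n. g i * (poly P (d i))\<^sup>2 * (b $ i)\<^sup>2)" by auto
    have "poly P x = (\<Sum>k<m. coeff P k * x ^ k)" for x
      unfolding poly_altdef by (rule sum_coeff_lessThan[OF P(1)])
    then have "0 < H b (coeff P)" using P(2) by (simp add: H_def)
    then have "{c. 0 < H b c} \<noteq> {}" by auto
    moreover have "open {c. 0 < H b c}"
      unfolding H_def by (intro open_Collect_less continuous_intros continuous_on_product_coordinates)
    ultimately show "\<exists>c\<in>D. 0 < H b c" using D(2) by blast
  next
    assume "\<exists>c\<in>D. 0 < H b c"
    then obtain c where c: "0 < H b c" by auto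
    define P where "P = Poly (map c [0..<m])"
    have cf: "coeff P k = (if k < m then c k else 0)" for k by (auto simp: P_def nth_default_def)
    have dP: "degree P < m" using degree_lessI[of P m] cf False by auto
    have "poly P x = (\<Sum>k<m. coeff P k * x ^ k)" for x
      unfolding poly_altdef by (rule sum_coeff_lessThan[OF dP])
    then have "0 < (\<Sum>i<n. g i * (poly P (d i))\<^sup>2 * (b $ i)\<^sup>2)" using c by (simp add: H_def cf)
    then show "\<exists>P. degree P < m \<and> 0 < (\<Sum>i<n. g i * (poly P (d i))\<^sup>2 * (b $ i)\<^sup>2)" using dP by auto
  qed
  have "{b \<in> space (uniform_sphere n). \<exists>c\<in>D. 0 < H b c} = (\<Union>c\<in>D. {b \<in> space (uniform_sphere n). 0 < H b c})" by auto
  also have "\<dots> \<in> sets (uniform_sphere n)"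
  proof -
    have "(\<lambda>b. H b c) \<in> borel_measurable (uniform_sphere n)" for c
      unfolding H_def by (intro borel_measurable_sum borel_measurable_times borel_measurable_const
          borel_measurable_power measurable_sphere_index) auto
    then have "{b \<in> space (uniform_sphere n). 0 < H b c} \<in> sets (uniform_sphere n)" for c by measurable
    then show ?thesis using D(1) by (intro sets.countable_UN') auto
  qed
  finally show ?thesis unfolding ex .
qed simp

lemma unit_sphereD:
  assumes "b \<in> unit_sphere n"
  shows "b \<in> carrier_vec n" "b \<noteq> 0\<^sub>v n" "b \<bullet> b = 1"
  using assms by (auto simp: unit_sphere_def)

lemma measurable_lanczos_cond:
  assumes m: "0 < m"
  shows "(\<lambda>b. lanczos_cond (diagm n d) b m) \<in> borel_measurable (uniform_sphere n)"
proof -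
  have "(\<lambda>b. ritz_max (diagm n d) b m) \<in> borel_measurable (uniform_sphere n)"
    unfolding borel_measurable_iff_greater
  proof
    fix a
    have "{b \<in> space (uniform_sphere n). a < ritz_max (diagm n d) b m}
      = {b \<in> space (uniform_sphere n). \<exists>P. degree P < m \<and> 0 < (\<Sum>i<n. (d i - a) * (poly P (d i))\<^sup>2 * (b $ i)\<^sup>2)}"
      using diagm_ritz_max_greater[OF _ _ m] unit_sphereD unfolding space_uniform_sphere by blast
    then show "{b \<in> space (uniform_sphere n). a < ritz_max (diagm n d) b m} \<in> sets (uniform_sphere n)"
      using sets_exists_poly by simp
  qed
  moreover have "(\<lambda>b. ritz_min (diagm n d) b m) \<in> borel_measurable (uniform_sphere n)"
    unfolding borel_measurable_iff_less
  proof
    fix a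
    have "{b \<in> space (uniform_sphere n). ritz_min (diagm n d) b m < a}
      = {b \<in> space (uniform_sphere n). \<exists>P. degree P < m \<and> 0 < (\<Sum>i<n. (a - d i) * (poly P (d i))\<^sup>2 * (b $ i)\<^sup>2)}"
      using diagm_ritz_min_less[OF _ _ m] unit_sphereD unfolding space_uniform_sphere by blast
    then show "{b \<in> space (uniform_sphere n). ritz_min (diagm n d) b m < a} \<in> sets (uniform_sphere n)"
      using sets_exists_poly by simp
  qed
  ultimately show ?thesis unfolding lanczos_cond_def by (rule borel_measurable_divide)
qed

section \<open>A hard diagonal instance\<close>

text \<open>The diagonal consists of one entry \<open>1\<close> (\<open>x = 0\<close>), of \<open>N\<close> entries \<open>1 + (\<kappa> - 1) y k\<close> for
  every \<open>k < m\<close>, and of entries \<open>\<kappa>\<close>. A Ritz value below \<open>1 + (\<kappa> - 1) \<tau>\<close> would come from a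
  polynomial \<open>R\<close> of degree below \<open>m\<close> with \<open>\<Sum> (x i - \<tau>) R(x i)\<^sup>2 (b i)\<^sup>2 < 0\<close>. Only the term
  \<open>i = 0\<close> is negative, and it is dominated by the clusters, because \<open>R(0)\<^sup>2\<close> is controlled by
  the values \<open>R(y k)\<^sup>2\<close> and \<open>(b 0)\<^sup>2\<close> by the weight of each cluster.\<close>

lemma ritz_min_ge_of_clusters:
  fixes y :: "nat \<Rightarrow> real"
  assumes \<kappa>: "1 \<le> \<kappa>" and n: "N * m + 2 \<le> n" and m: "0 < m"
    and \<tau>: "0 \<le> \<tau>" "\<tau> \<le> t" "t \<le> 1" and y: "\<And>k. t \<le> y k"
    and interp: "\<And>P. degree P < m \<Longrightarrow> (poly P 0)\<^sup>2 \<le> \<Lambda> * (\<Sum>k<m. (poly P (y k))\<^sup>2)"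
    and b: "b \<in> carrier_vec n" "b \<noteq> 0\<^sub>v n"
    and good: "\<And>k. k < m \<Longrightarrow> \<tau> * \<Lambda> * (b $ 0)\<^sup>2 \<le> (t - \<tau>) * (\<Sum>i\<in>{1 + k * N..<1 + Suc k * N}. (b $ i)\<^sup>2)"
  defines "x \<equiv> \<lambda>i. if i = 0 then 0 else if i \<le> N * m then y ((i - 1) div N) else (1 :: real)"
  shows "1 + (\<kappa> - 1) * \<tau> \<le> ritz_min (diagm n (\<lambda>i. 1 + (\<kappa> - 1) * x i)) b m"
proof (rule ccontr)
  let ?d = "\<lambda>i. 1 + (\<kappa> - 1) * x i"
  assume "\<not> ?thesis"
  then have "ritz_min (diagm n ?d) b m < 1 + (\<kappa> - 1) * \<tau>" by simp
  then obtain P where P: "degree P < m"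
    "0 < (\<Sum>i<n. (1 + (\<kappa> - 1) * \<tau> - ?d i) * (poly P (?d i))\<^sup>2 * (b $ i)\<^sup>2)"
    unfolding diagm_ritz_min_less[OF b m] by blast
  define R where "R = P \<circ>\<^sub>p [:1, \<kappa> - 1:]"
  have dR: "degree R < m"
  proof -
    have "degree R \<le> degree P * degree [:1, \<kappa> - 1:]" unfolding R_def by (rule degree_pcompose_le)
    also have "\<dots> \<le> degree P * 1" by (intro mult_left_mono) auto
    finally show ?thesis using P(1) by simp
  qed
  define f where "f i = (x i - \<tau>) * (poly R (x i))\<^sup>2 * (b $ i)\<^sup>2" for i
  define I where "I k = {1 + k * N..<1 + Suc k * N}" for k
  have Rval: "poly P (?d i) = poly R (x i)" for i by (simp add: R_def poly_pcompose mult.commute)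
  have sumf: "(\<Sum>i<n. (1 + (\<kappa> - 1) * \<tau> - ?d i) * (poly P (?d i))\<^sup>2 * (b $ i)\<^sup>2) = - ((\<kappa> - 1) * (\<Sum>i<n. f i))"
    unfolding sum_distrib_left sum_negf[symmetric] f_def Rval
    by (rule sum.cong) (auto simp: algebra_simps)
  have disj: "disjoint_family_on I {..<m}"
  proof -
    have "I j \<inter> I k = {}" if "j < k" for j k
    proof -
      have "Suc j * N \<le> k * N" using that by (intro mult_le_mono1) simp
      then show ?thesis by (auto simp: I_def)
    qed
    then show ?thesis unfolding disjoint_family_on_def by (metis Int_commute linorder_neqE_nat)
  qed
  have I: "I k \<subseteq> {1..N * m}" if "k < m" for k
  proof -
    have "Suc k * N \<le> m * N" using that by (intro mult_le_mono1) simp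
    then show ?thesis by (auto simp: I_def mult.commute)
  qed
  have xI: "x i = y k" if "i \<in> I k" "k < m" for i k
  proof -
    have "k * N \<le> i - 1" "i - 1 < Suc k * N" "1 \<le> i" using that(1) by (auto simp: I_def)
    then have "(i - 1) div N = k" by (metis div_nat_eqI mult.commute)
    then show ?thesis using I[OF that(2)] that(1) by (auto simp: x_def)
  qed
  have "0 \<le> (\<Sum>i<n. f i)"
  proof -
    define U where "U = insert 0 (\<Union>k<m. I k)"
    have U: "U \<subseteq> {..<n}" "finite U" "0 \<notin> (\<Union>k<m. I k)" "finite (\<Union>k<m. I k)"
      using I n by (fastforce simp: U_def I_def)+
    have "(\<Sum>i\<in>U. f i) \<le> (\<Sum>i<n. f i)"
    proof (rule sum_mono2)
      fix i assume "i \<in> {..<n} - U"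
      have "\<tau> \<le> x i" if "i \<noteq> 0" using that y[of "(i - 1) div N"] \<tau> by (auto simp: x_def)
      then show "0 \<le> f i" using \<open>i \<in> {..<n} - U\<close> by (auto simp: f_def U_def)
    qed (use U in auto)
    moreover have "(\<Sum>i\<in>U. f i) = f 0 + (\<Sum>k<m. \<Sum>i\<in>I k. f i)"
    proof -
      have "(\<Sum>i\<in>(\<Union>k<m. I k). f i) = (\<Sum>k<m. \<Sum>i\<in>I k. f i)"
        by (rule sum.UNION_disjoint_family[OF _ _ disj]) (auto simp: I_def)
      then show ?thesis unfolding U_def sum.insert[OF U(4) U(3)] by (simp only:)
    qed
    moreover have "(\<Sum>k<m. (t - \<tau>) * (poly R (y k))\<^sup>2 * (\<Sum>i\<in>I k. (b $ i)\<^sup>2)) \<le> (\<Sum>k<m. \<Sum>i\<in>I k. f i)"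
    proof (rule sum_mono)
      fix k assume k: "k \<in> {..<m}"
      have "(\<Sum>i\<in>I k. f i) = (\<Sum>i\<in>I k. (y k - \<tau>) * (poly R (y k))\<^sup>2 * (b $ i)\<^sup>2)"
        by (rule sum.cong) (use xI k in \<open>auto simp: f_def\<close>)
      also have "\<dots> = (y k - \<tau>) * ((poly R (y k))\<^sup>2 * (\<Sum>i\<in>I k. (b $ i)\<^sup>2))"
        by (simp add: sum_distrib_left mult.assoc)
      finally have "(\<Sum>i\<in>I k. f i) = (y k - \<tau>) * ((poly R (y k))\<^sup>2 * (\<Sum>i\<in>I k. (b $ i)\<^sup>2))" .
      moreover have "(t - \<tau>) * ((poly R (y k))\<^sup>2 * (\<Sum>i\<in>I k. (b $ i)\<^sup>2))
          \<le> (y k - \<tau>) * ((poly R (y k))\<^sup>2 * (\<Sum>i\<in>I k. (b $ i)\<^sup>2))"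
        using y[of k] by (intro mult_right_mono mult_nonneg_nonneg sum_nonneg) auto
      ultimately show "(t - \<tau>) * (poly R (y k))\<^sup>2 * (\<Sum>i\<in>I k. (b $ i)\<^sup>2) \<le> (\<Sum>i\<in>I k. f i)"
        by (simp add: mult.assoc)
    qed
    moreover have "\<tau> * \<Lambda> * (b $ 0)\<^sup>2 * (\<Sum>k<m. (poly R (y k))\<^sup>2)
        \<le> (\<Sum>k<m. (t - \<tau>) * (poly R (y k))\<^sup>2 * (\<Sum>i\<in>I k. (b $ i)\<^sup>2))"
      unfolding sum_distrib_left[of "\<tau> * \<Lambda> * (b $ 0)\<^sup>2"]
    proof (rule sum_mono)
      fix k assume "k \<in> {..<m}"
      then have "(poly R (y k))\<^sup>2 * (\<tau> * \<Lambda> * (b $ 0)\<^sup>2) \<le> (poly R (y k))\<^sup>2 * ((t - \<tau>) * (\<Sum>i\<in>I k. (b $ i)\<^sup>2))"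
        unfolding I_def by (intro mult_left_mono good) auto
      then show "\<tau> * \<Lambda> * (b $ 0)\<^sup>2 * (poly R (y k))\<^sup>2 \<le> (t - \<tau>) * (poly R (y k))\<^sup>2 * (\<Sum>i\<in>I k. (b $ i)\<^sup>2)"
        by (simp add: mult_ac)
    qed
    moreover have "- f 0 \<le> \<tau> * \<Lambda> * (b $ 0)\<^sup>2 * (\<Sum>k<m. (poly R (y k))\<^sup>2)"
    proof -
      have "(\<tau> * (b $ 0)\<^sup>2) * (poly R 0)\<^sup>2 \<le> (\<tau> * (b $ 0)\<^sup>2) * (\<Lambda> * (\<Sum>k<m. (poly R (y k))\<^sup>2))"
        by (rule mult_left_mono[OF interp[OF dR]]) (use \<tau> in simp)
      then show ?thesis by (simp add: f_def x_def mult_ac)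
    qed
    ultimately show ?thesis by linarith
  qed
  then have "0 \<le> (\<kappa> - 1) * (\<Sum>i<n. f i)" using \<kappa> by simp
  then show False using P(2) unfolding sumf by linarith
qed

definition sup_error_prob :: "real \<Rightarrow> nat \<Rightarrow> nat \<Rightarrow> real \<Rightarrow> real" where
  "sup_error_prob \<kappa> n m c = (SUP A \<in> {A \<in> spd_mats n. cond_num A = \<kappa>}.
      measure (uniform_sphere n) {b \<in> space (uniform_sphere n).
        (cond_num A - lanczos_cond A b m) / lanczos_cond A b m \<ge> c})"

text \<open>The nodes of \<open>heavy_nodes\<close> with multiplicity \<open>N\<close> together with a single eigenvalue at the lower end.
  If every cluster has sufficient weight, the smallest Ritz value stays above
  \<open>1 + (\<kappa> - 1) \<tau>\<close>; since the largest one is at most \<open>\<kappa>\<close>, the relative error of the condition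
  number is at least \<open>(\<kappa> - 1) \<tau>\<close>. The probability that some cluster is too light is bounded
  by a union bound over the \<open>m\<close> clusters.\<close>

lemma lanczos_hard_instance:
  assumes \<kappa>: "1 \<le> \<kappa>" and n: "N * m + 2 \<le> n" and m: "0 < m"
    and \<tau>: "0 < \<tau>" "\<tau> < t" "t < 1"
    and \<Lambda>_def: "\<Lambda> = ((1 + sqrt t) / (1 - sqrt t)) ^ (2 * m) / (4 * real m * t)"
    and q_def: "q = (t - \<tau>) / (\<tau> * \<Lambda>)"
  obtains A where "A \<in> spd_mats n" "cond_num A = \<kappa>"
    "\<And>c. c \<le> \<tau> * (\<kappa> - 1) \<Longrightarrow> 1 - real m * (sqrt 2 * (1 / sqrt (1 + q / 2)) ^ N)
      \<le> measure (uniform_sphere n) {b \<in> space (uniform_sphere n).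
          (cond_num A - lanczos_cond A b m) / lanczos_cond A b m \<ge> c}"
proof -
  have t0: "0 < t" using \<tau> by simp
  have n0: "0 < n" using n by simp
  obtain y :: "nat \<Rightarrow> real" where y: "\<And>k. t \<le> y k" "\<And>k. y k \<le> 1"
    "\<And>P. degree P < m \<Longrightarrow> (poly P 0)\<^sup>2 \<le> \<Lambda> * (\<Sum>k<m. (poly P (y k))\<^sup>2)"
    using heavy_nodes[OF t0 \<tau>(3), of m] unfolding \<Lambda>_def by blast
  have \<Lambda>: "0 < \<Lambda>"
  proof -
    have "sqrt t < 1" using \<tau> by (simp add: real_sqrt_lt_1_iff)
    then have "0 < (1 + sqrt t) / (1 - sqrt t)" using t0 by (intro divide_pos_pos add_pos_pos) auto
    then show ?thesis unfolding \<Lambda>_def using m t0 by simp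
  qed
  have q: "0 \<le> q" unfolding q_def using \<tau> \<Lambda> by simp
  define x where "x i = (if i = 0 then 0 else if i \<le> N * m then y ((i - 1) div N) else (1 :: real))" for i
  define d where "d i = 1 + (\<kappa> - 1) * x i" for i
  define A where "A = diagm n d"
  have x01: "0 \<le> x i" "x i \<le> 1" for i using y(1,2)[of "(i - 1) div N"] t0 by (auto simp: x_def)
  have d1: "1 \<le> d i" for i using \<kappa> x01[of i] by (simp add: d_def)
  have d_pos: "0 < d i" for i using d1[of i] by linarith
  have d2: "d i \<le> \<kappa>" for i using mult_left_mono[OF x01(2)[of i], of "\<kappa> - 1"] \<kappa> by (simp add: d_def)
  have A: "A \<in> spd_mats n" unfolding A_def by (rule diagm_spd) (use d1 in \<open>simp add: d_pos\<close>)
  have d0: "d 0 = 1" by (simp add: d_def x_def)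
  have dn: "d (n - 1) = \<kappa>" using n by (auto simp: d_def x_def)
  have "eig_min A = d 0" unfolding A_def by (rule diagm_eig_min) (use n0 d0 d1 in auto)
  then have emin: "eig_min A = 1" using d0 by simp
  have "eig_max A = d (n - 1)" unfolding A_def by (rule diagm_eig_max) (use n0 dn d2 in auto)
  then have emax: "eig_max A = \<kappa>" using dn by simp
  have cond: "cond_num A = \<kappa>" by (simp add: cond_num_def emin emax)
  interpret U: prob_space "uniform_sphere n" by (rule prob_space_uniform_sphere[OF n0])
  define I where "I k = {1 + k * N..<1 + Suc k * N}" for k
  define bad where "bad k = {b \<in> space (uniform_sphere n). q * (\<Sum>i\<in>I k. (b $ i)\<^sup>2) < (b $ 0)\<^sup>2}" for k
  have I: "I k \<subseteq> {..<n}" "0 \<notin> I k" "card (I k) = N" if "k < m" for k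
  proof -
    have "Suc k * N \<le> m * N" using that by (intro mult_le_mono1) simp
    then show "I k \<subseteq> {..<n}" using n by (auto simp: I_def mult.commute)
  qed (auto simp: I_def)
  have bad_sets: "bad k \<in> sets (uniform_sphere n)" if "k < m" for k
    unfolding bad_def by (rule uniform_sphere_cluster_tail(1)[OF n0 I(1,2)[OF that] q])
  have bad_prob: "measure (uniform_sphere n) (bad k) \<le> sqrt 2 * (1 / sqrt (1 + q / 2)) ^ N" if "k < m" for k
    unfolding bad_def using uniform_sphere_cluster_tail(2)[OF n0 I(1,2)[OF that] q] I(3)[OF that] by simp
  have main: "1 - real m * (sqrt 2 * (1 / sqrt (1 + q / 2)) ^ N)
      \<le> measure (uniform_sphere n) {b \<in> space (uniform_sphere n).
          (cond_num A - lanczos_cond A b m) / lanczos_cond A b m \<ge> c}" if c: "c \<le> \<tau> * (\<kappa> - 1)" for c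
  proof -
    define E where "E = {b \<in> space (uniform_sphere n). (cond_num A - lanczos_cond A b m) / lanczos_cond A b m \<ge> c}"
    have E: "E \<in> sets (uniform_sphere n)"
      unfolding E_def A_def using measurable_lanczos_cond[OF m, of n d] by measurable
    have "space (uniform_sphere n) - (\<Union>k<m. bad k) \<subseteq> E"
    proof
      fix b assume b: "b \<in> space (uniform_sphere n) - (\<Union>k<m. bad k)"
      then have bs: "b \<in> unit_sphere n" by (simp add: space_uniform_sphere)
      note bD = unit_sphereD[OF bs]
      have good: "\<tau> * \<Lambda> * (b $ 0)\<^sup>2 \<le> (t - \<tau>) * (\<Sum>i\<in>{1 + k * N..<1 + Suc k * N}. (b $ i)\<^sup>2)" if "k < m" for k
      proof -
        have "(b $ 0)\<^sup>2 \<le> q * (\<Sum>i\<in>I k. (b $ i)\<^sup>2)" using b that by (auto simp: bad_def not_less)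
        then have "\<tau> * \<Lambda> * (b $ 0)\<^sup>2 \<le> \<tau> * \<Lambda> * (q * (\<Sum>i\<in>I k. (b $ i)\<^sup>2))"
          using \<tau> \<Lambda> by (intro mult_left_mono) auto
        also have "\<dots> = (t - \<tau>) * (\<Sum>i\<in>I k. (b $ i)\<^sup>2)" unfolding q_def using \<tau> \<Lambda> by simp
        finally show ?thesis unfolding I_def .
      qed
      have lo: "1 + (\<kappa> - 1) * \<tau> \<le> ritz_min A b m"
      proof -
        have "1 + (\<kappa> - 1) * \<tau> \<le> ritz_min (diagm n (\<lambda>i. 1 + (\<kappa> - 1) * (if i = 0 then 0
            else if i \<le> N * m then y ((i - 1) div N) else 1))) b m"
          by (rule ritz_min_ge_of_clusters[OF \<kappa> n m less_imp_le[OF \<tau>(1)] less_imp_le[OF \<tau>(2)]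
              less_imp_le[OF \<tau>(3)] y(1) y(3) bD(1,2) good])
        then show ?thesis unfolding A_def d_def[abs_def] x_def .
      qed
      note R = ritz_bounds[OF A n0 bD(1,2) m, unfolded emin emax]
      have pos: "0 < ritz_min A b m" "0 < ritz_max A b m" using R by linarith+
      have "(\<kappa> - lanczos_cond A b m) / lanczos_cond A b m = \<kappa> / ritz_max A b m * ritz_min A b m - 1"
        unfolding lanczos_cond_def using pos by (simp add: field_simps)
      moreover have "1 * ritz_min A b m \<le> \<kappa> / ritz_max A b m * ritz_min A b m"
        using R pos by (intro mult_right_mono) (auto simp: le_divide_eq)
      ultimately have "c \<le> (\<kappa> - lanczos_cond A b m) / lanczos_cond A b m"
        using lo c by (simp add: mult.commute)
      then show "b \<in> E" using b by (simp add: E_def cond)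
    qed
    then have "measure (uniform_sphere n) (space (uniform_sphere n) - (\<Union>k<m. bad k)) \<le> measure (uniform_sphere n) E"
      by (rule U.finite_measure_mono[OF _ E])
    moreover have "measure (uniform_sphere n) (space (uniform_sphere n) - (\<Union>k<m. bad k))
        = 1 - measure (uniform_sphere n) (\<Union>k<m. bad k)"
      by (rule U.prob_compl) (use bad_sets in auto)
    moreover have "measure (uniform_sphere n) (\<Union>k<m. bad k) \<le> (\<Sum>k<m. measure (uniform_sphere n) (bad k))"
      by (rule U.finite_measure_subadditive_finite) (use bad_sets in auto)
    moreover have "(\<Sum>k<m. measure (uniform_sphere n) (bad k)) \<le> real m * (sqrt 2 * (1 / sqrt (1 + q / 2)) ^ N)"
      using sum_mono[of "{..<m}" "\<lambda>k. measure (uniform_sphere n) (bad k)" "\<lambda>_. sqrt 2 * (1 / sqrt (1 + q / 2)) ^ N"]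
        bad_prob by simp
    ultimately show ?thesis unfolding E_def by linarith
  qed
  show thesis by (rule that[OF A cond main])
qed

lemma ln_ge_1: 
  assumes "3 \<le> n"
  shows "1 \<le> ln (real n)"
proof -
  have "exp 1 \<le> (3::real)" using exp_le by simp
  also have "\<dots> \<le> real n" using assms by simp
  finally show ?thesis using assms by (subst ln_ge_iff) auto
qed

text \<open>The clusters have \<open>N \<ge> n / (2 m)\<close> elements. The factor \<open>4 m t\<close> in the extrapolation constant
  cancels the \<open>m\<close> in the cluster size, so that the failure probability is governed by
  \<open>n (t - \<tau>) / \<rho>\<close> with \<open>\<rho> = ((1 + \<surd>t) / (1 - \<surd>t))\<^bsup>2m\<^esup>\<close>. The two numerical
  conditions make each cluster fail with probability at most \<open>\<surd>2 / n\<^sup>3\<close>.\<close>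

lemma lanczos_lower_bound:
  assumes \<kappa>: "1 \<le> \<kappa>" and n: "3 \<le> n" and m: "0 < m"
    and \<tau>: "0 < \<tau>" "\<tau> < t" "t < 1"
    and C1: "12 * ((1 + sqrt t) / (1 - sqrt t)) ^ (2 * m) * ln (real n) \<le> real n * (t - \<tau>)"
    and C2: "48 * real m * ln (real n) \<le> real n"
    and c: "c \<le> \<tau> * (\<kappa> - 1)"
  shows "1 - 2 / (real n)\<^sup>2 \<le> sup_error_prob \<kappa> n m c"
proof -
  \<comment> \<open>Two of the \<open>n\<close> eigenvalues are reserved for the ends of the spectrum.\<close>
  define N where "N = (n - 2) div m"
  define \<rho> where "\<rho> = ((1 + sqrt t) / (1 - sqrt t)) ^ (2 * m)"
  define \<Lambda> where "\<Lambda> = \<rho> / (4 * real m * t)"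
  define q where "q = (t - \<tau>) / (\<tau> * \<Lambda>)"
  have n0: "0 < n" using n by simp
  interpret U: prob_space "uniform_sphere n" by (rule prob_space_uniform_sphere[OF n0])
  note ln1 = ln_ge_1[OF n]
  have "48 * real m * 1 \<le> 48 * real m * ln (real n)" by (rule mult_left_mono[OF ln1]) simp
  then have mn: "48 * real m \<le> real n" using C2 by simp
  have Nn: "N * m + 2 \<le> n"
  proof -
    have "N * m \<le> n - 2" by (simp add: N_def)
    then show ?thesis using n by simp
  qed
  have Nlow: "real n \<le> real N * (2 * real m)"
  proof -
    have "n - 2 < m + (n - 2) div m * m" by (rule dividend_less_times_div[OF m, of "n - 2", unfolded mult.commute[of m]]) 
    then have "real (n - 2) < real (m + N * m)" unfolding N_def by (simp only: of_nat_less_iff)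
    then have "real n - 2 < real m + real N * real m" using n by (simp add: of_nat_diff)
    then show ?thesis using mn m by (simp add: algebra_simps)
  qed
  have t0: "0 < t" using \<tau> by simp
  have \<rho>: "0 < \<rho>"
  proof -
    have "sqrt t < 1" using \<tau> by simp
    then have "0 < (1 + sqrt t) / (1 - sqrt t)" using t0 by (intro divide_pos_pos add_pos_pos) auto
    then show ?thesis unfolding \<rho>_def by simp
  qed
  have \<Lambda>: "0 < \<Lambda>" unfolding \<Lambda>_def using \<rho> m t0 by simp
  have q: "0 \<le> q" unfolding q_def using \<tau> \<Lambda> by simp
  \<comment> \<open>The cut-off at \<open>1/2\<close> admits the estimate \<open>exp (y / 2) \<le> 1 + y\<close>.\<close>
  define y where "y = min (q / 2) (1 / 2)"
  have y: "0 \<le> y" "y \<le> q / 2" "y \<le> 1 / 2" using q by (auto simp: y_def)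
  have Ny: "12 * ln (real n) \<le> real N * y"
  proof -
    have "12 * ln (real n) \<le> real N * (1 / 2)"
    proof -
      have "real m * (48 * ln (real n)) \<le> real m * (2 * real N)" using C2 Nlow by (simp add: mult_ac)
      then show ?thesis using m by simp
    qed
    moreover have "12 * ln (real n) \<le> real N * (q / 2)"
    proof -
      have "12 * ln (real n) \<le> real n * (t - \<tau>) / \<rho>"
        using C1 \<rho> unfolding \<rho>_def[symmetric] by (simp add: le_divide_eq mult_ac)
      also have "\<dots> \<le> real n * ((t - \<tau>) / \<rho>) * (t / \<tau>)"
      proof -
        have "real n * ((t - \<tau>) / \<rho>) * 1 \<le> real n * ((t - \<tau>) / \<rho>) * (t / \<tau>)"
          using \<tau> \<rho> by (intro mult_left_mono) (auto simp: le_divide_eq)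
        then show ?thesis by simp
      qed
      also have "\<dots> \<le> real N * (2 * real m) * ((t - \<tau>) / \<rho>) * (t / \<tau>)"
        using Nlow \<tau> \<rho> by (intro mult_right_mono) auto
      also have "\<dots> = real N * (q / 2)"
        unfolding q_def \<Lambda>_def by simp
      finally show ?thesis .
    qed
    ultimately show ?thesis unfolding y_def by (auto simp: min_def)
  qed
  have base: "1 / sqrt (1 + q / 2) \<le> exp (- y / 4)"
  proof -
    have e: "exp (y / 2) \<le> 1 + y / 2 + (y / 2)\<^sup>2" by (rule exp_bound) (use y in auto)
    have "y * y \<le> y * (1 / 2)" by (rule mult_left_mono[OF y(3) y(1)])
    then have "(y / 2)\<^sup>2 \<le> y / 2" using y(1) by (simp add: power2_eq_square)
    then have "exp (y / 2) \<le> 1 + q / 2" using e y by linarith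
    moreover have "exp (y / 2) = (exp (y / 4))\<^sup>2" by (simp flip: exp_of_nat_mult)
    ultimately have "(exp (y / 4))\<^sup>2 \<le> 1 + q / 2" by linarith
    then have "exp (y / 4) \<le> sqrt (1 + q / 2)" by (rule real_le_rsqrt)
    then have "1 / sqrt (1 + q / 2) \<le> 1 / exp (y / 4)" by (rule divide_left_mono) (use q in auto)
    then show ?thesis by (simp add: exp_minus inverse_eq_divide)
  qed
  have "(1 / sqrt (1 + q / 2)) ^ N \<le> exp (- y / 4) ^ N" by (rule power_mono[OF base]) (use q in auto)
  also have "\<dots> = exp (- (real N * y) / 4)" by (simp flip: exp_of_nat_mult)
  also have "\<dots> \<le> exp (- (3 * ln (real n)))" using Ny by simp
  also have "\<dots> = 1 / real n ^ 3"
  proof -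
    have "exp (3 * ln (real n)) = exp (ln (real n)) ^ 3" by (simp flip: exp_of_nat_mult)
    then show ?thesis using n0 by (simp add: exp_minus inverse_eq_divide)
  qed
  finally have pw: "(1 / sqrt (1 + q / 2)) ^ N \<le> 1 / real n ^ 3" .
  have "real m * (sqrt 2 * (1 / sqrt (1 + q / 2)) ^ N) \<le> real n * (2 * (1 / real n ^ 3))"
  proof (intro mult_mono pw)
    show "sqrt 2 \<le> 2" by (rule real_le_lsqrt) auto
  qed (use mn q in auto)
  also have "\<dots> = 2 / (real n)\<^sup>2" using n0 by (simp add: power2_eq_square power3_eq_cube)
  finally have small: "real m * (sqrt 2 * (1 / sqrt (1 + q / 2)) ^ N) \<le> 2 / (real n)\<^sup>2" .
  have A_ex: "\<exists>A. A \<in> spd_mats n \<and> cond_num A = \<kappa> \<and>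
    1 - real m * (sqrt 2 * (1 / sqrt (1 + q / 2)) ^ N)
      \<le> measure (uniform_sphere n) {b \<in> space (uniform_sphere n).
          (cond_num A - lanczos_cond A b m) / lanczos_cond A b m \<ge> c}"
  proof -
    have \<Lambda>': "\<Lambda> = ((1 + sqrt t) / (1 - sqrt t)) ^ (2 * m) / (4 * real m * t)"
      by (simp only: \<Lambda>_def \<rho>_def)
    show ?thesis
      by (rule lanczos_hard_instance[OF \<kappa> Nn m \<tau> \<Lambda>' q_def]) (use c in blast)
  qed
  then obtain A where A: "A \<in> spd_mats n" "cond_num A = \<kappa>"
    "1 - real m * (sqrt 2 * (1 / sqrt (1 + q / 2)) ^ N)
      \<le> measure (uniform_sphere n) {b \<in> space (uniform_sphere n).
          (cond_num A - lanczos_cond A b m) / lanczos_cond A b m \<ge> c}"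
    by blast
  show ?thesis unfolding sup_error_prob_def
  proof (rule cSUP_upper2)
    show "A \<in> {A \<in> spd_mats n. cond_num A = \<kappa>}" using A by simp
    show "1 - 2 / (real n)\<^sup>2 \<le> measure (uniform_sphere n) {b \<in> space (uniform_sphere n).
          (cond_num A - lanczos_cond A b m) / lanczos_cond A b m \<ge> c}" using A(3) small by linarith
  qed (auto intro!: bdd_aboveI2[where M = 1])
qed

lemma error_rate: "(\<lambda>n. real n * (2 / (real n)\<^sup>2)) \<longlonglongrightarrow> 0"
  by real_asymp

section \<open>Lower bounds in probability\<close>

text \<open>Here \<open>t = (1 - \<delta>)\<^sup>2\<close> may tend to \<open>1\<close>: for \<open>\<delta> = 2 exp (- ln n / (4 m))\<close>, which tends to
  \<open>0\<close> because \<open>m = o(ln n)\<close>, the extrapolation factor is at most \<open>(2 / \<delta>)\<^bsup>2m\<^esup> = \<surd>n\<close>.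
  The gap \<open>t - \<tau> = n\<^bsup>-1/4\<^esup>\<close> is small and yet large enough to absorb this factor.\<close>

lemma lower_bound_log_small:
  fixes m :: "nat \<Rightarrow> nat"
  assumes \<kappa>: "1 \<le> \<kappa>" and m0: "\<And>n. 0 < m n" and m: "(\<lambda>n. real (m n)) \<in> o(\<lambda>n. ln (real n))"
  shows "\<exists>(\<epsilon> :: nat \<Rightarrow> real) (\<eta> :: nat \<Rightarrow> real).
    \<epsilon> \<longlonglongrightarrow> 0 \<and> (\<lambda>n. real n * \<eta> n) \<longlonglongrightarrow> 0 \<and>
    (\<forall>\<^sub>F n in sequentially. 1 - \<eta> n \<le> sup_error_prob \<kappa> n (m n) ((1 - \<epsilon> n) * (\<kappa> - 1)))"
proof -
  define \<delta> where "\<delta> n = 2 * exp (- (ln (real n) / (4 * real (m n))))" for n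
  define \<tau> where "\<tau> n = (1 - \<delta> n)\<^sup>2 - real n powr (- 1 / 4)" for n
  have "(\<lambda>n. real (m n) / ln (real n)) \<longlonglongrightarrow> 0" by (rule smalloD_tendsto[OF m])
  moreover have pos: "\<forall>\<^sub>F n in sequentially. 0 < real (m n) / ln (real n)"
    using eventually_ge_at_top[of 3]
  proof eventually_elim
    case (elim n)
    then show ?case using ln_ge_1[of n] m0[of n] by simp
  qed
  ultimately have "LIM n sequentially. inverse (real (m n) / ln (real n)) :> at_top"
    by (rule filterlim_inverse_at_top)
  then have "LIM n sequentially. 1 / 4 * inverse (real (m n) / ln (real n)) :> at_top"
    by (rule filterlim_tendsto_pos_mult_at_top[OF tendsto_const, rotated]) simp
  then have "LIM n sequentially. ln (real n) / (4 * real (m n)) :> at_top"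
    by (simp add: field_simps)
  then have "(\<lambda>n. exp (- (ln (real n) / (4 * real (m n))))) \<longlonglongrightarrow> 0"
    by (intro filterlim_compose[OF exp_at_bot] filterlim_compose[OF filterlim_uminus_at_bot_at_top])
  from tendsto_mult[OF tendsto_const[of 2] this] have \<delta>: "\<delta> \<longlonglongrightarrow> 0" unfolding \<delta>_def by simp
  have np: "(\<lambda>n. real n powr (- 1 / 4)) \<longlonglongrightarrow> 0" by real_asymp
  have "(\<lambda>n. 1 - ((1 - \<delta> n)\<^sup>2 - real n powr (- 1 / 4))) \<longlonglongrightarrow> 1 - ((1 - 0)\<^sup>2 - 0)"
    by (intro tendsto_intros \<delta> np)
  then have eps: "(\<lambda>n. 1 - \<tau> n) \<longlonglongrightarrow> 0" unfolding \<tau>_def by simp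
  have ev1: "\<forall>\<^sub>F n in sequentially. \<delta> n < 1 / 2" by (rule order_tendstoD(2)[OF \<delta>]) simp
  have ev2: "\<forall>\<^sub>F n in sequentially. real n powr (- 1 / 4) < 1 / 4" by (rule order_tendstoD(2)[OF np]) simp
  have ev3: "\<forall>\<^sub>F n in sequentially. 12 * real n powr (1 / 2) * ln (real n) \<le> real n * real n powr (- 1 / 4)"
    by real_asymp
  have "\<forall>\<^sub>F n in sequentially. norm (real (m n)) \<le> 1 * norm (ln (real n))"
    by (rule landau_o.smallD[OF m]) simp
  then have ev4: "\<forall>\<^sub>F n in sequentially. real (m n) \<le> ln (real n)"
    using eventually_ge_at_top[of 3]
  proof eventually_elim
    case (elim n)
    then show ?case using ln_ge_1[of n] by simp
  qed
  have ev5: "\<forall>\<^sub>F n in sequentially. 48 * ln (real n) * ln (real n) \<le> real n" by real_asymp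
  have "\<forall>\<^sub>F n in sequentially. 1 - 2 / (real n)\<^sup>2 \<le> sup_error_prob \<kappa> n (m n) ((1 - (1 - \<tau> n)) * (\<kappa> - 1))"
    using ev1 ev2 ev3 ev4 ev5 eventually_ge_at_top[of 3]
  proof eventually_elim
    case (elim n)
    define r where "r = 1 - \<delta> n"
    have \<delta>0: "0 < \<delta> n" by (simp add: \<delta>_def)
    have r: "1 / 2 < r" "r < 1" using elim(1) \<delta>0 by (auto simp: r_def)
    have st: "sqrt (r\<^sup>2) = r" using r by simp
    have nn: "0 < real n" using elim(6) by simp
    have "0 < real n powr (- 1 / 4)" using nn by simp
    moreover have "1 / 4 < r\<^sup>2" using power_strict_mono[of "1/2" r 2] r by (simp add: power2_eq_square)
    ultimately have \<tau>: "0 < \<tau> n" "\<tau> n < r\<^sup>2" using elim(2) by (auto simp: \<tau>_def r_def)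
    have t1: "r\<^sup>2 < 1" using r by (simp add: power_less_one_iff)
    have "(1 + r) / (1 - r) \<le> 2 / \<delta> n" using r by (simp add: r_def divide_right_mono)
    also have "2 / \<delta> n = exp (ln (real n) / (4 * real (m n)))" by (simp add: \<delta>_def exp_minus inverse_eq_divide)
    finally have "((1 + r) / (1 - r)) ^ (2 * m n) \<le> exp (ln (real n) / (4 * real (m n))) ^ (2 * m n)"
      using r by (intro power_mono) auto
    also have "\<dots> = exp (1 / 2 * ln (real n))"
      using m0[of n] by (simp flip: exp_of_nat_mult)
    also have "\<dots> = real n powr (1 / 2)" using nn by (simp add: powr_def)
    finally have \<rho>: "((1 + r) / (1 - r)) ^ (2 * m n) \<le> real n powr (1 / 2)" .
    show ?case
    proof (rule lanczos_lower_bound[OF \<kappa> elim(6) m0 \<tau> t1])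
      have "12 * ((1 + r) / (1 - r)) ^ (2 * m n) * ln (real n) \<le> 12 * real n powr (1 / 2) * ln (real n)"
        using \<rho> ln_ge_1[OF elim(6)] by (intro mult_right_mono mult_left_mono) auto
      also note elim(3)
      also have "real n * real n powr (- 1 / 4) = real n * (r\<^sup>2 - \<tau> n)" by (simp add: \<tau>_def r_def)
      finally show "12 * ((1 + sqrt (r\<^sup>2)) / (1 - sqrt (r\<^sup>2))) ^ (2 * m n) * ln (real n) \<le> real n * (r\<^sup>2 - \<tau> n)"
        unfolding st .
      have "48 * real (m n) * ln (real n) \<le> 48 * ln (real n) * ln (real n)"
        using elim(4) ln_ge_1[OF elim(6)] by (intro mult_right_mono mult_left_mono) auto
      then show "48 * real (m n) * ln (real n) \<le> real n" using elim(5) by linarith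
    qed simp
  qed
  then show ?thesis using eps error_rate
    by (intro exI[of _ "\<lambda>n. 1 - \<tau> n"] exI[of _ "\<lambda>n. 2 / (real n)\<^sup>2"]) simp
qed

text \<open>If \<open>m \<le> K ln n\<close>, a constant \<open>t = r\<^sup>2\<close> with \<open>(1 + r) / (1 - r) = exp (1 / (4 K))\<close> keeps the
  extrapolation factor below \<open>\<surd>n\<close>. The error is thus bounded below by a positive constant
  times \<open>\<kappa> - 1\<close>, whereas \<open>(ln n / m)\<^sup>2\<close> is bounded and is divided by \<open>(ln (ln n))\<^sup>2\<close>.\<close>

lemma lower_bound_log:
  fixes m :: "nat \<Rightarrow> nat"
  assumes \<kappa>: "1 \<le> \<kappa>" and m0: "\<And>n. 0 < m n" and m: "(\<lambda>n. real (m n)) \<in> \<Theta>(\<lambda>n. ln (real n))"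
  shows "\<exists>\<eta> :: nat \<Rightarrow> real. (\<lambda>n. real n * \<eta> n) \<longlonglongrightarrow> 0 \<and>
    (\<forall>\<^sub>F n in sequentially. 1 - \<eta> n \<le> sup_error_prob \<kappa> n (m n) (0.015 * ((\<kappa> - 1) * (ln (real n))\<^sup>2 / ((real (m n))\<^sup>2 * (ln (ln (real n)))\<^sup>2))))"
proof -
  obtain K where K: "0 < K" "\<forall>\<^sub>F n in sequentially. norm (real (m n)) \<le> K * norm (ln (real n))"
    using landau_o.bigE[OF bigthetaD1[OF m]] by blast
  obtain k where k: "0 < k" "\<forall>\<^sub>F n in sequentially. norm (real (m n)) \<ge> k * norm (ln (real n))"
    using landau_omega.bigE[OF bigthetaD2[OF m]] by blast
  define e where "e = exp (1 / (4 * K))"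
  have e: "1 < e" using K by (simp add: e_def)
  define r where "r = (e - 1) / (e + 1)"
  have r: "0 < r" "r < 1" using e by (auto simp: r_def)
  have "1 + r = 2 * e / (e + 1)" "1 - r = 2 / (e + 1)" using e by (auto simp: r_def divide_simps)
  then have re: "(1 + r) / (1 - r) = e" using e by simp
  have st: "sqrt (r\<^sup>2) = r" using r by simp
  have \<tau>: "0 < r\<^sup>2 / 2" "r\<^sup>2 / 2 < r\<^sup>2" "r\<^sup>2 < 1" using r by (auto simp: power_less_one_iff)
  define s where "s = 0.015 / (k\<^sup>2 * (r\<^sup>2 / 2))"
  have "(\<lambda>n::nat. 12 * real n powr (1 / 2) * ln (real n) / real n) \<longlonglongrightarrow> 0" by real_asymp
  then have ev1: "\<forall>\<^sub>F n in sequentially. 12 * real n powr (1 / 2) * ln (real n) / real n < r\<^sup>2 / 2"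
    by (rule order_tendstoD(2)) (rule \<tau>(1))
  have "(\<lambda>n::nat. 48 * K * (ln (real n) * ln (real n) / real n)) \<longlonglongrightarrow> 48 * K * 0"
    by (intro tendsto_mult tendsto_const) real_asymp
  then have ev2: "\<forall>\<^sub>F n in sequentially. 48 * K * (ln (real n) * ln (real n) / real n) < 1"
    by (intro order_tendstoD(2)) auto
  have "LIM n sequentially. (ln (ln (real n)))\<^sup>2 :> at_top" by real_asymp
  then have ev3: "\<forall>\<^sub>F n in sequentially. s \<le> (ln (ln (real n)))\<^sup>2" by (simp add: filterlim_at_top)
  have ev4: "\<forall>\<^sub>F n in sequentially. 0 < (ln (ln (real n)))\<^sup>2" by real_asymp
  have "\<forall>\<^sub>F n in sequentially. 1 - 2 / (real n)\<^sup>2 \<le> sup_error_prob \<kappa> n (m n) (0.015 * ((\<kappa> - 1) * (ln (real n))\<^sup>2 / ((real (m n))\<^sup>2 * (ln (ln (real n)))\<^sup>2)))"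
    using ev1 ev2 ev3 ev4 K(2) k(2) eventually_ge_at_top[of 3]
  proof eventually_elim
    case (elim n)
    have nn: "0 < real n" using elim(7) by simp
    note L = ln_ge_1[OF elim(7)]
    have mK: "real (m n) \<le> K * ln (real n)" and mk: "k * ln (real n) \<le> real (m n)"
      using elim(5,6) L by auto
    have "e ^ (2 * m n) = exp (real (m n) / (2 * K))"
      by (simp add: e_def flip: exp_of_nat_mult)
    also have "\<dots> \<le> exp (1 / 2 * ln (real n))" using mK K(1) by (simp add: divide_le_eq mult_ac)
    also have "\<dots> = real n powr (1 / 2)" using nn by (simp add: powr_def)
    finally have \<rho>: "((1 + r) / (1 - r)) ^ (2 * m n) \<le> real n powr (1 / 2)" unfolding re .
    show ?case
    proof (rule lanczos_lower_bound[OF \<kappa> elim(7) m0 \<tau>])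
      have "12 * ((1 + r) / (1 - r)) ^ (2 * m n) * ln (real n) \<le> 12 * real n powr (1 / 2) * ln (real n)"
        using \<rho> L by (intro mult_right_mono mult_left_mono) auto
      also have "\<dots> \<le> real n * (r\<^sup>2 / 2)" using elim(1) nn by (simp add: divide_less_eq mult_ac)
      finally show "12 * ((1 + sqrt (r\<^sup>2)) / (1 - sqrt (r\<^sup>2))) ^ (2 * m n) * ln (real n) \<le> real n * (r\<^sup>2 - r\<^sup>2 / 2)"
        unfolding st by simp
      have "48 * real (m n) * ln (real n) \<le> 48 * (K * ln (real n)) * ln (real n)"
        using mK L by (intro mult_right_mono mult_left_mono) auto
      also have "\<dots> \<le> real n" using elim(2) nn by (simp add: divide_less_eq mult_ac)
      finally show "48 * real (m n) * ln (real n) \<le> real n" .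
      define l where "l = (ln (ln (real n)))\<^sup>2"
      have mk2: "k\<^sup>2 * (ln (real n))\<^sup>2 \<le> (real (m n))\<^sup>2"
        using power_mono[OF mk, of 2] k(1) L by (simp add: power_mult_distrib)
      have "0.015 * (ln (real n))\<^sup>2 \<le> (r\<^sup>2 / 2) * ((real (m n))\<^sup>2 * l)"
      proof -
        have "0.015 \<le> k\<^sup>2 * (r\<^sup>2 / 2) * l"
          using elim(3) k(1) \<tau>(1) unfolding s_def l_def[symmetric] by (simp add: divide_le_eq mult_ac)
        then have "0.015 * (ln (real n))\<^sup>2 \<le> (k\<^sup>2 * (r\<^sup>2 / 2) * l) * (ln (real n))\<^sup>2"
          by (rule mult_right_mono) simp
        also have "\<dots> = (r\<^sup>2 / 2 * l) * (k\<^sup>2 * (ln (real n))\<^sup>2)" by (simp add: mult_ac)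
        also have "\<dots> \<le> (r\<^sup>2 / 2 * l) * (real (m n))\<^sup>2"
          using mk2 by (rule mult_left_mono) (simp add: l_def)
        finally show ?thesis by (simp add: mult_ac)
      qed
      moreover have ml: "0 < (real (m n))\<^sup>2 * l" using elim(4) m0[of n] by (simp add: l_def)
      ultimately have "0.015 * (ln (real n))\<^sup>2 / ((real (m n))\<^sup>2 * l) \<le> r\<^sup>2 / 2"
        by (simp only: divide_le_eq if_True)
      then have "0.015 * (ln (real n))\<^sup>2 / ((real (m n))\<^sup>2 * l) * (\<kappa> - 1) \<le> r\<^sup>2 / 2 * (\<kappa> - 1)"
        using \<kappa> by (intro mult_right_mono) auto
      then show "0.015 * ((\<kappa> - 1) * (ln (real n))\<^sup>2 / ((real (m n))\<^sup>2 * (ln (ln (real n)))\<^sup>2)) \<le> r\<^sup>2 / 2 * (\<kappa> - 1)"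
        unfolding l_def[symmetric] by (simp add: mult_ac)
    qed
  qed
  then show ?thesis using error_rate by (intro exI[of _ "\<lambda>n. 2 / (real n)\<^sup>2"]) simp
qed

text \<open>For \<open>t = 1.2 / m\<^sup>2\<close> the extrapolation factor is bounded by \<open>exp (8 \<surd>1.2) \<le> exp 9\<close>, and the
  gap \<open>t - \<tau> = 0.12 / m\<^sup>2\<close> turns the condition on \<open>n\<close> into \<open>C m\<^sup>2 ln n \<le> n\<close> with a constant
  \<open>C\<close>, and \<open>m = o(\<surd>(n / ln n))\<close> ensures this for large \<open>n\<close>.\<close>

lemma lower_bound_polynomial:
  fixes m :: "nat \<Rightarrow> nat"
  assumes \<kappa>: "1 \<le> \<kappa>" and m0: "\<And>n. 0 < m n"
    and m: "(\<lambda>n. real (m n)) \<in> o(\<lambda>n. real n powr (1/2) * ln (real n) powr (-1/2))"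
    and m\<omega>: "(\<lambda>n. real (m n)) \<in> \<omega>(\<lambda>n. 1)"
  shows "\<exists>\<eta> :: nat \<Rightarrow> real. (\<lambda>n. real n * \<eta> n) \<longlonglongrightarrow> 0 \<and>
    (\<forall>\<^sub>F n in sequentially. 1 - \<eta> n \<le> sup_error_prob \<kappa> n (m n) (1.08 * ((\<kappa> - 1) / (real (m n))\<^sup>2)))"
proof -
  \<comment> \<open>The value \<open>12 exp 9 / 0.12\<close>: with the bound \<open>exp 9\<close> for the extrapolation factor, the first numerical condition reads \<open>12 exp 9 ln n \<le> 0.12 n / m\<^sup>2\<close>.\<close>
  define C where "C = 100 * exp (9::real)"
  have C: "100 \<le> C" unfolding C_def by simp
  have ev1: "\<forall>\<^sub>F n in sequentially. norm (real (m n)) \<le> 1 / sqrt C * norm (real n powr (1/2) * ln (real n) powr (-1/2))"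
    using C by (intro landau_o.smallD[OF m]) auto
  have ev2: "\<forall>\<^sub>F n in sequentially. norm (real (m n)) \<ge> 3 * norm (1::real)"
    by (rule landau_omega.smallD[OF m\<omega>]) simp
  have "\<forall>\<^sub>F n in sequentially. 1 - 2 / (real n)\<^sup>2 \<le> sup_error_prob \<kappa> n (m n) (1.08 * ((\<kappa> - 1) / (real (m n))\<^sup>2))"
    using ev1 ev2 eventually_ge_at_top[of 3]
  proof eventually_elim
    case (elim n)
    define \<mu> where "\<mu> = real (m n)"
    have \<mu>: "3 \<le> \<mu>" using elim(2) by (simp add: \<mu>_def)
    have nn: "0 < real n" using elim(3) by simp
    note L = ln_ge_1[OF elim(3)]
    define r where "r = sqrt 1.2 / \<mu>"
    have s12: "sqrt 1.2 \<le> 1.1" by (rule real_le_lsqrt) (auto simp: power2_eq_square)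
    have r2: "r\<^sup>2 = 1.2 / \<mu>\<^sup>2" by (simp add: r_def power_divide)
    have rmu: "r * \<mu> \<le> 1.1" using s12 \<mu> by (simp add: r_def)
    have r0: "0 < r" using \<mu> by (simp add: r_def)
    have "r \<le> 1.1 / 3" unfolding r_def using s12 \<mu> by (intro frac_le) auto
    then have r: "r \<le> 1 / 2" by simp
    have st: "sqrt (r\<^sup>2) = r" using r0 by simp
    have muC: "C * \<mu>\<^sup>2 * ln (real n) \<le> real n"
    proof -
      have "\<mu>\<^sup>2 \<le> (1 / sqrt C * (real n powr (1/2) * ln (real n) powr (-1/2)))\<^sup>2"
        using elim(1) \<mu> unfolding \<mu>_def[symmetric] by (intro power_mono) auto
      also have "\<dots> = 1 / C * (real n * (1 / ln (real n)))"
      proof -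
        have "(real n powr (1/2))\<^sup>2 = real n" using nn by (simp add: power2_eq_square flip: powr_add)
        moreover have "(ln (real n) powr (-1/2))\<^sup>2 = 1 / ln (real n)"
          using L by (simp add: power2_eq_square powr_minus_divide flip: powr_add)
        ultimately show ?thesis using C by (simp add: power_mult_distrib power_divide)
      qed
      finally show ?thesis using C L by (simp add: field_simps)
    qed
    have "(1 + r) / (1 - r) \<le> 1 + 4 * r"
    proof -
      have "r * r \<le> r * (1 / 2)" using r r0 by (intro mult_left_mono) auto
      then have "1 + r \<le> (1 + 4 * r) * (1 - r)" by (simp add: algebra_simps)
      then show ?thesis using r by (simp add: divide_le_eq)
    qed
    also have "\<dots> \<le> exp (4 * r)" by (rule exp_ge_add_one_self)
    finally have "((1 + r) / (1 - r)) ^ (2 * m n) \<le> exp (4 * r) ^ (2 * m n)"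
      using r r0 by (intro power_mono) auto
    also have "\<dots> = exp (8 * (r * \<mu>))" by (simp add: \<mu>_def mult_ac flip: exp_of_nat_mult)
    also have "\<dots> \<le> exp 9" using rmu by simp
    finally have \<rho>: "((1 + r) / (1 - r)) ^ (2 * m n) \<le> exp 9" .
    have mu2: "0 < \<mu>\<^sup>2" using \<mu> by simp
    have \<tau>: "0 < 1.08 / \<mu>\<^sup>2" "1.08 / \<mu>\<^sup>2 < r\<^sup>2" "r\<^sup>2 < 1"
    proof -
      show "0 < 1.08 / \<mu>\<^sup>2" using mu2 by simp
      show "1.08 / \<mu>\<^sup>2 < r\<^sup>2" unfolding r2 by (rule divide_strict_right_mono[OF _ mu2]) simp
      show "r\<^sup>2 < 1" using r r0 by (simp add: power_less_one_iff)
    qed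
    show ?case
    proof (rule lanczos_lower_bound[OF \<kappa> elim(3) m0 \<tau>])
      have "12 * ((1 + r) / (1 - r)) ^ (2 * m n) * ln (real n) \<le> 12 * exp 9 * ln (real n)"
        using \<rho> L by (intro mult_right_mono mult_left_mono) auto
      also have "\<dots> \<le> real n * (0.12 / \<mu>\<^sup>2)"
        using muC mu2 by (simp add: C_def le_divide_eq mult_ac)
      also have "0.12 / \<mu>\<^sup>2 = r\<^sup>2 - 1.08 / \<mu>\<^sup>2"
        unfolding r2 by (simp flip: diff_divide_distrib)
      finally show "12 * ((1 + sqrt (r\<^sup>2)) / (1 - sqrt (r\<^sup>2))) ^ (2 * m n) * ln (real n)
          \<le> real n * (r\<^sup>2 - 1.08 / \<mu>\<^sup>2)" unfolding st .
      have "48 * real (m n) * ln (real n) \<le> C * \<mu>\<^sup>2 * ln (real n)"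
      proof (rule mult_right_mono)
        have "\<mu> * 1 \<le> \<mu> * \<mu>" using \<mu> by (intro mult_left_mono) auto
        then have "48 * \<mu> \<le> C * \<mu>\<^sup>2" using C \<mu>
          by (intro mult_mono) (auto simp: power2_eq_square)
        then show "48 * real (m n) \<le> C * \<mu>\<^sup>2" by (simp add: \<mu>_def)
      qed (use L in simp)
      then show "48 * real (m n) * ln (real n) \<le> real n" using muC by linarith
      show "1.08 * ((\<kappa> - 1) / (real (m n))\<^sup>2) \<le> 1.08 / \<mu>\<^sup>2 * (\<kappa> - 1)" by (simp add: \<mu>_def)
    qed
  qed
  then show ?thesis using error_rate by (intro exI[of _ "\<lambda>n. 2 / (real n)\<^sup>2"]) simp
qed

section \<open>An upper bound for the moments\<close>

text \<open>The function \<open>ln ((1 + x) / (1 - x)) - 2 x\<close> vanishes at \<open>0\<close> and has the derivative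
  \<open>2 x\<^sup>2 / (1 - x\<^sup>2)\<close>.\<close>

lemma exp_double_le_ratio:
  fixes r :: real
  assumes "0 \<le> r" "r < 1"
  shows "exp (2 * r) \<le> (1 + r) / (1 - r)"
proof -
  define g where "g x = ln (1 + x) - ln (1 - x) - 2 * x" for x :: real
  have "g 0 \<le> g r"
  proof (rule DERIV_nonneg_imp_nondecreasing[OF assms(1)])
    fix x assume x: "0 \<le> x" "x \<le> r"
    have "(g has_real_derivative (1 / (1 + x) + 1 / (1 - x) - 2)) (at x)"
      unfolding g_def using x assms by (auto intro!: derivative_eq_intros)
    moreover have "1 / (1 + x) + 1 / (1 - x) - 2 = 2 * x\<^sup>2 / ((1 + x) * (1 - x))"
      using x assms by (simp add: divide_simps) (simp add: algebra_simps power2_eq_square)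
    moreover have "0 \<le> 2 * x\<^sup>2 / ((1 + x) * (1 - x))" using x assms by simp
    ultimately show "\<exists>y. (g has_real_derivative y) (at x) \<and> 0 \<le> y" by metis
  qed
  then have "2 * r \<le> ln ((1 + r) / (1 - r))" using assms by (simp add: g_def ln_div)
  then have "exp (2 * r) \<le> exp (ln ((1 + r) / (1 - r)))" by simp
  then show ?thesis using assms by simp
qed

text \<open>In place of the triangle inequality for the \<open>p\<close>-norm, this is enough to split the moment
  into a bounded part and a rare event.\<close>

lemma powr_superadditive:
  fixes a c p :: real
  assumes "0 \<le> a" "0 \<le> c" "1 \<le> p"
  shows "a powr p + c powr p \<le> (a + c) powr p"
proof -
  have e: "x powr p = x * x powr (p - 1)" if "0 \<le> x" for x
    using powr_mult_base[OF that, of "p - 1"] by simp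
  have "a * a powr (p - 1) \<le> a * (a + c) powr (p - 1)" "c * c powr (p - 1) \<le> c * (a + c) powr (p - 1)"
    using assms by (auto intro!: mult_left_mono powr_mono2)
  then have "a powr p + c powr p \<le> (a + c) * (a + c) powr (p - 1)"
    using assms by (simp add: e distrib_right)
  then show ?thesis using assms by (simp add: e)
qed

text \<open>With \<open>M = m - 1\<close> and \<open>L = ln (n M\<^bsup>8p\<^esup>)\<close>, the choice \<open>r = L / (4 M)\<close> makes the amplification
  factor at least \<open>exp L = n M\<^bsup>8p\<^esup>\<close> and contributes the main term \<open>r\<^sup>2 = L\<^sup>2 / (16 M\<^sup>2)\<close>. If both
  extremal eigenvectors have a component of at least \<open>\<theta> = M\<^bsup>-3p\<^esup> / \<surd>n\<close> in \<open>b\<close>, the second term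
  of the error is at most \<open>M\<^bsup>-2p\<^esup> \<le> 1 / M\<^sup>2\<close>; otherwise the error is at most \<open>1\<close>, on an event of
  probability at most \<open>6 M\<^bsup>-3p\<^esup>\<close>. Both corrections are absorbed in the difference between
  \<open>1/16 = 0.0625\<close> and \<open>0.068\<close>, because \<open>L \<ge> 20\<close>. For \<open>r \<ge> 1\<close> the bound exceeds \<open>1\<close>, which
  the relative error never does.\<close>

lemma lanczos_moment_bound:
  assumes A: "A \<in> spd_mats n" and n: "100 \<le> n" and m: "10 \<le> m" and p: "1 \<le> p"
  shows "(\<integral>b. ((cond_num A - lanczos_cond A b m) / cond_num A) powr p \<partial>uniform_sphere n) powr (1 / p)
      \<le> 0.068 * (cond_num A + 1) * ((ln (real n * (real m - 1) powr (8 * p)))\<^sup>2 / (real m - 1)\<^sup>2)"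
proof -
  define M where "M = real m - 1"
  define L where "L = ln (real n * M powr (8 * p))"
  define r where "r = L / (4 * M)"
  define \<kappa> where "\<kappa> = cond_num A"
  define f where "f b = (cond_num A - lanczos_cond A b m) / cond_num A" for b
  obtain k where k: "m = Suc k" using m by (cases m) auto
  have Mk: "M = real k" by (simp add: M_def k)
  have n0: "0 < n" and m0: "0 < m" using n m by auto
  interpret U: prob_space "uniform_sphere n" by (rule prob_space_uniform_sphere[OF n0])
  have M: "9 \<le> M" using m by (simp add: M_def)
  have Leq: "L = ln (real n) + 8 * p * ln M" unfolding L_def using n0 M by (subst ln_mult) (auto simp: ln_powr)
  have L: "20 \<le> L"
  proof -
    have "exp 4 = exp (1::real) ^ 4" by (simp flip: exp_of_nat_mult)
    also have "\<dots> \<le> 3 ^ 4" by (rule power_mono[OF exp_le]) simp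
    also have "\<dots> \<le> real n" using n by simp
    finally have 1: "4 \<le> ln (real n)" using n0 by (subst ln_ge_iff) auto
    have "exp 2 = exp (1::real) ^ 2" by (simp flip: exp_of_nat_mult)
    also have "\<dots> \<le> 3 ^ 2" by (rule power_mono[OF exp_le]) simp
    also have "\<dots> \<le> M" using M by simp
    finally have 2: "2 \<le> ln M" using M by (subst ln_ge_iff) auto
    have "8 * 2 \<le> 8 * p * ln M" using p 2 by (intro mult_mono) auto
    then show ?thesis unfolding Leq using 1 by linarith
  qed
  have bD: "b \<in> carrier_vec n" "b \<noteq> 0\<^sub>v n" "b \<bullet> b = 1" if "b \<in> space (uniform_sphere n)" for b
    using unit_sphereD that unfolding space_uniform_sphere by auto
  have f01: "0 \<le> f b" "f b \<le> 1" if "b \<in> space (uniform_sphere n)" for b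
    unfolding f_def using lanczos_relative_error_range[OF A n0 bD(1,2)[OF that] m0] by auto
  have \<kappa>: "1 \<le> \<kappa>"
  proof -
    obtain b where b: "b \<in> space (uniform_sphere n)" using U.not_empty by blast
    note R = ritz_bounds[OF A n0 bD(1,2)[OF b] m0]
    have "eig_min A \<le> eig_max A" "0 < eig_min A" using R spd_extremal_eigenvalues(5)[OF A n0] by linarith+
    then show ?thesis unfolding \<kappa>_def cond_num_def by simp
  qed
  have int0: "0 \<le> (\<integral>b. f b powr p \<partial>uniform_sphere n)" by (rule Bochner_Integration.integral_nonneg) simp
  have target: "(\<integral>b. f b powr p \<partial>uniform_sphere n) powr (1 / p) \<le> 0.068 * (\<kappa> + 1) * (L\<^sup>2 / M\<^sup>2)"
  proof (cases "r < 1")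
    case False
    have "(\<integral>b. f b powr p \<partial>uniform_sphere n) \<le> (\<integral>b. 1 \<partial>uniform_sphere n)"
    proof (rule integral_mono')
      show "f b powr p \<le> 1" if "b \<in> space (uniform_sphere n)" for b
        using powr_mono2[of p "f b" 1] f01[OF that] p by simp
    qed simp_all
    then have "(\<integral>b. f b powr p \<partial>uniform_sphere n) powr (1 / p) \<le> 1 powr (1 / p)"
      using int0 p by (intro powr_mono2) (auto simp: U.prob_space)
    also have "\<dots> \<le> 0.068 * 2 * 16" by simp
    finally have 1: "(\<integral>b. f b powr p \<partial>uniform_sphere n) powr (1 / p) \<le> 0.068 * 2 * 16" .
    have "4 * M \<le> L" using False M unfolding r_def by (simp add: not_less le_divide_eq)
    then have "(4 * M)\<^sup>2 \<le> L\<^sup>2" using M by (intro power_mono) auto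
    then have "16 \<le> L\<^sup>2 / M\<^sup>2" using M by (simp add: le_divide_eq power_mult_distrib)
    then have "0.068 * 2 * 16 \<le> 0.068 * (\<kappa> + 1) * (L\<^sup>2 / M\<^sup>2)" using \<kappa> by (intro mult_mono) auto
    with 1 show ?thesis by (rule order_trans)
  next
    case True
    have r: "0 \<le> r" "r < 1" using L M True by (auto simp: r_def)
    obtain u w where uw: "u \<in> carrier_vec n" "u \<bullet> u = 1" "A *\<^sub>v u = eig_min A \<cdot>\<^sub>v u"
      "w \<in> carrier_vec n" "w \<bullet> w = 1" "A *\<^sub>v w = eig_max A \<cdot>\<^sub>v w"
      using spd_extremal_eigenvalues(1,2)[OF A n0] by auto
    \<comment> \<open>The threshold balances the two corrections: \<open>\<theta>\<^sup>2\<close> still leaves a factor \<open>M\<^bsup>2p\<^esup>\<close> of the amplification.\<close>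
    define \<theta> where "\<theta> = M powr (- 3 * p) / sqrt (real n)"
    have \<theta>: "0 < \<theta>" using M n0 by (simp add: \<theta>_def)
    define Bu where "Bu = {b \<in> space (uniform_sphere n). (u \<bullet> b)\<^sup>2 < \<theta>\<^sup>2}"
    define Bw where "Bw = {b \<in> space (uniform_sphere n). (w \<bullet> b)\<^sup>2 < \<theta>\<^sup>2}"
    have sets: "Bu \<in> sets (uniform_sphere n)" "Bw \<in> sets (uniform_sphere n)"
      unfolding Bu_def Bw_def using uniform_sphere_slab(1)[OF n] uw \<theta> by auto
    have "measure (uniform_sphere n) (Bu \<union> Bw) \<le> measure (uniform_sphere n) Bu + measure (uniform_sphere n) Bw"
      by (rule measure_Un_le[OF sets])
    also have "\<dots> \<le> 3 * \<theta> * sqrt (real n) + 3 * \<theta> * sqrt (real n)"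
      unfolding Bu_def Bw_def using uniform_sphere_slab(2)[OF n] uw \<theta> by (intro add_mono) auto
    also have "\<dots> = 6 * M powr (- 3 * p)" using n0 by (simp add: \<theta>_def)
    also have "\<dots> \<le> (6 / M ^ 3) powr p"
    proof -
      have "6 * M powr (- 3 * p) \<le> 6 powr p * M powr (- 3 * p)"
        using powr_mono[of 1 p "6::real"] p by (intro mult_right_mono) auto
      also have "\<dots> = (6 / M ^ 3) powr p"
      proof -
        have "M ^ 3 = M powr 3" using M by simp
        then have "(M ^ 3) powr p = M powr (3 * p)" by (simp only: powr_powr)
        moreover have "M powr (- 3 * p) = 1 / M powr (3 * p)" using powr_minus_divide[of M "3 * p"] by simp
        ultimately show ?thesis using M by (simp add: powr_divide)
      qed
      finally show ?thesis .
    qed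
    finally have bad: "measure (uniform_sphere n) (Bu \<union> Bw) \<le> (6 / M ^ 3) powr p" .
    define \<rho> where "\<rho> = ((1 + r) / (1 - r)) ^ (2 * k)"
    have "exp (2 * r) ^ (2 * k) \<le> \<rho>" unfolding \<rho>_def by (rule power_mono[OF exp_double_le_ratio[OF r]]) simp
    also have "exp (2 * r) ^ (2 * k) = exp L"
      using M by (simp add: r_def Mk flip: exp_of_nat_mult)
    also have "exp L = real n * M powr (8 * p)" unfolding L_def using n0 M by simp
    finally have \<rho>: "real n * M powr (8 * p) \<le> \<rho>" .
    have "M\<^sup>2 \<le> \<rho> * \<theta>\<^sup>2"
    proof -
      have "M\<^sup>2 = M powr 2" using M by simp
      also have "\<dots> \<le> M powr (2 * p)" using M p by (intro powr_mono) auto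
      also have "\<dots> = M powr (8 * p) * (M powr (- 3 * p))\<^sup>2"
        by (simp add: power2_eq_square flip: powr_add)
      also have "\<dots> = (real n * M powr (8 * p)) * \<theta>\<^sup>2" using n0 by (simp add: \<theta>_def power_divide)
      also have "\<dots> \<le> \<rho> * \<theta>\<^sup>2" by (rule mult_right_mono[OF \<rho>]) simp
      finally show ?thesis .
    qed
    moreover have "0 < M\<^sup>2" using M by simp
    ultimately have e: "1 / (\<rho> * \<theta>\<^sup>2) \<le> 1 / M\<^sup>2" by (rule frac_le[OF zero_le_one order_refl, rotated])
    define V where "V = (\<kappa> + 1) * (r\<^sup>2 + 1 / M\<^sup>2)"
    have V: "0 \<le> V" unfolding V_def using \<kappa> by simp
    have good: "f b \<le> V" if b: "b \<in> space (uniform_sphere n)" "b \<notin> Bu \<union> Bw" for b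
    proof -
      have "\<theta>\<^sup>2 \<le> (u \<bullet> b)\<^sup>2" "\<theta>\<^sup>2 \<le> (w \<bullet> b)\<^sup>2" using b by (auto simp: Bu_def Bw_def)
      then have "f b \<le> (\<kappa> + 1) * (r\<^sup>2 + 1 / (\<rho> * \<theta>\<^sup>2))"
        unfolding f_def \<kappa>_def \<rho>_def k
        by (intro lanczos_relative_error_le[OF A n0 bD(1,3)[OF b(1)] uw r \<theta>])
      also have "\<dots> \<le> V" unfolding V_def using e \<kappa> by (intro mult_left_mono) auto
      finally show ?thesis .
    qed
    have ind: "integrable (uniform_sphere n) (indicator (Bu \<union> Bw) :: _ \<Rightarrow> real)"
      using sets by (intro integrable_real_indicator) (auto simp: U.emeasure_eq_measure)
    have "(\<integral>b. f b powr p \<partial>uniform_sphere n) \<le> (\<integral>b. V powr p + indicator (Bu \<union> Bw) b \<partial>uniform_sphere n)"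
    proof (rule integral_mono')
      show "integrable (uniform_sphere n) (\<lambda>b. V powr p + indicator (Bu \<union> Bw) b)"
        by (intro Bochner_Integration.integrable_add ind) simp
      fix b assume b: "b \<in> space (uniform_sphere n)"
      show "f b powr p \<le> V powr p + indicator (Bu \<union> Bw) b"
      proof (cases "b \<in> Bu \<union> Bw")
        case True
        have "f b powr p \<le> 1" using powr_mono2[of p "f b" 1] f01[OF b] p by simp
        then show ?thesis using True by (simp add: add_increasing)
      next
        case False
        have "f b powr p \<le> V powr p" using powr_mono2[of p "f b" V] f01[OF b] good[OF b False] p by simp
        then show ?thesis using False by simp
      qed
    qed simp
    also have "\<dots> = V powr p + measure (uniform_sphere n) (Bu \<union> Bw)"
      using sets by (subst Bochner_Integration.integral_add) (auto simp: U.prob_space ind)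
    also have "\<dots> \<le> V powr p + (6 / M ^ 3) powr p" using bad by simp
    also have "\<dots> \<le> (V + 6 / M ^ 3) powr p" by (rule powr_superadditive) (use V M p in auto)
    finally have "(\<integral>b. f b powr p \<partial>uniform_sphere n) powr (1 / p) \<le> ((V + 6 / M ^ 3) powr p) powr (1 / p)"
      using int0 p by (intro powr_mono2) auto
    also have "\<dots> = V + 6 / M ^ 3" using p V M by (simp add: powr_powr)
    also have "\<dots> \<le> 0.068 * (\<kappa> + 1) * (L\<^sup>2 / M\<^sup>2)"
    proof -
      define l where "l = L\<^sup>2 / M\<^sup>2"
      define j where "j = 1 / M\<^sup>2"
      have j: "0 \<le> j" unfolding j_def by simp
      have "20\<^sup>2 \<le> L\<^sup>2" using L by (intro power_mono) auto
      then have l: "400 * j \<le> l" unfolding l_def j_def by (simp add: divide_right_mono)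
      have "6 / M ^ 3 \<le> 6 / (9 * M\<^sup>2)"
        using M by (intro divide_left_mono) (auto simp: power3_eq_cube power2_eq_square)
      moreover have "6 / (9 * M\<^sup>2) = 2 / 3 * j" unfolding j_def by simp
      ultimately have s: "6 / M ^ 3 \<le> j" using j by linarith
      have V': "V = (\<kappa> + 1) * (l / 16 + j)"
        unfolding V_def r_def l_def j_def by (simp add: power_divide power_mult_distrib)
      have "(\<kappa> + 1) * (l / 16 + j) + j \<le> (\<kappa> + 1) * (l / 16 + 2 * j)"
      proof -
        have "0 \<le> \<kappa> * j" using \<kappa> j by simp
        then show ?thesis by (simp add: algebra_simps)
      qed
      also have "\<dots> \<le> (\<kappa> + 1) * (0.068 * l)" using \<kappa> l j by (intro mult_left_mono) auto
      finally show ?thesis unfolding V' l_def[symmetric] using s by (simp add: mult_ac)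
    qed
    finally show ?thesis .
  qed
  then show ?thesis unfolding f_def \<kappa>_def L_def M_def .
qed

lemma lanczos_upper_bound:
  assumes \<kappa>: "1 \<le> \<kappa>" and n: "100 \<le> n" and m: "10 \<le> m" and p: "1 \<le> p"
  shows "(SUP A \<in> {A \<in> spd_mats n. cond_num A = \<kappa>}.
         (\<integral>b. ((cond_num A - lanczos_cond A b m) / cond_num A) powr p \<partial>uniform_sphere n)
           powr (1 / p))
      \<le> 0.068 * (\<kappa> + 1) * ((ln (real n * (real m - 1) powr (8 * p)))\<^sup>2 / (real m - 1)\<^sup>2)"
proof (rule cSUP_least)
  \<comment> \<open>With clusters of size \<open>0\<close> the construction still provides a matrix of condition number \<open>\<kappa>\<close>.\<close>
  have "0 * 1 + 2 \<le> n" using n by simp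
  then show "{A \<in> spd_mats n. cond_num A = \<kappa>} \<noteq> {}"
    by (rule lanczos_hard_instance[OF \<kappa> _ _ _ _ _ refl refl, where m = 1 and \<tau> = "1 / 4" and t = "1 / 2"])
      auto
  fix A assume "A \<in> {A \<in> spd_mats n. cond_num A = \<kappa>}"
  then show "(\<integral>b. ((cond_num A - lanczos_cond A b m) / cond_num A) powr p \<partial>uniform_sphere n) powr (1 / p)
      \<le> 0.068 * (\<kappa> + 1) * ((ln (real n * (real m - 1) powr (8 * p)))\<^sup>2 / (real m - 1)\<^sup>2)"
    using lanczos_moment_bound[OF _ n m p, of A] by auto
qed

theorem corollary5p3:
  fixes \<kappa> :: real
  assumes "1 \<le> \<kappa>"
  shows
  "(\<forall>m :: nat \<Rightarrow> nat. (\<forall>n. 0 < m n) \<longrightarrow>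
      (\<lambda>n. real (m n)) \<in> o(\<lambda>n. ln (real n)) \<longrightarrow>
      (\<exists>(\<epsilon> :: nat \<Rightarrow> real) (\<eta> :: nat \<Rightarrow> real).
        \<epsilon> \<longlonglongrightarrow> 0 \<and> (\<lambda>n. real n * \<eta> n) \<longlonglongrightarrow> 0 \<and>
        (\<forall>\<^sub>F n in sequentially.
          (SUP A \<in> {A \<in> spd_mats n. cond_num A = \<kappa>}.
             measure (uniform_sphere n) {b \<in> space (uniform_sphere n).
               (cond_num A - lanczos_cond A b (m n)) / lanczos_cond A b (m n)
                 \<ge> (1 - \<epsilon> n) * (\<kappa> - 1)})
          \<ge> 1 - \<eta> n)))
   \<and>
   (\<forall>m :: nat \<Rightarrow> nat. (\<forall>n. 0 < m n) \<longrightarrow>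
      (\<lambda>n. real (m n)) \<in> \<Theta>(\<lambda>n. ln (real n)) \<longrightarrow>
      (\<exists>\<eta> :: nat \<Rightarrow> real.
        (\<lambda>n. real n * \<eta> n) \<longlonglongrightarrow> 0 \<and>
        (\<forall>\<^sub>F n in sequentially.
          (SUP A \<in> {A \<in> spd_mats n. cond_num A = \<kappa>}.
             measure (uniform_sphere n) {b \<in> space (uniform_sphere n).
               (cond_num A - lanczos_cond A b (m n)) / lanczos_cond A b (m n)
                 \<ge> 0.015 * ((\<kappa> - 1) * (ln (real n))\<^sup>2
                      / ((real (m n))\<^sup>2 * (ln (ln (real n)))\<^sup>2))})
          \<ge> 1 - \<eta> n)))
   \<and>
   (\<forall>m :: nat \<Rightarrow> nat. (\<forall>n. 0 < m n) \<longrightarrow>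
      (\<lambda>n. real (m n)) \<in> o(\<lambda>n. real n powr (1/2) * ln (real n) powr (-1/2)) \<longrightarrow>
      (\<lambda>n. real (m n)) \<in> \<omega>(\<lambda>n. 1) \<longrightarrow>
      (\<exists>\<eta> :: nat \<Rightarrow> real.
        (\<lambda>n. real n * \<eta> n) \<longlonglongrightarrow> 0 \<and>
        (\<forall>\<^sub>F n in sequentially.
          (SUP A \<in> {A \<in> spd_mats n. cond_num A = \<kappa>}.
             measure (uniform_sphere n) {b \<in> space (uniform_sphere n).
               (cond_num A - lanczos_cond A b (m n)) / lanczos_cond A b (m n)
                 \<ge> 1.08 * ((\<kappa> - 1) / (real (m n))\<^sup>2)})
          \<ge> 1 - \<eta> n)))
   \<and>
   (\<forall>(n :: nat) (m :: nat) (p :: real). 100 \<le> n \<longrightarrow> 10 \<le> m \<longrightarrow> 1 \<le> p \<longrightarrow>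
      (SUP A \<in> {A \<in> spd_mats n. cond_num A = \<kappa>}.
         (\<integral>b. ((cond_num A - lanczos_cond A b m) / cond_num A) powr p \<partial>uniform_sphere n)
           powr (1 / p))
      \<le> 0.068 * (\<kappa> + 1) * ((ln (real n * (real m - 1) powr (8 * p)))\<^sup>2 / (real m - 1)\<^sup>2))"
  using lower_bound_log_small[OF assms] lower_bound_log[OF assms]
    lower_bound_polynomial[OF assms] lanczos_upper_bound[OF assms]
  unfolding sup_error_prob_def
  by (intro conjI allI impI) simp_all

end
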